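(* Let $(\mathcal A,(\mathcal A_t)_{t\ge0},\mathbb E_{\mathcal A})$, $(\mathcal B,(\mathcal B_t)_{t\ge0},\mathbb E_{\mathcal B})$, $(\mathcal C,(\mathcal C_t)_{t\ge0},\mathbb E_{\mathcal C})$ be filtered $\mathrm C^*$-probability spaces. If $X:\mathbb R_+\to\mathcal A$ and $Y:\mathbb R_+\to\mathcal B$ are $L^\infty$-decomposable processes and $\Lambda\in\mathrm Q_0(\mathcal A\times\mathcal B;\mathcal C)$, then, as the mesh $|\Pi|$ of partitions $\Pi$ of $\mathbb R_+$ tends to $0$, the processes $$t\mapsto\mathrm{RS}^{X,Y}_\Pi(\Lambda)(t)=\sum_{s\in\Pi}\Lambda(s_-)\big[X(s\wedge t)-X(s_-\wedge t),\,Y(s\wedge t)-Y(s_-\wedge t)\big]$$ converge in $L^2(\mathbb E_{\mathcal C})$, uniformly on compact subsets of $\mathbb R_+$, to the process $$t\mapsto\Lambda(t)[X(t),Y(t)]-\Lambda(0)[X(0),Y(0)]-\int_0^td\Lambda(s)[X(s),Y(s)]-\int_0^t\Lambda(s)[dX(s),Y(s)]-\int_0^t\Lambda(s)[X(s),dY(s)].$$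
   Context: A $\mathrm C^*$-probability space $(\mathcal A,\mathbb E)$ is a unital $\mathrm C^*$-algebra with a faithful tracial state. For $p\in[1,\infty)$, $\|a\|_p=\mathbb E[|a|^p]^{1/p}$, $L^p(\mathcal A,\mathbb E)=L^p(\mathbb E)$ is the $\|\cdot\|_p$-completion of $\mathcal A$; $L^\infty(\mathbb E):=\mathcal A$ with the $\mathrm C^*$-norm. A filtration is an increasing family $(\mathcal A_t)_{t\ge0}$ of unital norm-closed $*$-subalgebras; $\mathbb E[a\mid\mathcal N]\in L^1(\mathcal N,\mathbb E)$ is the trace-preserving conditional expectation ($\mathbb E[b_0\mathbb E[a\mid\mathcal N]]=\mathbb E[b_0a]$ for $b_0\in\mathcal N$). Bilinear means real-bilinear. $X:\mathbb R_+\to\mathcal A$ is $L^\infty$-decomposable if it is adapted ($X(t)\in\mathcal A_t$) and $X=X(0)+M+A$ with $M$ a norm-continuous martingale ($M(t)\in\mathcal A_t$, $\mathbb E[M(t)\mid\mathcal A_s]=M(s)$ for $s\le t$), $A$ adapted, norm-continuous, of locally bounded variation in norm, and $M(0)=A(0)=0$. For bilinear $\Lambda:\mathcal A\times\mathcal B\to\mathcal C$, $|||\Lambda|||_2=\sup\{\|\Lambda[x,y]\|_r:p,q,r\in[1,\infty],\ \frac1p+\frac1q=\frac1r,\ \|x\|_p\le1,\|y\|_q\le1\}$; $\mathbb B_2=\mathbb B_2(\mathcal A\times\mathcal B;\mathcal C)$ is the space of those with $|||\Lambda|||_2<\infty$; they extend to bounded bilinear maps $L^p\times L^q\to L^r$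 when $\frac1p+\frac1q\le\frac1r$. A process $\Lambda:\mathbb R_+\to\mathbb B_2$ is adapted if for all $u\ge t\ge0$: $\Lambda(t)[\mathcal A_u,\mathcal B_u]\subseteq\mathcal C_u$; $\mathbb E_{\mathcal C}[\Lambda(t)[x,y]\mid\mathcal C_u]=\Lambda(t)[\mathbb E_{\mathcal A}[x\mid\mathcal A_u],y]$ for $x\in L^2(\mathbb E_{\mathcal A})$, $y\in L^2(\mathcal B_u,\mathbb E_{\mathcal B})$; and $\mathbb E_{\mathcal C}[\Lambda(t)[x,y]\mid\mathcal C_u]=\Lambda(t)[x,\mathbb E_{\mathcal B}[y\mid\mathcal B_u]]$ for $x\in L^2(\mathcal A_u,\mathbb E_{\mathcal A})$, $y\in L^2(\mathbb E_{\mathcal B})$. $\mathrm Q_0(\mathcal A\times\mathcal B;\mathcal C)$ is the set of adapted $\Lambda:\mathbb R_+\to\mathbb B_2$ that are left-continuous and of locally bounded variation with respect to $|||\cdot|||_2$. A partition of $\mathbb R_+$ is $\Pi=\{0=t_0<t_1<\cdots\}$ with $t_n\to\infty$; $s_-$ is the left neighbour of $s\in\Pi$ ($0_-:=0$), $|\Pi|=\sup_{s\in\Pi}(s-s_-)$; $a\wedge b=\min\{a,b\}$. $\int_0^td\Lambda(s)[X(s),Y(s)]$ is the Riemann–Stieltjes integral of $s\mapsto(T\mapsto T[X(s),Y(s)])$ against the integrator $\Lambda$. $\int_0^t\Lambda(s)[dX(s),Y(s)]$ is the stochastic integral against $X$ of the $B(L^2(\mathbb E_{\mathcal A});L^2(\mathbb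 E_{\mathcal C}))$-valued process $s\mapsto\Lambda(s)[\,\cdot\,,Y(s)]$, which equals the $L^2$-limit, locally uniform in $t$, of $\sum_{s\in\Pi}\Lambda(s_-)[X(s\wedge t)-X(s_-\wedge t),Y(s_-)]$ as $|\Pi|\to0$; $\int_0^t\Lambda(s)[X(s),dY(s)]$ is defined analogously as the limit of $\sum_{s\in\Pi}\Lambda(s_-)[X(s_-),Y(s\wedge t)-Y(s_-\wedge t)]$. *)

theory Defs
  imports "HOL-Analysis.Analysis" "HOL-Computational_Algebra.Polynomial"
begin

class cstar_algebra = real_normed_algebra_1 + banach +
  fixes scaleC :: "complex \<Rightarrow> 'a \<Rightarrow> 'a"  (infixr "*\<^sub>C" 75)
    and star :: "'a \<Rightarrow> 'a"
  assumes scaleC_add_right: "c *\<^sub>C (x + y) = c *\<^sub>C x + c *\<^sub>C y"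
    and scaleC_add_left: "(c + d) *\<^sub>C x = c *\<^sub>C x + d *\<^sub>C x"
    and scaleC_scaleC: "c *\<^sub>C d *\<^sub>C x = (c * d) *\<^sub>C x"
    and scaleR_scaleC: "r *\<^sub>R x = complex_of_real r *\<^sub>C x"
    and mult_scaleC_left: "(c *\<^sub>C x) * y = c *\<^sub>C (x * y)"
    and mult_scaleC_right: "x * (c *\<^sub>C y) = c *\<^sub>C (x * y)"
    and norm_scaleC: "norm (c *\<^sub>C x) = cmod c * norm x"
    and star_add: "star (x + y) = star x + star y"
    and star_scaleC: "star (c *\<^sub>C x) = cnj c *\<^sub>C star x"
    and star_mult: "star (x * y) = star y * star x"
    and star_star: "star (star x) = x"
    and cstar_identity: "norm (star x * x) = (norm x)\<^sup>2"

definition spectrum :: "'a::cstar_algebra \<Rightarrow> complex set" where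
  "spectrum a = {z. \<not> (\<exists>b. b * (z *\<^sub>C 1 - a) = 1 \<and> (z *\<^sub>C 1 - a) * b = 1)}"

definition poly_at :: "real poly \<Rightarrow> 'a::cstar_algebra \<Rightarrow> 'a" where
  "poly_at q a = (\<Sum>i\<le>degree q. coeff q i *\<^sub>R a ^ i)"

text \<open>Continuous functional calculus \<open>f(a)\<close> of a self-adjoint \<open>a\<close> (so that the spectrum is
  a compact set of reals) and a real function \<open>f\<close> that is continuous on the spectrum.\<close>

definition cfc :: "(real \<Rightarrow> real) \<Rightarrow> 'a::cstar_algebra \<Rightarrow> 'a" where
  "cfc f a = (THE c. \<forall>q. uniform_limit {x. complex_of_real x \<in> spectrum a}
                            (\<lambda>n. poly (q n)) f sequentially
                       \<longrightarrow> (\<lambda>n. poly_at (q n) a) \<longlonglongrightarrow> c)"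

definition cstar_abs :: "'a::cstar_algebra \<Rightarrow> 'a" where
  "cstar_abs a = cfc sqrt (star a * a)"

definition unital_closed_star_subalgebra :: "'a::cstar_algebra set \<Rightarrow> bool" where
  "unital_closed_star_subalgebra N \<longleftrightarrow>
     1 \<in> N \<and> (\<forall>x\<in>N. \<forall>y\<in>N. x + y \<in> N) \<and> (\<forall>x\<in>N. \<forall>y\<in>N. x * y \<in> N) \<and>
     (\<forall>c. \<forall>x\<in>N. c *\<^sub>C x \<in> N) \<and> (\<forall>x\<in>N. star x \<in> N) \<and> closed N"

locale cstar_probability_space =
  fixes E :: "'a::cstar_algebra \<Rightarrow> complex"
  assumes E_add: "E (x + y) = E x + E y"
    and E_scaleC: "E (c *\<^sub>C x) = c * E x"
    and E_one: "E 1 = 1"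
    and E_positive: "E (star x * x) \<in> \<real> \<and> Re (E (star x * x)) \<ge> 0"
    and E_faithful: "E (star x * x) = 0 \<Longrightarrow> x = 0"
    and E_tracial: "E (x * y) = E (y * x)"

locale filtered_cstar_probability_space = cstar_probability_space E
  for E :: "'a::cstar_algebra \<Rightarrow> complex" +
  fixes F :: "real \<Rightarrow> 'a set"
  assumes F_subalgebra: "t \<ge> 0 \<Longrightarrow> unital_closed_star_subalgebra (F t)"
    and F_mono: "0 \<le> s \<Longrightarrow> s \<le> t \<Longrightarrow> F s \<subseteq> F t"

definition pnorm :: "('a::cstar_algebra \<Rightarrow> complex) \<Rightarrow> ereal \<Rightarrow> 'a \<Rightarrow> real" where
  "pnorm E p a =
     (if p = \<infinity> then norm a
      else Re (E (cfc (\<lambda>x. x powr real_of_ereal p) (cstar_abs a))) powr (1 / real_of_ereal p))"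

text \<open>The completion of a vector space for a norm \<open>\<nu>\<close> other than its type class norm is realised
  as the set of classes of \<open>\<nu>\<close>-Cauchy sequences modulo \<open>\<nu>\<close>-null sequences.  Operations are
  defined on representatives; the unions below are over equal sets whenever the operation is
  \<open>\<nu>\<close>-bounded.\<close>

definition cauchy_wrt :: "('a::real_vector \<Rightarrow> real) \<Rightarrow> (nat \<Rightarrow> 'a) \<Rightarrow> bool" where
  "cauchy_wrt \<nu> x \<longleftrightarrow> (\<forall>e>0. \<exists>N. \<forall>m\<ge>N. \<forall>n\<ge>N. \<nu> (x m - x n) < e)"

definition cmpl_class :: "('a::real_vector \<Rightarrow> real) \<Rightarrow> (nat \<Rightarrow> 'a) \<Rightarrow> (nat \<Rightarrow> 'a) set" where
  "cmpl_class \<nu> x = {y. cauchy_wrt \<nu> y \<and> (\<lambda>n. \<nu> (y n - x n)) \<longlonglongrightarrow> 0}"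

definition cmpl_embed :: "('a::real_vector \<Rightarrow> real) \<Rightarrow> 'a \<Rightarrow> (nat \<Rightarrow> 'a) set" where
  "cmpl_embed \<nu> a = cmpl_class \<nu> (\<lambda>_. a)"

definition cmpl_minus ::
  "('a::real_vector \<Rightarrow> real) \<Rightarrow> (nat \<Rightarrow> 'a) set \<Rightarrow> (nat \<Rightarrow> 'a) set \<Rightarrow> (nat \<Rightarrow> 'a) set" where
  "cmpl_minus \<nu> \<xi> \<eta> = (\<Union>x\<in>\<xi>. \<Union>y\<in>\<eta>. cmpl_class \<nu> (\<lambda>n. x n - y n))"

definition cmpl_norm :: "('a::real_vector \<Rightarrow> real) \<Rightarrow> (nat \<Rightarrow> 'a) set \<Rightarrow> real" where
  "cmpl_norm \<nu> \<xi> = (THE r. \<forall>x\<in>\<xi>. (\<lambda>n. \<nu> (x n)) \<longlonglongrightarrow> r)"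

definition cmpl_bilinear_ext ::
  "('c::real_vector \<Rightarrow> real) \<Rightarrow> ('a \<Rightarrow> 'b \<Rightarrow> 'c) \<Rightarrow>
   (nat \<Rightarrow> 'a) set \<Rightarrow> (nat \<Rightarrow> 'b) set \<Rightarrow> (nat \<Rightarrow> 'c) set" where
  "cmpl_bilinear_ext \<nu> T \<xi> \<eta> = (\<Union>x\<in>\<xi>. \<Union>y\<in>\<eta>. cmpl_class \<nu> (\<lambda>n. T (x n) (y n)))"

text \<open>\<open>Lp_sub E p N\<close> is the completion of the subalgebra \<open>N\<close>, as a subset of the completion of
  the whole algebra.\<close>

definition Lp_sub ::
  "('a::cstar_algebra \<Rightarrow> complex) \<Rightarrow> ereal \<Rightarrow> 'a set \<Rightarrow> (nat \<Rightarrow> 'a) set set" where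
  "Lp_sub E p N = {cmpl_class (pnorm E p) x |x. range x \<subseteq> N \<and> cauchy_wrt (pnorm E p) x}"

abbreviation Lp :: "('a::cstar_algebra \<Rightarrow> complex) \<Rightarrow> ereal \<Rightarrow> (nat \<Rightarrow> 'a) set set" where
  "Lp E p \<equiv> Lp_sub E p UNIV"

text \<open>\<open>\<eta> = E[\<xi> | N]\<close> for \<open>\<xi>\<close> in \<open>L\<^sup>p(E)\<close>.  Since \<open>a \<mapsto> E[b a]\<close> is continuous for the
  \<open>p\<close>-norm, the last clause says that the continuous extensions of this functional to
  \<open>L\<^sup>p(E)\<close> satisfy \<open>E[b \<eta>] = E[b \<xi>]\<close>.\<close>

definition has_cond_exp ::
  "('a::cstar_algebra \<Rightarrow> complex) \<Rightarrow> ereal \<Rightarrow> 'a set \<Rightarrow>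
   (nat \<Rightarrow> 'a) set \<Rightarrow> (nat \<Rightarrow> 'a) set \<Rightarrow> bool" where
  "has_cond_exp E p N \<xi> \<eta> \<longleftrightarrow> \<xi> \<in> Lp E p \<and> \<eta> \<in> Lp_sub E p N \<and>
     (\<forall>b\<in>N. \<forall>x\<in>\<xi>. \<forall>y\<in>\<eta>. (\<lambda>n. E (b * y n) - E (b * x n)) \<longlonglongrightarrow> 0)"

text \<open>Processes are functions on \<open>real\<close> whose values at negative times are irrelevant: the time set
  is \<open>{0..}\<close>.\<close>

definition adapted :: "(real \<Rightarrow> 'a set) \<Rightarrow> (real \<Rightarrow> 'a) \<Rightarrow> bool" where
  "adapted F X \<longleftrightarrow> (\<forall>t\<ge>0. X t \<in> F t)"

definition martingale ::
  "('a::cstar_algebra \<Rightarrow> complex) \<Rightarrow> (real \<Rightarrow> 'a set) \<Rightarrow> (real \<Rightarrow> 'a) \<Rightarrow> bool" where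
  "martingale E F M \<longleftrightarrow> adapted F M \<and>
     (\<forall>s t. 0 \<le> s \<and> s \<le> t \<longrightarrow>
        has_cond_exp E 1 (F s) (cmpl_embed (pnorm E 1) (M t)) (cmpl_embed (pnorm E 1) (M s)))"

definition locally_bounded_variation :: "('v::minus \<Rightarrow> ereal) \<Rightarrow> (real \<Rightarrow> 'v) \<Rightarrow> bool" where
  "locally_bounded_variation \<nu> G \<longleftrightarrow>
     (\<forall>T\<ge>0. \<exists>V::real. \<forall>n (u::nat \<Rightarrow> real).
        0 \<le> u 0 \<and> u n \<le> T \<and> (\<forall>i<n. u i \<le> u (Suc i)) \<longrightarrow>
        (\<Sum>i<n. \<nu> (G (u (Suc i)) - G (u i))) \<le> ereal V)"

definition Linf_decomposable ::
  "('a::cstar_algebra \<Rightarrow> complex) \<Rightarrow> (real \<Rightarrow> 'a set) \<Rightarrow> (real \<Rightarrow> 'a) \<Rightarrow> bool" where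
  "Linf_decomposable E F X \<longleftrightarrow> adapted F X \<and>
     (\<exists>M A. martingale E F M \<and> continuous_on {0..} M \<and>
            adapted F A \<and> continuous_on {0..} A \<and>
            locally_bounded_variation (\<lambda>a. ereal (norm a)) A \<and>
            M 0 = 0 \<and> A 0 = 0 \<and> (\<forall>t\<ge>0. X t = X 0 + M t + A t))"

definition bnorm2 ::
  "('a::cstar_algebra \<Rightarrow> complex) \<Rightarrow> ('b::cstar_algebra \<Rightarrow> complex) \<Rightarrow>
   ('c::cstar_algebra \<Rightarrow> complex) \<Rightarrow> ('a \<Rightarrow> 'b \<Rightarrow> 'c) \<Rightarrow> ereal" where
  "bnorm2 EA EB EC T =
     Sup {ereal (pnorm EC r (T x y)) |p q r x y.
            1 \<le> p \<and> 1 \<le> q \<and> 1 \<le> r \<and> 1 / p + 1 / q = 1 / r \<and>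
            pnorm EA p x \<le> 1 \<and> pnorm EB q y \<le> 1}"

text \<open>\<open>bilinear\<close> is real-bilinearity.\<close>

definition B2 ::
  "('a::cstar_algebra \<Rightarrow> complex) \<Rightarrow> ('b::cstar_algebra \<Rightarrow> complex) \<Rightarrow>
   ('c::cstar_algebra \<Rightarrow> complex) \<Rightarrow> ('a \<Rightarrow> 'b \<Rightarrow> 'c) set" where
  "B2 EA EB EC = {T. bilinear T \<and> bnorm2 EA EB EC T < \<infinity>}"

definition adapted_bilinear ::
  "('a::cstar_algebra \<Rightarrow> complex) \<Rightarrow> (real \<Rightarrow> 'a set) \<Rightarrow>
   ('b::cstar_algebra \<Rightarrow> complex) \<Rightarrow> (real \<Rightarrow> 'b set) \<Rightarrow>
   ('c::cstar_algebra \<Rightarrow> complex) \<Rightarrow> (real \<Rightarrow> 'c set) \<Rightarrow> (real \<Rightarrow> 'a \<Rightarrow> 'b \<Rightarrow> 'c) \<Rightarrow> bool" where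
  "adapted_bilinear EA FA EB FB EC FC L \<longleftrightarrow>
     (\<forall>t u. 0 \<le> t \<and> t \<le> u \<longrightarrow>
        (let ext = cmpl_bilinear_ext (pnorm EC 1) (L t) in
         (\<forall>x\<in>FA u. \<forall>y\<in>FB u. L t x y \<in> FC u) \<and>
         (\<forall>\<xi> \<xi>' \<upsilon>. has_cond_exp EA 2 (FA u) \<xi> \<xi>' \<and> \<upsilon> \<in> Lp_sub EB 2 (FB u) \<longrightarrow>
            has_cond_exp EC 1 (FC u) (ext \<xi> \<upsilon>) (ext \<xi>' \<upsilon>)) \<and>
         (\<forall>\<xi> \<upsilon> \<upsilon>'. \<xi> \<in> Lp_sub EA 2 (FA u) \<and> has_cond_exp EB 2 (FB u) \<upsilon> \<upsilon>' \<longrightarrow>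
            has_cond_exp EC 1 (FC u) (ext \<xi> \<upsilon>) (ext \<xi> \<upsilon>'))))"

definition Q0 ::
  "('a::cstar_algebra \<Rightarrow> complex) \<Rightarrow> (real \<Rightarrow> 'a set) \<Rightarrow>
   ('b::cstar_algebra \<Rightarrow> complex) \<Rightarrow> (real \<Rightarrow> 'b set) \<Rightarrow>
   ('c::cstar_algebra \<Rightarrow> complex) \<Rightarrow> (real \<Rightarrow> 'c set) \<Rightarrow> (real \<Rightarrow> 'a \<Rightarrow> 'b \<Rightarrow> 'c) set" where
  "Q0 EA FA EB FB EC FC =
     {L. (\<forall>t\<ge>0. L t \<in> B2 EA EB EC) \<and> adapted_bilinear EA FA EB FB EC FC L \<and>
         (\<forall>t>0. ((\<lambda>s. bnorm2 EA EB EC (L s - L t)) \<longlongrightarrow> 0) (at_left t)) \<and>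
         locally_bounded_variation (bnorm2 EA EB EC) L}"

text \<open>A partition of \<open>{0..}\<close> is given by its increasing enumeration \<open>\<pi>\<close>.  The left neighbour of
  \<open>\<pi> n\<close> is \<open>\<pi> (n - 1)\<close>: truncated subtraction yields the convention \<open>0\<^sub>- = 0\<close>.\<close>

definition is_partition :: "(nat \<Rightarrow> real) \<Rightarrow> bool" where
  "is_partition \<pi> \<longleftrightarrow> \<pi> 0 = 0 \<and> strict_mono \<pi> \<and> filterlim \<pi> at_top sequentially"

definition mesh :: "(nat \<Rightarrow> real) \<Rightarrow> ereal" where
  "mesh \<pi> = (SUP n. ereal (\<pi> n - \<pi> (n - 1)))"

text \<open>Convergence of processes \<open>S \<pi>\<close> with values in the algebra to an \<open>L\<^sup>p\<close>-valued process \<open>Z\<close>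
  in \<open>L\<^sup>p\<close>, uniformly on compact time sets, as the mesh of \<open>\<pi>\<close> tends to \<open>0\<close>.\<close>

definition Lp_mesh_limit ::
  "('c::cstar_algebra \<Rightarrow> complex) \<Rightarrow> ereal \<Rightarrow> ((nat \<Rightarrow> real) \<Rightarrow> real \<Rightarrow> 'c) \<Rightarrow>
   (real \<Rightarrow> (nat \<Rightarrow> 'c) set) \<Rightarrow> bool" where
  "Lp_mesh_limit E p S Z \<longleftrightarrow> (\<forall>t\<ge>0. Z t \<in> Lp E p) \<and>
     (\<forall>T\<ge>0. \<forall>e>0. \<exists>d>0. \<forall>\<pi>. is_partition \<pi> \<and> mesh \<pi> < ereal d \<longrightarrow>
        (\<forall>t\<in>{0..T}. cmpl_norm (pnorm E p)
           (cmpl_minus (pnorm E p) (cmpl_embed (pnorm E p) (S \<pi> t)) (Z t)) < e))"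

text \<open>In the series below, only finitely many terms are nonzero: the \<open>n\<close>-th one
  vanishes if \<open>t \<le> \<pi> (n - 1)\<close>.\<close>

definition RS ::
  "(real \<Rightarrow> 'a \<Rightarrow> 'b \<Rightarrow> 'c) \<Rightarrow> (real \<Rightarrow> 'a::cstar_algebra) \<Rightarrow> (real \<Rightarrow> 'b::cstar_algebra) \<Rightarrow>
   (nat \<Rightarrow> real) \<Rightarrow> real \<Rightarrow> 'c::cstar_algebra" where
  "RS L X Y \<pi> t =
     (\<Sum>n. L (\<pi> (n - 1)) (X (min (\<pi> n) t) - X (min (\<pi> (n - 1)) t))
                         (Y (min (\<pi> n) t) - Y (min (\<pi> (n - 1)) t)))"

text \<open>\<open>I t = \<integral>\<^sub>0\<^sup>t H(s)[dX(s)]\<close> for all \<open>t \<ge> 0\<close>, for a process \<open>H\<close> of linear maps, as the locally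
  uniform limit in \<open>L\<^sup>2\<close> of left-endpoint sums.  As a limit, \<open>I\<close> is unique on \<open>{0..}\<close>.\<close>

definition has_stoch_integral ::
  "('c::cstar_algebra \<Rightarrow> complex) \<Rightarrow> (real \<Rightarrow> 'a \<Rightarrow> 'c) \<Rightarrow> (real \<Rightarrow> 'a::cstar_algebra) \<Rightarrow>
   (real \<Rightarrow> (nat \<Rightarrow> 'c) set) \<Rightarrow> bool" where
  "has_stoch_integral E H X I \<longleftrightarrow>
     Lp_mesh_limit E 2
       (\<lambda>\<pi> t. \<Sum>n. H (\<pi> (n - 1)) (X (min (\<pi> n) t) - X (min (\<pi> (n - 1)) t))) I"

text \<open>Norm-convergent Riemann--Stieltjes integral over \<open>{a..b}\<close> of an operator-valued integrand
  \<open>G\<close> against the integrator \<open>g\<close>: the limit of the sums of \<open>G(\<tau>\<^sub>i)(g(u\<^sub>i\<^sub>+\<^sub>1) - g(u\<^sub>i))\<close>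
  over tagged partitions of \<open>{a..b}\<close>.\<close>

definition has_RS_integral ::
  "(real \<Rightarrow> 'v::minus \<Rightarrow> 'w::real_normed_vector) \<Rightarrow> (real \<Rightarrow> 'v) \<Rightarrow> real \<Rightarrow> real \<Rightarrow> 'w \<Rightarrow> bool" where
  "has_RS_integral G g a b c \<longleftrightarrow>
     (\<forall>e>0. \<exists>d>0. \<forall>n u \<tau>.
        u 0 = a \<and> u n = b \<and>
        (\<forall>i<n. u i < u (Suc i) \<and> u (Suc i) - u i < d \<and> \<tau> i \<in> {u i..u (Suc i)}) \<longrightarrow>
        norm ((\<Sum>i<(n::nat). G (\<tau> i) (g (u (Suc i)) - g (u i))) - c) < e)"

end

theory Submission
  imports Defs "HOL-Computational_Algebra.Fundamental_Theorem_Algebra"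
begin

text \<open>
  On a cell \<open>{r..s}\<close> of a partition the increment of \<open>t \<mapsto> L t [X t, Y t]\<close> is the sum of
  \<open>(L s - L r) [X s, Y s]\<close>, \<open>L r [\<Delta>X, \<Delta>Y]\<close>, \<open>L r [\<Delta>X, Y r]\<close> and
  \<open>L r [X r, \<Delta>Y]\<close> (\<open>product_rule_sum\<close>).  Summed over the cells, this expresses the
  quadratic sums by a boundary term, a Riemann--Stieltjes sum with integrator \<open>L\<close>, and the
  left-endpoint sums of the two stochastic integrals.  So it suffices that these three kinds of
  sums converge, uniformly on compact time sets; the formula for the limit is then the limit of an
  identity (\<open>Lp_mesh_limit_combine\<close>).

  The Riemann--Stieltjes sums converge in the norm of the algebra because \<open>X\<close> and \<open>Y\<close> are norm
  continuous and \<open>L\<close> has locally bounded variation (\<open>rs_limit_uniform\<close>,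
  \<open>diagonal_riemann_sums\<close>).

  For the left-endpoint sums of \<open>L s [dX s, Y s]\<close>, the second argument is approximated by a step
  process \<open>s \<mapsto> Y (h \<lfloor>s/h\<rfloor>)\<close>, which is adapted and uniformly close to \<open>Y\<close>.  The error is
  small in the two-norm, uniformly over all partitions (\<open>decomposable_sum_bound\<close>): for the
  martingale part of \<open>X\<close> the summands are orthogonal by adaptedness of \<open>L\<close>, which yields the
  Ito estimate (\<open>martingale_sum_bound\<close>), and the part of bounded variation is estimated term by
  term.  With the step process inserted, \<open>s \<mapsto> L s [\<cdot>, Y (h \<lfloor>s/h\<rfloor>)]\<close> itself has bounded
  variation, and summation by parts reduces the sums to Riemann--Stieltjes sums
  (\<open>step_sums_converge\<close>).  Exchanging the roles of \<open>X\<close> and \<open>Y\<close> gives the other integral.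

  All of this lives in the pre-Hilbert norm \<open>\<parallel>a\<parallel>\<^sub>2 = \<tau>(a\<^sup>* a)\<^sup>1\<^sup>/\<^sup>2\<close> of a faithful trace
  \<open>\<tau>\<close>, whereas the \<open>p\<close>-norms are given by functional calculus.  The identification at
  \<open>p = 2\<close> (\<open>pnorm_2\<close>) needs the functional calculus of self-adjoint elements, and that rests on
  two facts about a self-adjoint \<open>b\<close>: its spectrum is real, and it contains \<open>\<parallel>b\<parallel>\<close> or
  \<open>-\<parallel>b\<parallel>\<close> (\<open>self_adjoint_norm_in_spectrum\<close>).  Positivity of \<open>a\<^sup>* a\<close> is obtained from
  the faithful trace (\<open>negative_part_star_mult_self\<close>).
\<close>

section \<open>Spectra of self-adjoint elements\<close>

lemma scaleC_zero_right [simp]: "c *\<^sub>C (0::'a::cstar_algebra) = 0"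
  using scaleC_add_right[of c 0 "0::'a"] by simp

lemma scaleC_zero_left [simp]: "0 *\<^sub>C (x::'a::cstar_algebra) = 0"
  using scaleC_add_left[of 0 0 x] by simp

lemma scaleC_one [simp]: "1 *\<^sub>C (x::'a::cstar_algebra) = x"
  using scaleR_scaleC[of 1 x] by simp

lemma scaleC_minus_left: "(- c) *\<^sub>C (x::'a::cstar_algebra) = - (c *\<^sub>C x)"
  using scaleC_add_left[of c "-c" x] by (simp add: eq_neg_iff_add_eq_0 add.commute)

lemma scaleC_minus_right: "c *\<^sub>C (- x::'a::cstar_algebra) = - (c *\<^sub>C x)"
  using scaleC_add_right[of c x "-x"] by (simp add: eq_neg_iff_add_eq_0 add.commute)

lemma scaleC_diff_left: "(c - d) *\<^sub>C (x::'a::cstar_algebra) = c *\<^sub>C x - d *\<^sub>C x"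
  using scaleC_add_left[of c "-d" x] by (simp add: scaleC_minus_left)

lemma scaleC_diff_right: "c *\<^sub>C (x - y::'a::cstar_algebra) = c *\<^sub>C x - c *\<^sub>C y"
  using scaleC_add_right[of c x "-y"] by (simp add: scaleC_minus_right)

lemma star_zero [simp]: "star (0::'a::cstar_algebra) = 0"
  using star_add[of 0 "0::'a"] by simp

lemma star_minus: "star (- x::'a::cstar_algebra) = - star x"
  using star_add[of x "-x"] by (simp add: eq_neg_iff_add_eq_0 add.commute)

lemma star_diff: "star (x - y::'a::cstar_algebra) = star x - star y"
  using star_add[of x "-y"] by (simp add: star_minus)

lemma star_one [simp]: "star (1::'a::cstar_algebra) = 1"
  using star_mult[of "star 1" "1::'a"] by (simp add: star_star)

lemma star_scaleR: "star (r *\<^sub>R x::'a::cstar_algebra) = r *\<^sub>R star x"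
  by (simp add: scaleR_scaleC star_scaleC)

lemma norm_star [simp]: "norm (star x) = norm (x::'a::cstar_algebra)"
proof -
  have le: "norm y \<le> norm (star y)" for y :: 'a
  proof (cases "y = 0")
    case False
    have "(norm y)\<^sup>2 \<le> norm (star y) * norm y"
      unfolding cstar_identity[symmetric] by (rule norm_mult_ineq)
    then show ?thesis using False by (simp add: power2_eq_square)
  qed simp
  show ?thesis using le[of x] le[of "star x"] by (simp add: star_star)
qed

lemma self_adjoint_norm_square:
  "star h = h \<Longrightarrow> norm (h * h) = (norm (h::'a::cstar_algebra))\<^sup>2"
  using cstar_identity[of h] by simp

lemma self_adjoint_power: "star h = h \<Longrightarrow> star (h ^ n) = (h::'a::cstar_algebra) ^ n"
  by (induction n) (simp_all add: star_mult power_commutes)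

definition unit_elt :: "'a::ring_1 \<Rightarrow> bool" where
  "unit_elt x \<longleftrightarrow> (\<exists>b. b * x = 1 \<and> x * b = 1)"

lemma spectrum_iff: "z \<in> spectrum a \<longleftrightarrow> \<not> unit_elt (z *\<^sub>C 1 - a)"
  by (simp add: spectrum_def unit_elt_def)

lemma unit_elt_mult: "unit_elt x \<Longrightarrow> unit_elt y \<Longrightarrow> unit_elt (x * y)"
proof -
  assume "unit_elt x" "unit_elt y"
  then obtain b c where "b * x = 1" "x * b = 1" "c * y = 1" "y * c = 1"
    unfolding unit_elt_def by blast
  then have "(c * b) * (x * y) = 1" "(x * y) * (c * b) = 1"
    by (metis mult.assoc mult.right_neutral)+
  then show ?thesis unfolding unit_elt_def by blast
qed

lemma unit_elt_scaleC:
  assumes "c \<noteq> 0" shows "unit_elt (c *\<^sub>C (x::'a::cstar_algebra)) \<longleftrightarrow> unit_elt x"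
proof -
  have imp: "unit_elt (d *\<^sub>C y)" if u: "unit_elt y" and "d \<noteq> 0" for d and y :: 'a
  proof -
    obtain b where "b * y = 1" "y * b = 1" using u unfolding unit_elt_def by blast
    then have "(inverse d *\<^sub>C b) * (d *\<^sub>C y) = 1" "(d *\<^sub>C y) * (inverse d *\<^sub>C b) = 1"
      using that by (simp_all add: mult_scaleC_left mult_scaleC_right scaleC_scaleC)
    then show ?thesis unfolding unit_elt_def by blast
  qed
  show ?thesis
    using imp[of x c] imp[of "c *\<^sub>C x" "inverse c"] assms by (auto simp: scaleC_scaleC)
qed

text \<open>The inverse is the Neumann series.\<close>

lemma unit_elt_one_minus:
  fixes x :: "'a::{real_normed_algebra_1,banach}"
  assumes "norm x < 1"
  shows "unit_elt (1 - x)"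
proof -
  have sm: "summable (\<lambda>n. x ^ n)"
    by (rule summable_comparison_test[of _ "\<lambda>n. norm x ^ n"])
      (use assms norm_power_ineq in \<open>auto intro: summable_geometric\<close>)
  define b where "b = (\<Sum>n. x ^ n)"
  have s: "(\<lambda>n. x ^ n) sums b" using sm b_def by (simp add: summable_sums)
  have s': "(\<lambda>n. x ^ Suc n) sums (b - 1)"
    using sums_Suc_iff[of "\<lambda>n. x ^ n"] s by simp
  have "x * b = b - 1"
    by (rule sums_unique2[OF _ s']) (use sums_mult[OF s, of x] in simp)
  moreover have "b * x = b - 1"
    by (rule sums_unique2[OF _ s']) (use sums_mult2[OF s, of x] in \<open>simp add: power_commutes\<close>)
  ultimately have "b * (1 - x) = 1" "(1 - x) * b = 1" by (simp_all add: algebra_simps)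
  then show ?thesis unfolding unit_elt_def by blast
qed

lemma spectrum_bound:
  assumes "z \<in> spectrum (a::'a::cstar_algebra)" shows "cmod z \<le> norm a"
proof (rule ccontr)
  assume "\<not> cmod z \<le> norm a"
  then have z: "z \<noteq> 0" "norm a < cmod z" by auto
  have "norm (inverse z *\<^sub>C a) < 1"
  proof -
    have "norm (inverse z *\<^sub>C a) = norm a / cmod z"
      by (simp add: norm_scaleC norm_inverse divide_inverse mult.commute)
    then show ?thesis using z by simp
  qed
  then have "unit_elt (z *\<^sub>C (1 - inverse z *\<^sub>C a))"
    using z by (simp add: unit_elt_scaleC unit_elt_one_minus)
  then show False using assms z by (simp add: spectrum_iff scaleC_diff_right scaleC_scaleC)
qed

text \<open>Translating \<open>h\<close> by \<open>i s\<close> moves \<open>x + i y\<close> to height \<open>y + s\<close>, while the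
  \<open>C\<^sup>*\<close>-identity only allows the norm to grow like \<open>sqrt (\<parallel>h\<parallel>\<^sup>2 + s\<^sup>2)\<close>; as
  \<open>s\<close> is arbitrary this forces \<open>y = 0\<close>.\<close>

lemma self_adjoint_spectrum_real:
  fixes h :: "'a::cstar_algebra"
  assumes h: "star h = h" and z: "z \<in> spectrum h"
  shows "Im z = 0"
proof -
  have key: "2 * Im z * s \<le> (norm h)\<^sup>2" for s :: real
  proof -
    let ?w = "\<i> * complex_of_real s"
    let ?g = "h + ?w *\<^sub>C 1"
    have "z + ?w \<in> spectrum ?g"
      using z by (simp add: spectrum_iff scaleC_add_left algebra_simps)
    then have "(cmod (z + ?w))\<^sup>2 \<le> (norm ?g)\<^sup>2"
      by (intro power_mono spectrum_bound) auto
    also have "\<dots> = norm (star ?g * ?g)" by (simp add: cstar_identity)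
    also have "star ?g * ?g = h * h + (s\<^sup>2) *\<^sub>R 1"
      by (simp add: star_add star_scaleC h algebra_simps mult_scaleC_left mult_scaleC_right
          scaleC_scaleC scaleR_scaleC scaleC_minus_left scaleC_diff_right power2_eq_square)
    also have "norm \<dots> \<le> (norm h)\<^sup>2 + s\<^sup>2"
      by (rule norm_triangle_le) (simp add: self_adjoint_norm_square h)
    also have "(cmod (z + ?w))\<^sup>2 = (Re z)\<^sup>2 + (Im z + s)\<^sup>2"
      by (simp add: cmod_power2)
    finally have "(Re z)\<^sup>2 + (Im z)\<^sup>2 + 2 * Im z * s \<le> (norm h)\<^sup>2"
      by (simp add: power2_sum)
    moreover have "0 \<le> (Re z)\<^sup>2 + (Im z)\<^sup>2" by simp
    ultimately show ?thesis by linarith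
  qed
  show ?thesis
  proof (rule ccontr)
    assume "Im z \<noteq> 0"
    with key[of "((norm h)\<^sup>2 + 1) / (2 * Im z)"] show False by simp
  qed
qed

text \<open>If neither \<open>1\<close> nor \<open>-1\<close> were in the spectrum of \<open>c\<close>, the resolvent
  \<open>F z = (1 - z c)\<^sup>-\<^sup>1\<close> would exist and be uniformly continuous on the closed unit disc, so
  that \<open>F u\<close> and \<open>F (t u)\<close> are close for \<open>|u| = 1\<close> and some \<open>t < 1\<close>.  Averaging over
  roots of unity (Rickart's argument, here for roots of order \<open>2\<^sup>k\<close> by repeated halving) turns
  \<open>F\<close> into the resolvent of \<open>c^(2^k)\<close> without spoiling that closeness.  As
  \<open>(t c)^(2^k)\<close> tends to \<open>0\<close>, the element \<open>c^(2^k)\<close> has norm less than \<open>1\<close> for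
  large \<open>k\<close>, against the \<open>C\<^sup>*\<close>-identity.\<close>

lemma norm_one_self_adjoint_spectrum:
  fixes c :: "'a::cstar_algebra"
  assumes c: "star c = c" and n1: "norm c = 1"
  shows "1 \<in> spectrum c \<or> -1 \<in> spectrum c"
proof (rule ccontr)
  assume "\<not> ?thesis"
  then have no1: "1 \<notin> spectrum c" "-1 \<notin> spectrum c" by auto
  have inv: "unit_elt (1 - z *\<^sub>C c)" if "cmod z \<le> 1" for z
  proof (cases "cmod z < 1")
    case True
    then show ?thesis by (intro unit_elt_one_minus) (simp add: norm_scaleC n1)
  next
    case False
    with that have z1: "cmod z = 1" by simp
    then have z0: "z \<noteq> 0" by auto
    have "inverse z \<notin> spectrum c"
    proof
      assume s: "inverse z \<in> spectrum c"
      then have "Im (inverse z) = 0" by (rule self_adjoint_spectrum_real[OF c])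
      then obtain r where r: "inverse z = complex_of_real r" by (metis complex_is_Real_iff of_real_Re)
      with z1 have "\<bar>r\<bar> = 1"
        by (metis norm_inverse norm_of_real inverse_1)
      with s no1 r show False by (auto simp: abs_if split: if_splits)
    qed
    then have "unit_elt (z *\<^sub>C (inverse z *\<^sub>C 1 - c))"
      using z0 by (simp add: unit_elt_scaleC spectrum_iff)
    then show ?thesis using z0 by (simp add: scaleC_diff_right scaleC_scaleC)
  qed
  \<comment> \<open>the resolvent on the closed unit disc\<close>
  define F where "F z = (SOME b. b * (1 - z *\<^sub>C c) = 1 \<and> (1 - z *\<^sub>C c) * b = 1)" for z
  have F: "F z * (1 - z *\<^sub>C c) = 1" "(1 - z *\<^sub>C c) * F z = 1" if "cmod z \<le> 1" for z
    using someI_ex[OF inv[OF that, unfolded unit_elt_def]] unfolding F_def by auto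
  \<comment> \<open>resolvent identity\<close>
  have Fdiff: "F z - F w = (z - w) *\<^sub>C (F z * c * F w)" if "cmod z \<le> 1" "cmod w \<le> 1" for z w
  proof -
    have "F z - F w = F z * ((1 - w *\<^sub>C c) * F w) - (F z * (1 - z *\<^sub>C c)) * F w"
      using F that by simp
    also have "\<dots> = F z * ((1 - w *\<^sub>C c) - (1 - z *\<^sub>C c)) * F w"
      by (simp add: algebra_simps)
    also have "(1 - w *\<^sub>C c) - (1 - z *\<^sub>C c) = (z - w) *\<^sub>C c" by (simp add: scaleC_diff_left)
    finally show ?thesis by (simp add: mult_scaleC_left mult_scaleC_right)
  qed
  have Fb: "norm (F z - F w) \<le> cmod (z - w) * norm (F z) * norm (F w)"
    if "cmod z \<le> 1" "cmod w \<le> 1" for z w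
  proof -
    have "norm (F z * c * F w) \<le> norm (F z * c) * norm (F w)" by (rule norm_mult_ineq)
    also have "\<dots> \<le> norm (F z) * norm (F w)"
      using norm_mult_ineq[of "F z" c] n1 by (intro mult_right_mono) auto
    finally have "cmod (z - w) * norm (F z * c * F w) \<le> cmod (z - w) * (norm (F z) * norm (F w))"
      by (intro mult_left_mono) auto
    then show ?thesis by (simp add: Fdiff[OF that] norm_scaleC mult.assoc)
  qed
  have cont: "continuous_on (cball 0 1) F"
    unfolding continuous_on_iff
  proof (intro ballI allI impI)
    fix w :: complex and e :: real assume w: "w \<in> cball 0 1" and e: "e > 0"
    define K where "K = norm (F w) + 1"
    have K: "K > 0" "norm (F w) \<le> K" by (auto simp: K_def add_nonneg_pos)
    \<comment> \<open>the first bound keeps \<open>\<parallel>F z\<parallel> \<le> 2 K\<close>, the second makes the increment at most \<open>e/2\<close>\<close>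
    define d where "d = min (1 / (2 * K)) (e / (4 * K\<^sup>2))"
    have d: "d > 0" using K e by (simp add: d_def)
    show "\<exists>d>0. \<forall>z\<in>cball 0 1. dist z w < d \<longrightarrow> dist (F z) (F w) < e"
    proof (intro exI conjI ballI impI)
      fix z assume z: "z \<in> cball 0 1" and dz: "dist z w < d"
      have zw: "cmod z \<le> 1" "cmod w \<le> 1" using z w by auto
      have dz': "cmod (z - w) \<le> 1 / (2 * K)" "cmod (z - w) \<le> e / (4 * K\<^sup>2)"
        using dz by (auto simp: d_def dist_norm)
      have "cmod (z - w) * norm (F z) * norm (F w) \<le> (1 / (2 * K)) * norm (F z) * K"
        using dz' K by (intro mult_mono) auto
      also have "\<dots> = norm (F z) / 2" using K by simp
      finally have "norm (F z - F w) \<le> norm (F z) / 2" using Fb[OF zw] by linarith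
      moreover have "norm (F z) \<le> norm (F w) + norm (F z - F w)" by norm
      ultimately have Fz: "norm (F z) \<le> 2 * K" using K by linarith
      have "cmod (z - w) * norm (F z) * norm (F w) \<le> (e / (4 * K\<^sup>2)) * (2 * K) * K"
        using dz' K Fz e by (intro mult_mono) auto
      also have "\<dots> = e / 2" using K by (simp add: power2_eq_square)
      finally show "dist (F z) (F w) < e" using Fb[OF zw] e by (simp add: dist_norm)
    qed (rule d)
  qed
  have "uniformly_continuous_on (cball 0 1) F"
    by (rule compact_uniformly_continuous[OF cont]) simp
  then obtain d where d: "d > 0"
    and dF: "\<And>z w. z \<in> cball 0 1 \<Longrightarrow> w \<in> cball 0 1 \<Longrightarrow> dist w z < d \<Longrightarrow> dist (F w) (F z) < 1/8"
    unfolding uniformly_continuous_on_def by (metis zero_less_divide_1_iff zero_less_numeral)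
  define t where "t = max (1/2) (1 - d/2)"
  have t: "0 < t" "t < 1" "1 - t < d" using d by (auto simp: t_def)
  let ?t = "complex_of_real t"
  have ex: "\<exists>G. (\<forall>z. cmod z \<le> 1 \<longrightarrow> G z * (1 - z ^ (2^k) *\<^sub>C c ^ (2^k)) = 1 \<and>
                   (1 - z ^ (2^k) *\<^sub>C c ^ (2^k)) * G z = 1) \<and>
              (\<forall>u. cmod u = 1 \<longrightarrow> norm (G u - G (?t * u)) \<le> 1/8)" for k
  proof (induction k)
    case 0
    have "norm (F u - F (?t * u)) \<le> 1/8" if u: "cmod u = 1" for u
    proof -
      have "dist u (?t * u) = cmod ((1 - ?t) * u)" by (simp add: dist_norm algebra_simps)
      also have "\<dots> = cmod (complex_of_real (1 - t))" by (simp add: norm_mult u)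
      also have "\<dots> = 1 - t" using t by (simp del: of_real_diff)
      finally have "dist u (?t * u) < d" using t by simp
      then show ?thesis using dF[of "?t * u" u] u t by (simp add: dist_norm norm_mult)
    qed
    then show ?case using F by (intro exI[of _ F]) simp
  next
    case (Suc k)
    then obtain G where G1: "\<And>z. cmod z \<le> 1 \<Longrightarrow> G z * (1 - z ^ (2^k) *\<^sub>C c ^ (2^k)) = 1"
      and G2: "\<And>z. cmod z \<le> 1 \<Longrightarrow> (1 - z ^ (2^k) *\<^sub>C c ^ (2^k)) * G z = 1"
      and G3: "\<And>u. cmod u = 1 \<Longrightarrow> norm (G u - G (?t * u)) \<le> 1/8"
      by blast
    define \<omega> where "\<omega> = cis (pi / 2 ^ k)"
    have w1: "cmod \<omega> = 1" by (simp add: \<omega>_def)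
    have w2: "\<omega> ^ (2 ^ k) = -1"
      by (simp add: \<omega>_def Complex.DeMoivre)
    \<comment> \<open>as \<open>\<omega>^(2^k) = -1\<close>, this averages the inverses of \<open>1 - x\<close> and \<open>1 + x\<close>,
        where \<open>x = (z c)^(2^k)\<close>\<close>
    define G' where "G' z = (1/2) *\<^sub>R (G z + G (\<omega> * z))" for z
    have "G' z * (1 - z ^ (2^Suc k) *\<^sub>C c ^ (2^Suc k)) = 1 \<and>
          (1 - z ^ (2^Suc k) *\<^sub>C c ^ (2^Suc k)) * G' z = 1" if z: "cmod z \<le> 1" for z
    proof -
      define x where "x = z ^ (2^k) *\<^sub>C c ^ (2^k)"
      have xx: "z ^ (2^Suc k) *\<^sub>C c ^ (2^Suc k) = x * x"
        by (simp add: x_def mult_scaleC_left mult_scaleC_right scaleC_scaleC mult_2 power_add)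
      have a: "G z * (1 - x) = 1" "(1 - x) * G z = 1" using G1[OF z] G2[OF z] by (simp_all add: x_def)
      have "cmod (\<omega> * z) \<le> 1" using z w1 by (simp add: norm_mult)
      from G1[OF this] G2[OF this] have b: "G (\<omega> * z) * (1 + x) = 1" "(1 + x) * G (\<omega> * z) = 1"
        by (simp_all add: x_def power_mult_distrib w2 scaleC_minus_left)
      have f: "1 - x * x = (1 - x) * (1 + x)" "1 - x * x = (1 + x) * (1 - x)"
        by (simp_all add: algebra_simps)
      have "(G z + G (\<omega> * z)) * (1 - x * x) = (G z * (1 - x)) * (1 + x) + (G (\<omega> * z) * (1 + x)) * (1 - x)"
        by (metis distrib_right f mult.assoc)
      then have l: "(G z + G (\<omega> * z)) * (1 - x * x) = 2" using a b by simp
      have "(1 - x * x) * (G z + G (\<omega> * z)) = (1 + x) * ((1 - x) * G z) + (1 - x) * ((1 + x) * G (\<omega> * z))"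
        by (metis distrib_left f mult.assoc)
      then have r: "(1 - x * x) * (G z + G (\<omega> * z)) = 2" using a b by simp
      have two: "(1/2) *\<^sub>R (2::'a) = 1"
        using scaleR_add_right[of "1/2" "1::'a" 1] by (simp flip: scaleR_add_left)
      show ?thesis unfolding xx G'_def mult_scaleR_left mult_scaleR_right l r two by simp
    qed
    moreover have "norm (G' u - G' (?t * u)) \<le> 1/8" if u: "cmod u = 1" for u
    proof -
      have "G' u - G' (?t * u) =
          (1/2) *\<^sub>R ((G u - G (?t * u)) + (G (\<omega> * u) - G (?t * (\<omega> * u))))"
        by (simp add: G'_def scaleR_right_diff_distrib[symmetric] algebra_simps)
      moreover have "norm ((G u - G (?t * u)) + (G (\<omega> * u) - G (?t * (\<omega> * u)))) \<le> 1/8 + 1/8"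
        using G3[OF u] G3[of "\<omega> * u"] u w1
        by (intro norm_triangle_mono) (simp_all add: norm_mult)
      ultimately show ?thesis by simp
    qed
    ultimately show ?case by blast
  qed
  have cn: "norm (c ^ (2 ^ k)) = 1" for k
  proof (induction k)
    case (Suc k)
    have "c ^ (2 ^ Suc k) = c ^ (2 ^ k) * c ^ (2 ^ k)" by (simp add: mult_2 power_add)
    then show ?case using Suc self_adjoint_norm_square[OF self_adjoint_power[OF c]] by simp
  qed (simp add: n1)
  have "(\<lambda>k. t ^ k) \<longlonglongrightarrow> 0" using t by (intro LIMSEQ_power_zero) simp
  then have "eventually (\<lambda>k. t ^ k < 1/5) sequentially" by (rule order_tendstoD) simp
  then obtain k where k: "t ^ k < 1/5" by (auto simp: eventually_sequentially)
  have "t ^ (2 ^ k) \<le> t ^ k" using t by (intro power_decreasing) auto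
  with k have tk: "t ^ (2 ^ k) < 1/5" by simp
  obtain G where G1: "\<And>z. cmod z \<le> 1 \<Longrightarrow> G z * (1 - z ^ (2^k) *\<^sub>C c ^ (2^k)) = 1"
    and G2: "\<And>u. cmod u = 1 \<Longrightarrow> norm (G u - G (?t * u)) \<le> 1/8"
    using ex[of k] by blast
  define y where "y = ?t ^ (2^k) *\<^sub>C c ^ (2^k)"
  have y: "norm y \<le> 1/5" using tk t by (simp add: y_def norm_scaleC cn norm_power)
  have "G ?t * (1 - y) = 1" using G1[of ?t] t by (simp add: y_def)
  then have Gt: "G ?t - 1 = G ?t * y" by (simp add: algebra_simps)
  have "norm (G ?t - 1) \<le> norm (G ?t) * norm y" unfolding Gt by (rule norm_mult_ineq)
  also have "\<dots> \<le> norm (G ?t) * (1/5)" using y by (intro mult_left_mono) auto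
  finally have "norm (G ?t - 1) \<le> norm (G ?t) / 5" by simp
  moreover have "norm (G ?t) \<le> 1 + norm (G ?t - 1)"
    using norm_triangle_sub[of "G ?t" 1] by simp
  ultimately have "norm (G ?t - 1) \<le> 1/4" by linarith
  moreover have "norm (G 1 - G ?t) \<le> 1/8" using G2[of 1] by simp
  moreover have "norm (G 1 - 1) \<le> norm (G 1 - G ?t) + norm (G ?t - 1)" by norm
  ultimately have G1': "norm (G 1 - 1) \<le> 3/8" by linarith
  define w where "w = c ^ (2 ^ k)"
  have w: "norm w = 1" by (simp add: w_def cn)
  have "G 1 * (1 - w) = 1" using G1[of 1] by (simp add: w_def)
  then have "w = (G 1 - 1) + (1 - G 1) * w" by (simp add: algebra_simps)
  then have "norm w \<le> norm (G 1 - 1) + norm ((1 - G 1) * w)" by (metis norm_triangle_ineq)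
  also have "norm ((1 - G 1) * w) \<le> norm (1 - G 1) * norm w" by (rule norm_mult_ineq)
  finally show False using G1' w by (simp add: norm_minus_commute)
qed

lemma self_adjoint_norm_in_spectrum:
  fixes b :: "'a::cstar_algebra"
  assumes b: "star b = b"
  shows "\<exists>r. \<bar>r\<bar> = norm b \<and> complex_of_real r \<in> spectrum b"
proof (cases "b = 0")
  case True
  then show ?thesis by (intro exI[of _ 0]) (simp add: spectrum_iff unit_elt_def)
next
  case False
  define c where "c = (1 / norm b) *\<^sub>R b"
  have cc: "star c = c" "norm c = 1" using False b by (simp_all add: c_def star_scaleR)
  obtain s where s: "\<bar>s\<bar> = 1" "complex_of_real s \<in> spectrum c"
    using norm_one_self_adjoint_spectrum[OF cc]
  proof
    assume "1 \<in> spectrum c" then show ?thesis using that[of 1] by simp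
  next
    assume "- 1 \<in> spectrum c" then show ?thesis using that[of "-1"] by simp
  qed
  have "complex_of_real (norm b) *\<^sub>C (complex_of_real s *\<^sub>C 1 - c)
      = complex_of_real (norm b * s) *\<^sub>C 1 - b"
    using False by (simp add: c_def scaleC_diff_right scaleC_scaleC scaleR_scaleC)
  then have "complex_of_real (norm b * s) \<in> spectrum b"
    using s False unit_elt_scaleC[of "complex_of_real (norm b)" "complex_of_real s *\<^sub>C 1 - c"]
    by (simp add: spectrum_iff)
  then show ?thesis using s by (intro exI[of _ "norm b * s"]) (simp add: abs_mult)
qed

section \<open>Continuous functional calculus\<close>

lemma poly_at_altdef:
  assumes "degree q \<le> N" shows "poly_at q a = (\<Sum>i\<le>N. coeff q i *\<^sub>R a ^ i)"
  unfolding poly_at_def using assms by (intro sum.mono_neutral_left) (auto simp: coeff_eq_0)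

lemma poly_at_pCons: "poly_at (pCons c p) a = c *\<^sub>R 1 + a * poly_at p a"
proof -
  have "poly_at (pCons c p) a = (\<Sum>i\<le>Suc (degree p). coeff (pCons c p) i *\<^sub>R a ^ i)"
    by (rule poly_at_altdef) (simp add: degree_pCons_le)
  also have "\<dots> = c *\<^sub>R 1 + a * poly_at p a"
    unfolding sum.atMost_Suc_shift by (simp add: poly_at_def sum_distrib_left)
  finally show ?thesis .
qed

lemma poly_at_0 [simp]: "poly_at 0 a = 0"
  by (simp add: poly_at_def)

lemma poly_at_smult: "poly_at (smult c p) a = c *\<^sub>R poly_at p a"
  by (subst poly_at_altdef[of _ "degree p"]) (simp_all add: poly_at_def scaleR_sum_right)

lemma poly_at_add: "poly_at (p + q) a = poly_at p a + poly_at q a"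
  by (simp add: poly_at_altdef[of _ "max (degree p) (degree q)"] degree_add_le_max
      scaleR_add_left sum.distrib)

lemma poly_at_diff: "poly_at (p - q) a = poly_at p a - poly_at q a"
  by (simp add: poly_at_altdef[of _ "max (degree p) (degree q)"] degree_diff_le_max
      scaleR_diff_left sum_subtractf)

lemma poly_at_mult: "poly_at (p * q) a = poly_at p a * poly_at q a"
  by (induction p) (simp_all add: poly_at_pCons poly_at_add poly_at_smult algebra_simps)

lemma star_poly_at:
  assumes "star h = h" shows "star (poly_at q h) = poly_at q h"
proof (induction q)
  case (pCons c q)
  have "h * poly_at q h = poly_at q h * h"
  proof (induction q)
    case (pCons c q)
    have "h * (h * poly_at q h) = (h * poly_at q h) * h"
      by (metis mult.assoc pCons.IH)
    then show ?case by (simp add: poly_at_pCons distrib_left distrib_right)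
  qed simp
  then show ?case using assms pCons by (simp add: poly_at_pCons star_add star_mult star_scaleR)
qed simp

definition cpoly_at :: "complex poly \<Rightarrow> 'a::cstar_algebra \<Rightarrow> 'a" where
  "cpoly_at q a = (\<Sum>i\<le>degree q. coeff q i *\<^sub>C a ^ i)"

lemma cpoly_at_altdef:
  assumes "degree q \<le> N" shows "cpoly_at q a = (\<Sum>i\<le>N. coeff q i *\<^sub>C a ^ i)"
  unfolding cpoly_at_def using assms by (intro sum.mono_neutral_left) (auto simp: coeff_eq_0)

lemma cpoly_at_linear_mult: "cpoly_at ([:- z, 1:] * q) a = (a - z *\<^sub>C 1) * cpoly_at q a"
proof -
  have scal: "c *\<^sub>C (\<Sum>i\<in>I. f i) = (\<Sum>i\<in>I. c *\<^sub>C f i)" for c and I :: "nat set" and f :: "nat \<Rightarrow> 'a"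
    by (induction I rule: infinite_finite_induct) (simp_all add: scaleC_add_right)
  have eq: "[:- z, 1:] * q = pCons 0 q - smult z q" by simp
  have d: "degree ([:- z, 1:] * q) \<le> Suc (degree q)"
    using degree_mult_le[of "[:-z, 1:]" q] by simp
  have "cpoly_at ([:- z, 1:] * q) a =
      (\<Sum>i\<le>Suc (degree q). coeff (pCons 0 q) i *\<^sub>C a ^ i) - (\<Sum>i\<le>Suc (degree q). (z * coeff q i) *\<^sub>C a ^ i)"
    unfolding cpoly_at_altdef[OF d] unfolding eq by (simp add: scaleC_diff_left sum_subtractf del: sum.atMost_Suc)
  also have "(\<Sum>i\<le>Suc (degree q). coeff (pCons 0 q) i *\<^sub>C a ^ i) = a * cpoly_at q a"
    unfolding sum.atMost_Suc_shift by (simp add: cpoly_at_def sum_distrib_left mult_scaleC_right)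
  also have "(\<Sum>i\<le>Suc (degree q). (z * coeff q i) *\<^sub>C a ^ i) = z *\<^sub>C cpoly_at q a"
    by (simp add: cpoly_at_altdef[of q "Suc (degree q)"] scal scaleC_scaleC scaleC_add_right)
  finally show ?thesis by (simp add: left_diff_distrib mult_scaleC_left)
qed

text \<open>A polynomial without zeros in the spectrum splits into linear factors, each of which is
  invertible at \<open>a\<close>.\<close>

lemma unit_elt_cpoly_at:
  fixes a :: "'a::cstar_algebra"
  assumes "q \<noteq> 0" and "\<And>z. poly q z = 0 \<Longrightarrow> z \<notin> spectrum a"
  shows "unit_elt (cpoly_at q a)"
  using assms
proof (induction "degree q" arbitrary: q)
  case 0
  then obtain c where q: "q = [:c:]" by (metis degree_eq_zeroE)
  with 0 have "c \<noteq> 0" by auto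
  moreover have "cpoly_at q a = c *\<^sub>C 1" by (simp add: q cpoly_at_def)
  ultimately show ?case by (simp add: unit_elt_scaleC) (simp add: unit_elt_def)
next
  case (Suc n)
  have "\<not> constant (poly q)" using Suc(2) by (simp add: constant_degree)
  then obtain z where z: "poly q z = 0" using fundamental_theorem_of_algebra by blast
  then obtain p where p: "q = [:- z, 1:] * p" by (metis poly_eq_0_iff_dvd dvdE)
  have p0: "p \<noteq> 0" using p Suc(3) by auto
  then have "degree q = Suc (degree p)" by (simp add: p degree_mult_eq del: mult_pCons_left)
  then have "n = degree p" using Suc(2) by simp
  moreover have "w \<notin> spectrum a" if "poly p w = 0" for w
    using Suc(4)[of w] that by (simp add: p)
  ultimately have "unit_elt (cpoly_at p a)" using Suc(1) p0 by blast
  moreover have "unit_elt (a - z *\<^sub>C 1)"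
  proof -
    have "unit_elt (z *\<^sub>C 1 - a)" using Suc(4)[OF z] by (simp add: spectrum_iff)
    then have "unit_elt ((-1) *\<^sub>C (z *\<^sub>C 1 - a))" by (subst unit_elt_scaleC) auto
    then show ?thesis by (simp add: scaleC_minus_left)
  qed
  ultimately show ?case unfolding p cpoly_at_linear_mult by (rule unit_elt_mult[rotated])
qed

definition real_spectrum :: "'a::cstar_algebra \<Rightarrow> real set" where
  "real_spectrum a = {x. complex_of_real x \<in> spectrum a}"

lemma real_spectrum_bound: "x \<in> real_spectrum a \<Longrightarrow> \<bar>x\<bar> \<le> norm a"
  using spectrum_bound[of "complex_of_real x" a] by (simp add: real_spectrum_def)

lemma poly_map_complex_of_real:
  "poly (map_poly complex_of_real q) (complex_of_real x) = complex_of_real (poly q x)"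
  by (induction q) (simp_all add: map_poly_pCons)

lemma spectral_mapping:
  fixes h :: "'a::cstar_algebra"
  assumes h: "star h = h" and l: "l \<in> real_spectrum (poly_at q h)"
  shows "\<exists>x\<in>real_spectrum h. poly q x = l"
proof (cases "[:l:] - q = 0")
  case True
  then have "q = [:l:]" by simp
  moreover obtain x where "x \<in> real_spectrum h"
    using self_adjoint_norm_in_spectrum[OF h] by (auto simp: real_spectrum_def)
  ultimately show ?thesis by (intro bexI[of _ x]) auto
next
  case False
  define P where "P = map_poly complex_of_real ([:l:] - q)"
  have P0: "P \<noteq> 0" using False unfolding P_def by (simp add: map_poly_eq_0_iff)
  have "cpoly_at P h = poly_at ([:l:] - q) h"
    by (simp add: cpoly_at_def poly_at_def P_def degree_map_poly coeff_map_poly scaleR_scaleC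
        del: coeff_diff)
  also have "\<dots> = complex_of_real l *\<^sub>C 1 - poly_at q h"
    by (simp add: poly_at_diff poly_at_pCons scaleR_scaleC)
  finally have "\<not> unit_elt (cpoly_at P h)" using l by (simp add: real_spectrum_def spectrum_iff)
  then obtain z where z: "poly P z = 0" "z \<in> spectrum h" using unit_elt_cpoly_at[OF P0] by blast
  then have "Im z = 0" using self_adjoint_spectrum_real[OF h] by blast
  then obtain x where x: "z = complex_of_real x" by (metis complex_is_Real_iff of_real_Re)
  have "poly ([:l:] - q) x = 0" using z(1) unfolding P_def x poly_map_complex_of_real by simp
  then show ?thesis using z x by (intro bexI[of _ x]) (auto simp: real_spectrum_def)
qed

text \<open>Contractivity of the polynomial calculus for the supremum norm on the spectrum is what makes
  it extend to continuous functions.\<close>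

lemma norm_poly_at_le:
  fixes h :: "'a::cstar_algebra"
  assumes h: "star h = h" and B: "\<And>x. x \<in> real_spectrum h \<Longrightarrow> \<bar>poly q x\<bar> \<le> B"
  shows "norm (poly_at q h) \<le> B"
proof -
  obtain r where "\<bar>r\<bar> = norm (poly_at q h)" "r \<in> real_spectrum (poly_at q h)"
    using self_adjoint_norm_in_spectrum[OF star_poly_at[OF h]] by (auto simp: real_spectrum_def)
  then show ?thesis using spectral_mapping[OF h] B by metis
qed

lemma poly_at_null:
  fixes h :: "'a::cstar_algebra"
  assumes h: "star h = h" and q: "uniform_limit (real_spectrum h) (\<lambda>n. poly (q n)) (\<lambda>_. 0) sequentially"
  shows "(\<lambda>n. poly_at (q n) h) \<longlonglongrightarrow> 0"
  unfolding LIMSEQ_iff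
proof (intro allI impI)
  fix e :: real assume e: "e > 0"
  then have "eventually (\<lambda>n. \<forall>x\<in>real_spectrum h. dist (poly (q n) x) 0 < e/2) sequentially"
    by (intro uniform_limitD[OF q]) simp
  then obtain N where N: "\<And>n x. n \<ge> N \<Longrightarrow> x \<in> real_spectrum h \<Longrightarrow> \<bar>poly (q n) x\<bar> < e/2"
    by (auto simp: eventually_sequentially)
  have "norm (poly_at (q n) h) \<le> e/2" if "n \<ge> N" for n
    using N[OF that] by (intro norm_poly_at_le[OF h]) (auto intro: less_imp_le)
  then show "\<exists>N. \<forall>n\<ge>N. norm (poly_at (q n) h - 0) < e" using e by (intro exI[of _ N]) force
qed

lemma cfc_eqI:
  fixes h :: "'a::cstar_algebra"
  assumes h: "star h = h" and q: "uniform_limit (real_spectrum h) (\<lambda>n. poly (q n)) f sequentially"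
    and c: "(\<lambda>n. poly_at (q n) h) \<longlonglongrightarrow> c"
  shows "cfc f h = c"
  unfolding cfc_def real_spectrum_def[symmetric]
proof (rule the_equality)
  show "\<forall>q. uniform_limit (real_spectrum h) (\<lambda>n. poly (q n)) f sequentially
       \<longrightarrow> (\<lambda>n. poly_at (q n) h) \<longlonglongrightarrow> c"
  proof (intro allI impI)
    fix p assume p: "uniform_limit (real_spectrum h) (\<lambda>n. poly (p n)) f sequentially"
    have "uniform_limit (real_spectrum h) (\<lambda>n. poly (p n - q n)) (\<lambda>_. 0) sequentially"
      using uniform_limit_minus[OF p q] by (simp add: poly_diff[abs_def])
    from tendsto_add[OF c poly_at_null[OF h this]] show "(\<lambda>n. poly_at (p n) h) \<longlonglongrightarrow> c"
      by (simp add: poly_at_diff)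
  qed
qed (use q c LIMSEQ_unique in blast)

lemma cfc_tendsto:
  fixes h :: "'a::cstar_algebra"
  assumes h: "star h = h" and q: "uniform_limit (real_spectrum h) (\<lambda>n. poly (q n)) f sequentially"
  shows "(\<lambda>n. poly_at (q n) h) \<longlonglongrightarrow> cfc f h"
proof -
  have "Cauchy (\<lambda>n. poly_at (q n) h)"
    unfolding Cauchy_iff
  proof (intro allI impI)
    fix e :: real assume e: "e > 0"
    then have "eventually (\<lambda>n. \<forall>x\<in>real_spectrum h. dist (poly (q n) x) (f x) < e/3) sequentially"
      by (intro uniform_limitD[OF q]) simp
    then obtain N where N: "\<And>n x. n \<ge> N \<Longrightarrow> x \<in> real_spectrum h \<Longrightarrow> \<bar>poly (q n) x - f x\<bar> < e/3"
      by (auto simp: eventually_sequentially dist_real_def)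
    have "norm (poly_at (q m - q n) h) \<le> 2 * (e/3)" if "m \<ge> N" "n \<ge> N" for m n
    proof (rule norm_poly_at_le[OF h])
      fix x assume "x \<in> real_spectrum h"
      then show "\<bar>poly (q m - q n) x\<bar> \<le> 2 * (e/3)" using N[of m x] N[of n x] that unfolding poly_diff by linarith
    qed
    then show "\<exists>M. \<forall>m\<ge>M. \<forall>n\<ge>M. norm (poly_at (q m) h - poly_at (q n) h) < e"
      using e by (intro exI[of _ N]) (force simp: poly_at_diff)
  qed
  then obtain c where "(\<lambda>n. poly_at (q n) h) \<longlonglongrightarrow> c" using Cauchy_convergent convergent_def by blast
  with cfc_eqI[OF h q this] show ?thesis by simp
qed

lemma poly_approximation:
  fixes f :: "real \<Rightarrow> real"
  assumes f: "continuous_on UNIV f"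
  obtains q where "uniform_limit (real_spectrum h) (\<lambda>n. poly (q n)) f sequentially"
proof -
  have "\<exists>p. \<forall>x\<in>{- norm h..norm h}. \<bar>f x - poly p x\<bar> < 1 / real (Suc n)" for n
  proof -
    obtain g where g: "real_polynomial_function g" "\<And>x. x \<in> {- norm h..norm h} \<Longrightarrow> \<bar>f x - g x\<bar> < 1 / real (Suc n)"
      using Stone_Weierstrass_real_polynomial_function[of "{- norm h..norm h}" f "1 / real (Suc n)"]
        continuous_on_subset[OF f] by (metis compact_Icc of_nat_0_less_iff subset_UNIV zero_less_Suc zero_less_divide_1_iff)
    then obtain a N where "g = (\<lambda>x. \<Sum>i\<le>N. a i * x ^ i)"
      unfolding real_polynomial_function_iff_sum by blast
    then have "g = poly (\<Sum>i\<le>N. monom (a i) i)" by (simp add: poly_sum poly_monom fun_eq_iff)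
    with g show ?thesis by blast
  qed
  then obtain q where q: "\<And>n x. x \<in> {- norm h..norm h} \<Longrightarrow> \<bar>f x - poly (q n) x\<bar> < 1 / real (Suc n)"
    by metis
  have "uniform_limit (real_spectrum h) (\<lambda>n. poly (q n)) f sequentially"
  proof (rule uniform_limitI)
    fix e :: real assume "e > 0"
    then have "eventually (\<lambda>n. 1 / real (Suc n) < e) sequentially"
      using LIMSEQ_inverse_real_of_nat by (auto dest: order_tendstoD simp: inverse_eq_divide)
    then show "eventually (\<lambda>n. \<forall>x\<in>real_spectrum h. dist (poly (q n) x) (f x) < e) sequentially"
    proof eventually_elim
      case (elim n)
      show ?case
      proof
        fix x assume "x \<in> real_spectrum h"
        from real_spectrum_bound[OF this] have "x \<in> {- norm h..norm h}" by auto
        from q[OF this, of n] elim show "dist (poly (q n) x) (f x) < e" by (simp add: dist_real_def)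
      qed
    qed
  qed
  then show thesis by (rule that)
qed

lemma cfc_cong:
  assumes "\<And>x. x \<in> real_spectrum h \<Longrightarrow> f x = g x" shows "cfc f h = cfc g h"
  unfolding cfc_def real_spectrum_def[symmetric]
  using assms by (simp cong: uniform_limit_cong')

lemma cfc_poly: "star h = h \<Longrightarrow> cfc (poly q) h = poly_at q (h::'a::cstar_algebra)"
  by (rule cfc_eqI[where q = "\<lambda>_. q"]) (auto simp: uniform_limit_iff)

lemma cfc_mult:
  fixes h :: "'a::cstar_algebra"
  assumes h: "star h = h" and f: "continuous_on UNIV f" and g: "continuous_on UNIV g"
  shows "cfc (\<lambda>x. f x * g x) h = cfc f h * cfc g h"
proof -
  obtain p where p: "uniform_limit (real_spectrum h) (\<lambda>n. poly (p n)) f sequentially"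
    using poly_approximation[OF f] .
  obtain q where q: "uniform_limit (real_spectrum h) (\<lambda>n. poly (q n)) g sequentially"
    using poly_approximation[OF g] .
  have sub: "real_spectrum h \<subseteq> {- norm h..norm h}" using real_spectrum_bound[of _ h] by (force simp: abs_le_iff)
  have b: "bounded (k ` real_spectrum h)" if "continuous_on UNIV k" for k :: "real \<Rightarrow> real"
    using compact_imp_bounded[OF compact_continuous_image[OF continuous_on_subset[OF that]
        compact_Icc[of "- norm h" "norm h"]]] sub
    by (meson bounded_subset image_mono subset_UNIV)
  have "uniform_limit (real_spectrum h) (\<lambda>n. poly (p n * q n)) (\<lambda>x. f x * g x) sequentially"
    using uniform_lim_mult[OF p q b[OF f] b[OF g]] by (simp add: poly_mult[abs_def])
  moreover have "(\<lambda>n. poly_at (p n * q n) h) \<longlonglongrightarrow> cfc f h * cfc g h"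
    unfolding poly_at_mult by (intro tendsto_mult cfc_tendsto[OF h] p q)
  ultimately show ?thesis by (rule cfc_eqI[OF h])
qed

lemma cfc_add:
  fixes h :: "'a::cstar_algebra"
  assumes h: "star h = h" and f: "continuous_on UNIV f" and g: "continuous_on UNIV g"
  shows "cfc (\<lambda>x. f x + g x) h = cfc f h + cfc g h"
proof -
  obtain p where p: "uniform_limit (real_spectrum h) (\<lambda>n. poly (p n)) f sequentially"
    using poly_approximation[OF f] .
  obtain q where q: "uniform_limit (real_spectrum h) (\<lambda>n. poly (q n)) g sequentially"
    using poly_approximation[OF g] .
  have "uniform_limit (real_spectrum h) (\<lambda>n. poly (p n + q n)) (\<lambda>x. f x + g x) sequentially"
    using uniform_limit_add[OF p q] by (simp add: poly_add[abs_def])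
  moreover have "(\<lambda>n. poly_at (p n + q n) h) \<longlonglongrightarrow> cfc f h + cfc g h"
    unfolding poly_at_add by (intro tendsto_add cfc_tendsto[OF h] p q)
  ultimately show ?thesis by (rule cfc_eqI[OF h])
qed

lemma tendsto_star: "(x \<longlongrightarrow> a) F \<Longrightarrow> ((\<lambda>n. star (x n)) \<longlongrightarrow> star (a::'a::cstar_algebra)) F"
  unfolding tendsto_iff by (simp add: dist_norm flip: star_diff)

lemma star_cfc:
  fixes h :: "'a::cstar_algebra"
  assumes h: "star h = h" and f: "continuous_on UNIV f"
  shows "star (cfc f h) = cfc f h"
proof -
  obtain p where p: "uniform_limit (real_spectrum h) (\<lambda>n. poly (p n)) f sequentially"
    using poly_approximation[OF f] .
  have "(\<lambda>n. poly_at (p n) h) \<longlonglongrightarrow> star (cfc f h)"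
    using tendsto_star[OF cfc_tendsto[OF h p]] by (simp add: star_poly_at h)
  then show ?thesis using cfc_tendsto[OF h p] LIMSEQ_unique by blast
qed

section \<open>The two-norm of a faithful trace\<close>

context cstar_probability_space
begin

lemma E_zero [simp]: "E 0 = 0"
  using E_add[of 0 0] by simp

lemma E_minus: "E (- x) = - E x"
  using E_add[of x "-x"] by (simp add: eq_neg_iff_add_eq_0 add.commute)

lemma E_diff: "E (x - y) = E x - E y"
  using E_add[of x "-y"] by (simp add: E_minus)

lemma E_scaleR: "E (r *\<^sub>R x) = complex_of_real r * E x"
  by (simp add: scaleR_scaleC E_scaleC)

text \<open>Polarization: \<open>E (y\<^sup>* y)\<close> is real for \<open>y = 1 + x\<close> and for \<open>y = 1 + i x\<close>.\<close>

lemma E_star: "E (star x) = cnj (E x)"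
proof -
  have im: "Im (E (star y * y)) = 0" for y using E_positive[of y] by (simp add: complex_is_Real_iff)
  have "star (1 + x) * (1 + x) = star 1 * 1 + star x * x + x + star x"
    by (simp add: star_add algebra_simps)
  then have "E (star (1 + x) * (1 + x)) = E (star 1 * 1) + E (star x * x) + E x + E (star x)"
    by (simp only: E_add)
  then have 1: "Im (E x + E (star x)) = 0" using im[of "1 + x"] im[of 1] im[of x] by simp
  have "star (1 + \<i> *\<^sub>C x) * (1 + \<i> *\<^sub>C x) = star 1 * 1 + star x * x + \<i> *\<^sub>C x + (- \<i>) *\<^sub>C star x"
    by (simp add: star_add star_scaleC mult_scaleC_left mult_scaleC_right scaleC_scaleC scaleC_add_right
        scaleC_minus_left scaleC_minus_right scaleC_diff_right algebra_simps)
  then have eq: "E (star (1 + \<i> *\<^sub>C x) * (1 + \<i> *\<^sub>C x)) = E (star 1 * 1) + E (star x * x) + \<i> * E x + (- \<i>) * E (star x)"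
    by (simp only: E_add E_scaleC)
  then have 2: "Im (\<i> * (E x - E (star x))) = 0"
    using im[of "1 + \<i> *\<^sub>C x", unfolded eq] im[of 1] im[of x] by simp
  show ?thesis using 1 2 by (simp add: complex_eq_iff)
qed

definition norm2 :: "'a \<Rightarrow> real" where
  "norm2 x = sqrt (Re (E (star x * x)))"

lemma norm2_nonneg [simp]: "0 \<le> norm2 x"
  using E_positive[of x] by (simp add: norm2_def)

lemma norm2_square: "(norm2 x)\<^sup>2 = Re (E (star x * x))"
  using E_positive[of x] by (simp add: norm2_def)

lemma norm2_zero [simp]: "norm2 0 = 0"
  by (simp add: norm2_def)

lemma norm2_eq_0: "norm2 x = 0 \<Longrightarrow> x = 0"
  using norm2_square[of x] E_positive[of x] E_faithful[of x]
  by (auto simp: complex_is_Real_iff complex_eq_iff)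

lemma norm2_scaleC: "norm2 (c *\<^sub>C x) = cmod c * norm2 x"
proof -
  have "E (star (c *\<^sub>C x) * (c *\<^sub>C x)) = (cnj c * c) * E (star x * x)"
    by (simp add: star_scaleC mult_scaleC_left mult_scaleC_right scaleC_scaleC E_scaleC mult.commute)
  also have "cnj c * c = complex_of_real ((cmod c)\<^sup>2)"
    using complex_norm_square[of c] by (simp add: mult.commute)
  finally show ?thesis by (simp add: norm2_def real_sqrt_mult)
qed

lemma norm2_scaleR: "norm2 (r *\<^sub>R x) = \<bar>r\<bar> * norm2 x"
  by (simp add: scaleR_scaleC norm2_scaleC)

lemma norm2_minus: "norm2 (- x) = norm2 x"
  using norm2_scaleR[of "-1" x] by simp

lemma norm2_minus_commute: "norm2 (x - y) = norm2 (y - x)"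
  using norm2_minus[of "x - y"] by simp

lemma norm2_add_square: "(norm2 (x + y))\<^sup>2 = (norm2 x)\<^sup>2 + 2 * Re (E (star x * y)) + (norm2 y)\<^sup>2"
proof -
  have "E (star y * x) = cnj (E (star x * y))"
    using E_star[of "star x * y"] by (simp add: star_mult star_star)
  moreover have "star (x + y) * (x + y) = star x * x + star x * y + star y * x + star y * y"
    by (simp add: star_add algebra_simps)
  ultimately show ?thesis unfolding norm2_square by (simp add: E_add)
qed

lemma Cauchy_Schwarz_Re: "\<bar>Re (E (star x * y))\<bar> \<le> norm2 x * norm2 y"
proof (cases "y = 0")
  case False
  define b where "b = Re (E (star x * y))"
  have d: "norm2 y > 0" using False norm2_eq_0[of y] norm2_nonneg[of y] by linarith
  have "0 \<le> (norm2 x)\<^sup>2 + 2 * (t * b) + t\<^sup>2 * (norm2 y)\<^sup>2" for t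
    using norm2_add_square[of x "t *\<^sub>R y"] zero_le_power2[of "norm2 (x + t *\<^sub>R y)"]
    by (simp add: norm2_scaleR E_scaleR b_def power_mult_distrib)
  \<comment> \<open>the minimizer of this quadratic polynomial in \<open>t\<close>\<close>
  from this[of "- b / (norm2 y)\<^sup>2"] have "b\<^sup>2 / (norm2 y)\<^sup>2 \<le> (norm2 x)\<^sup>2"
    using d by (simp add: power2_eq_square field_simps)
  then have "b\<^sup>2 \<le> (norm2 x * norm2 y)\<^sup>2" using d by (simp add: field_simps power_mult_distrib)
  then show ?thesis unfolding b_def using abs_le_square_iff[of _ "norm2 x * norm2 y"] by simp
qed simp

lemma Cauchy_Schwarz: "cmod (E (star x * y)) \<le> norm2 x * norm2 y"
proof (cases "E (star x * y) = 0")
  case False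
  \<comment> \<open>the phase that makes \<open>E (x\<^sup>* (c y))\<close> nonnegative\<close>
  define c where "c = cnj (sgn (E (star x * y)))"
  have c: "cmod c = 1" using False by (simp add: c_def norm_sgn)
  have "E (star x * (c *\<^sub>C y)) = c * E (star x * y)" by (simp add: mult_scaleC_right E_scaleC)
  also have "\<dots> = complex_of_real (cmod (E (star x * y)))"
    using False complex_norm_square[of "E (star x * y)"]
    by (simp add: c_def sgn_eq field_simps power2_eq_square)
  finally have "cmod (E (star x * y)) = Re (E (star x * (c *\<^sub>C y)))" by simp
  also have "\<dots> \<le> norm2 x * norm2 (c *\<^sub>C y)" using Cauchy_Schwarz_Re[of x "c *\<^sub>C y"] by linarith
  finally show ?thesis by (simp add: norm2_scaleC c)
qed simp

lemma norm2_triangle: "norm2 (x + y) \<le> norm2 x + norm2 y"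
proof (rule power2_le_imp_le)
  show "(norm2 (x + y))\<^sup>2 \<le> (norm2 x + norm2 y)\<^sup>2"
    using Cauchy_Schwarz_Re[of x y] unfolding norm2_add_square power2_sum by (simp add: algebra_simps)
qed (simp add: add_nonneg_nonneg)

text \<open>Positivity of \<open>h = a\<^sup>* a\<close> comes from the trace: with \<open>d\<^sup>2 = h\<^sup>-\<close>, the element
  \<open>(a d\<^sup>2)\<^sup>* (a d\<^sup>2) = d\<^sup>2 h d\<^sup>2\<close> is the negative of \<open>(d\<^sup>3)\<^sup>* d\<^sup>3\<close>, so faithfulness gives
  \<open>d = 0\<close>.\<close>

lemma negative_part_star_mult_self:
  fixes a :: 'a
  assumes h: "h = star a * a"
  shows "cfc (\<lambda>x. sqrt (max 0 (- x))) h = 0"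
proof -
  have sh: "star h = h" by (simp add: h star_mult star_star)
  define g :: "real \<Rightarrow> real" where "g = (\<lambda>x. sqrt (max 0 (- x)))"
  define d where "d = cfc g h"
  have cg: "continuous_on UNIV g" unfolding g_def by (intro continuous_intros)
  have sd: "star d = d" unfolding d_def by (rule star_cfc[OF sh cg])
  have idh: "cfc (\<lambda>x. x) h = h"
    using cfc_poly[OF sh, of "[:0, 1:]"] by (simp add: poly_at_pCons poly_pCons[abs_def])
  have g2: "cfc (\<lambda>x. g x * g x) h = d * d"
    unfolding d_def by (rule cfc_mult[OF sh cg cg])
  have c2: "continuous_on UNIV (\<lambda>x. g x * g x)" using cg by (intro continuous_intros)
  have "cfc (\<lambda>x. (g x * g x) * x) h = (d * d) * h"
    using cfc_mult[OF sh c2 continuous_on_id] by (simp add: g2 idh id_def)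
  moreover have "(g x * g x) * x = - ((g x * g x) * (g x * g x))" for x :: real
    by (simp add: g_def max_def)
  moreover have "cfc (\<lambda>x. (g x * g x) * (g x * g x)) h = (d * d) * (d * d)"
    using cfc_mult[OF sh c2 c2] by (simp add: g2)
  moreover have "cfc (\<lambda>x. - f x) h = - cfc f h" if "continuous_on UNIV f" for f
    using cfc_mult[OF sh _ that, of "\<lambda>_. -1"] cfc_poly[OF sh, of "[:-1:]"]
    by (simp add: poly_at_pCons poly_pCons[abs_def])
  ultimately have dh: "(d * d) * h = - ((d * d) * (d * d))"
    using c2 by (simp add: continuous_on_mult)
  define p where "p = a * (d * d)"
  define q where "q = d * (d * d)"
  have "star p * p = (d * d) * h * (d * d)"
    by (simp add: p_def h star_mult sd mult.assoc)
  also have "\<dots> = - (star q * q)"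
    unfolding dh by (simp add: q_def star_mult sd mult.assoc)
  finally have "Re (E (star p * p)) = - Re (E (star q * q))" by (simp add: E_minus)
  then have "norm2 q = 0" using E_positive[of p] E_positive[of q] by (simp add: norm2_def)
  then have "q = 0" by (rule norm2_eq_0)
  then have "norm ((d * d) * (d * d)) = 0" by (simp add: q_def mult.assoc)
  moreover have "star (d * d) = d * d" by (simp add: star_mult sd)
  ultimately have "norm d = 0" using self_adjoint_norm_square sd by (metis zero_eq_power2)
  then show ?thesis by (simp add: d_def g_def)
qed

text \<open>With \<open>h = a\<^sup>* a\<close>, the functions \<open>k\<close> and \<open>g\<close> below are the square roots of the positive
  and negative part, so \<open>h = k(h)\<^sup>2 - g(h)\<^sup>2\<close>.  The square root of a negative real is
  \<open>sqrt (- x) = - sqrt x\<close> by convention, so \<open>sqrt = k - g\<close> holds on the whole line, and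
  \<open>g(h) = 0\<close> leaves \<open>\<bar>a\<bar> = k(h)\<close>.\<close>

lemma cstar_abs_square:
  fixes a :: 'a
  shows "star (cstar_abs a) = cstar_abs a" "cstar_abs a * cstar_abs a = star a * a"
proof -
  define h where "h = star a * a"
  have sh: "star h = h" by (simp add: h_def star_mult star_star)
  define k :: "real \<Rightarrow> real" where "k = (\<lambda>x. sqrt (max 0 x))"
  define g :: "real \<Rightarrow> real" where "g = (\<lambda>x. sqrt (max 0 (- x)))"
  have cont: "continuous_on UNIV k" "continuous_on UNIV g" "continuous_on UNIV (\<lambda>x::real. - g x)"
    "continuous_on UNIV sqrt"
    unfolding g_def k_def by (intro continuous_intros)+
  have g0: "cfc g h = 0" using negative_part_star_mult_self[OF h_def] by (simp add: g_def)
  have idh: "cfc (\<lambda>x. x) h = h"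
    using cfc_poly[OF sh, of "[:0, 1:]"] by (simp add: poly_at_pCons poly_pCons[abs_def])
  have kk: "cfc (\<lambda>x. k x * k x) h = cfc k h * cfc k h" by (rule cfc_mult[OF sh cont(1,1)])
  have gg: "cfc (\<lambda>x. g x * g x) h = 0" using cfc_mult[OF sh cont(2,2)] by (simp add: g0)
  have ngg: "cfc (\<lambda>x. - g x * g x) h = 0" using cfc_mult[OF sh cont(3,2)] by (simp add: g0)
  have cc: "continuous_on UNIV (\<lambda>x. k x * k x)" "continuous_on UNIV (\<lambda>x. g x * g x)"
    "continuous_on UNIV (\<lambda>x. - g x * g x)" using cont by (auto intro!: continuous_intros)
  have "cfc (\<lambda>x. k x * k x + - g x * g x) h = cfc k h * cfc k h"
    using cfc_add[OF sh cc(1,3)] unfolding kk ngg by simp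
  moreover have "k x * k x + - g x * g x = x" for x by (simp add: k_def g_def max_def)
  ultimately have hk: "h = cfc k h * cfc k h" by (simp add: idh)
  have "cfc (\<lambda>x. k x + - g x) h = cfc k h"
    using cfc_add[OF sh cont(1,3)] cfc_mult[OF sh _ cont(2), of "\<lambda>_. -1"] by (simp add: g0)
  moreover have "k x + - g x = sqrt x" for x by (simp add: k_def g_def max_def real_sqrt_minus)
  ultimately have ab: "cstar_abs a = cfc k h" by (simp add: cstar_abs_def h_def)
  show "star (cstar_abs a) = cstar_abs a" unfolding ab by (rule star_cfc[OF sh cont(1)])
  show "cstar_abs a * cstar_abs a = star a * a" using hk by (simp add: ab h_def)
qed

lemma pnorm_2: "pnorm E 2 a = norm2 a"
proof -
  let ?c = "cstar_abs a"
  have "(\<lambda>x::real. x powr 2) = (\<lambda>x. x * x)"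
  proof
    fix x :: real
    \<comment> \<open>also for \<open>x < 0\<close>, because \<open>ln x = ln \<bar>x\<bar>\<close> by convention\<close>
    have "x powr 2 = \<bar>x\<bar> powr 2" by (cases "x < 0") (simp_all add: powr_def ln_minus)
    then show "x powr 2 = x * x" by (simp add: power2_eq_square)
  qed
  then have "cfc (\<lambda>x. x powr 2) ?c = cfc (poly [:0, 0, 1:]) ?c"
    by (simp add: poly_pCons[abs_def])
  also have "\<dots> = star a * a"
    by (simp add: cfc_poly cstar_abs_square poly_at_pCons)
  finally show ?thesis
    using E_positive[of a] by (simp add: pnorm_def norm2_def powr_half_sqrt)
qed

text \<open>\<open>\<parallel>h\<parallel> - h\<close> is a square, because its functional calculus symbol is nonnegative on the
  spectrum of \<open>h = a\<^sup>* a\<close>.\<close>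

lemma norm2_le_norm: "norm2 a \<le> norm a"
proof -
  define h where "h = star a * a"
  have sh: "star h = h" by (simp add: h_def star_mult star_star)
  define K where "K = norm h"
  define k where "k = (\<lambda>x. sqrt (K - x))"
  have ck: "continuous_on UNIV k" unfolding k_def by (intro continuous_intros)
  have "cfc k h * cfc k h = cfc (\<lambda>x. k x * k x) h" by (simp add: cfc_mult[OF sh ck ck])
  also have "\<dots> = cfc (poly [:K, -1:]) h"
  proof (rule cfc_cong)
    fix x assume "x \<in> real_spectrum h"
    from real_spectrum_bound[OF this] show "k x * k x = poly [:K, -1:] x"
      by (simp add: k_def K_def)
  qed
  also have "\<dots> = K *\<^sub>R 1 - h" by (simp add: cfc_poly[OF sh] poly_at_pCons)
  finally have "star (cfc k h) * cfc k h = K *\<^sub>R 1 - h" by (simp add: star_cfc[OF sh ck])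
  then have "Re (E (star a * a)) \<le> K"
    using E_positive[of "cfc k h"] by (simp add: E_diff E_scaleR E_one h_def)
  then show ?thesis
    unfolding norm2_def K_def h_def cstar_identity by (rule real_le_lsqrt[OF norm_ge_zero])
qed

lemma pnorm_infinity: "pnorm E \<infinity> a = norm a"
  by (simp add: pnorm_def)

text \<open>This makes constant sequences members of their own classes in the completion for \<open>p = 1\<close>.
  Conditional expectations of elements of the algebra can be evaluated on them.\<close>

lemma pnorm_1_zero: "pnorm E 1 0 = 0"
proof -
  have sp: "real_spectrum (0::'a) \<subseteq> {0}" using real_spectrum_bound[of _ "0::'a"] by auto
  have z: "cfc f (0::'a) = 0" if "f 0 = 0" for f
  proof -
    have "cfc f (0::'a) = cfc (poly 0) 0" using sp that by (intro cfc_cong) auto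
    then show ?thesis by (simp add: cfc_poly)
  qed
  show ?thesis by (simp add: pnorm_def cstar_abs_def z)
qed

end

section \<open>The completion for the two-norm and uniformly Cauchy families of sums\<close>

text \<open>The partitions \<open>{0, 1/(k+1), 2/(k+1), \<dots>}\<close> serve to pick a representing sequence of a
  limit along all partitions.\<close>

definition uniform_partition :: "nat \<Rightarrow> nat \<Rightarrow> real" where
  "uniform_partition k n = real n / real (Suc k)"

lemma is_partition_uniform: "is_partition (uniform_partition k)"
proof -
  have "filterlim (\<lambda>n. real n * (1 / real (Suc k))) at_top sequentially"
    by (intro filterlim_at_top_mult_tendsto_pos[OF tendsto_const] filterlim_real_sequentially) simp
  then show ?thesis
    by (simp add: is_partition_def uniform_partition_def[abs_def] strict_mono_def divide_strict_right_mono)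
qed

lemma mesh_uniform_partition: "mesh (uniform_partition k) \<le> ereal (1 / real (Suc k))"
  unfolding mesh_def
proof (rule SUP_least)
  fix n
  have "real n - real (n - 1) \<le> 1" by simp
  then show "ereal (uniform_partition k n - uniform_partition k (n - 1)) \<le> ereal (1 / real (Suc k))"
    unfolding uniform_partition_def ereal_less_eq diff_divide_distrib[symmetric]
    by (intro divide_right_mono) auto
qed

lemma eventually_mesh_uniform_partition:
  assumes "d > 0" shows "eventually (\<lambda>k. mesh (uniform_partition k) < ereal d) sequentially"
proof -
  have "eventually (\<lambda>k. 1 / real (Suc k) < d) sequentially"
    using LIMSEQ_inverse_real_of_nat assms by (auto dest: order_tendstoD simp: inverse_eq_divide)
  then show ?thesis
    by eventually_elim (use mesh_uniform_partition le_less_trans less_ereal.simps(1) in blast)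
qed

lemma Lp_mesh_limit_cong:
  assumes "Lp_mesh_limit E p S Z" "\<And>t. t \<ge> 0 \<Longrightarrow> Z t = Z' t"
  shows "Lp_mesh_limit E p S Z'"
  using assms unfolding Lp_mesh_limit_def by (metis (no_types, lifting) atLeastAtMost_iff)

context cstar_probability_space
begin

lemma norm2_diff_triangle: "norm2 (x - z) \<le> norm2 (x - y) + norm2 (y - z)"
  using norm2_triangle[of "x - y" "y - z"] by simp

lemma norm2_triangle_ineq3: "\<bar>norm2 x - norm2 y\<bar> \<le> norm2 (x - y)"
  using norm2_triangle[of "x - y" y] norm2_triangle[of "y - x" x] norm2_minus_commute[of x y]
  by simp

lemma cauchy_norm2_diff:
  assumes "cauchy_wrt norm2 x" "cauchy_wrt norm2 y"
  shows "cauchy_wrt norm2 (\<lambda>n. x n - y n)"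
  unfolding cauchy_wrt_def
proof (intro allI impI)
  fix e :: real assume "e > 0"
  then have "e / 2 > 0" by simp
  obtain N M where N: "\<And>m n. m \<ge> N \<Longrightarrow> n \<ge> N \<Longrightarrow> norm2 (x m - x n) < e / 2"
    and M: "\<And>m n. m \<ge> M \<Longrightarrow> n \<ge> M \<Longrightarrow> norm2 (y m - y n) < e / 2"
    using assms \<open>e / 2 > 0\<close> unfolding cauchy_wrt_def by metis
  have "norm2 (x m - y m - (x n - y n)) < e" if "m \<ge> max N M" "n \<ge> max N M" for m n
  proof -
    have "norm2 ((x m - x n) + (y n - y m)) \<le> norm2 (x m - x n) + norm2 (y n - y m)"
      by (rule norm2_triangle)
    also have "(x m - x n) + (y n - y m) = x m - y m - (x n - y n)" by simp
    finally show ?thesis using N[of m n] M[of n m] that by simp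
  qed
  then show "\<exists>N. \<forall>m\<ge>N. \<forall>n\<ge>N. norm2 (x m - y m - (x n - y n)) < e" by blast
qed

lemma cauchy_norm2_const: "cauchy_wrt norm2 (\<lambda>_. a)"
  by (simp add: cauchy_wrt_def)

lemma cmpl_class_self: "cauchy_wrt norm2 x \<Longrightarrow> x \<in> cmpl_class norm2 x"
  by (simp add: cmpl_class_def)

lemma norm2_null_trans:
  assumes "(\<lambda>n. norm2 (x n - y n)) \<longlonglongrightarrow> 0" "(\<lambda>n. norm2 (y n - z n)) \<longlonglongrightarrow> 0"
  shows "(\<lambda>n. norm2 (x n - z n)) \<longlonglongrightarrow> 0"
  by (rule tendsto_sandwich[OF _ _ tendsto_const tendsto_add_zero[OF assms]])
    (use norm2_diff_triangle in auto)

lemma norm2_null_sym: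
  "(\<lambda>n. norm2 (x n - y n)) \<longlonglongrightarrow> 0 \<Longrightarrow> (\<lambda>n. norm2 (y n - x n)) \<longlonglongrightarrow> 0"
  by (simp add: norm2_minus_commute)

lemma cmpl_class_eqI:
  assumes "(\<lambda>n. norm2 (x n - y n)) \<longlonglongrightarrow> 0"
  shows "cmpl_class norm2 x = cmpl_class norm2 y"
  unfolding cmpl_class_def
  using norm2_null_trans[OF _ assms] norm2_null_trans[OF _ norm2_null_sym[OF assms]] by blast

lemma cmpl_minus_class:
  assumes x: "cauchy_wrt norm2 x" and y: "cauchy_wrt norm2 y"
  shows "cmpl_minus norm2 (cmpl_class norm2 x) (cmpl_class norm2 y)
       = cmpl_class norm2 (\<lambda>n. x n - y n)"
proof -
  have "cmpl_class norm2 (\<lambda>n. x' n - y' n) = cmpl_class norm2 (\<lambda>n. x n - y n)"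
    if "x' \<in> cmpl_class norm2 x" "y' \<in> cmpl_class norm2 y" for x' y'
  proof (rule cmpl_class_eqI)
    have null: "(\<lambda>n. norm2 (x' n - x n)) \<longlonglongrightarrow> 0" "(\<lambda>n. norm2 (y n - y' n)) \<longlonglongrightarrow> 0"
      using that norm2_null_sym by (auto simp: cmpl_class_def)
    have "norm2 (x' n - y' n - (x n - y n)) \<le> norm2 (x' n - x n) + norm2 (y n - y' n)" for n
      using norm2_triangle[of "x' n - x n" "y n - y' n"] by (simp add: algebra_simps)
    then show "(\<lambda>n. norm2 (x' n - y' n - (x n - y n))) \<longlonglongrightarrow> 0"
      by (intro tendsto_sandwich[OF _ _ tendsto_const tendsto_add_zero[OF null]]) auto
  qed
  moreover have "x \<in> cmpl_class norm2 x" "y \<in> cmpl_class norm2 y"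
    using x y by (auto intro: cmpl_class_self)
  ultimately show ?thesis unfolding cmpl_minus_def by blast
qed

lemma cmpl_norm_class:
  assumes x: "cauchy_wrt norm2 x" and r: "(\<lambda>n. norm2 (x n)) \<longlonglongrightarrow> r"
  shows "cmpl_norm norm2 (cmpl_class norm2 x) = r"
  unfolding cmpl_norm_def
proof (rule the_equality)
  show "\<forall>y\<in>cmpl_class norm2 x. (\<lambda>n. norm2 (y n)) \<longlonglongrightarrow> r"
  proof
    fix y assume "y \<in> cmpl_class norm2 x"
    then have "(\<lambda>n. norm2 (y n - x n)) \<longlonglongrightarrow> 0" by (simp add: cmpl_class_def)
    then have "(\<lambda>n. norm2 (y n) - norm2 (x n)) \<longlonglongrightarrow> 0"
      by (rule Lim_null_comparison[rotated]) (simp add: norm2_triangle_ineq3)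
    from tendsto_add[OF this r] show "(\<lambda>n. norm2 (y n)) \<longlonglongrightarrow> r" by simp
  qed
qed (use cmpl_class_self[OF x] r LIMSEQ_unique in blast)

lemma cmpl_embed_eq: "cmpl_embed norm2 a = cmpl_class norm2 (\<lambda>_. a)"
  by (simp add: cmpl_embed_def)

lemma pnorm_2_fun: "pnorm E 2 = norm2"
  by (rule ext) (rule pnorm_2)

text \<open>The Cauchy condition compares two arbitrary partitions, not only a partition and a
  refinement of it.\<close>

definition uniformly_cauchy :: "((nat \<Rightarrow> real) \<Rightarrow> real \<Rightarrow> 'a) \<Rightarrow> bool" where
  "uniformly_cauchy S \<longleftrightarrow>
     (\<forall>T\<ge>0. \<forall>e>0. \<exists>d>0. \<forall>\<pi> \<pi>'. is_partition \<pi> \<and> mesh \<pi> < ereal d \<and>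
        is_partition \<pi>' \<and> mesh \<pi>' < ereal d \<longrightarrow>
        (\<forall>t\<in>{0..T}. norm2 (S \<pi> t - S \<pi>' t) < e))"

definition mesh_limit :: "((nat \<Rightarrow> real) \<Rightarrow> real \<Rightarrow> 'a) \<Rightarrow> real \<Rightarrow> (nat \<Rightarrow> 'a) set" where
  "mesh_limit S t = cmpl_class norm2 (\<lambda>k. S (uniform_partition k) t)"

lemma uniformly_cauchy_sequence:
  assumes "uniformly_cauchy S" "t \<ge> 0"
  shows "cauchy_wrt norm2 (\<lambda>k. S (uniform_partition k) t)"
  unfolding cauchy_wrt_def
proof (intro allI impI)
  fix e :: real assume "e > 0"
  then obtain d where d: "d > 0" "\<And>\<pi> \<pi>'. is_partition \<pi> \<Longrightarrow> mesh \<pi> < ereal d \<Longrightarrow>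
        is_partition \<pi>' \<Longrightarrow> mesh \<pi>' < ereal d \<Longrightarrow> norm2 (S \<pi> t - S \<pi>' t) < e"
    using assms unfolding uniformly_cauchy_def by (metis atLeastAtMost_iff order_refl)
  obtain N where "\<And>k. k \<ge> N \<Longrightarrow> mesh (uniform_partition k) < ereal d"
    using eventually_mesh_uniform_partition[OF d(1)] by (auto simp: eventually_sequentially)
  then show "\<exists>N. \<forall>m\<ge>N. \<forall>n\<ge>N. norm2 (S (uniform_partition m) t - S (uniform_partition n) t) < e"
    using d(2) is_partition_uniform by blast
qed

lemma Lp_mesh_limit_mesh_limit:
  assumes S: "uniformly_cauchy S"
  shows "Lp_mesh_limit E 2 S (mesh_limit S)"
  unfolding Lp_mesh_limit_def pnorm_2_fun
proof (intro conjI allI impI)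
  fix t :: real assume "t \<ge> 0"
  then show "mesh_limit S t \<in> Lp E 2"
    using uniformly_cauchy_sequence[OF S] unfolding Lp_sub_def pnorm_2_fun mesh_limit_def by blast
next
  fix T e :: real assume T: "T \<ge> 0" and e: "e > 0"
  then have "e / 2 > 0" by simp
  then obtain d where d: "d > 0" "\<And>\<pi> \<pi>' t. is_partition \<pi> \<Longrightarrow> mesh \<pi> < ereal d \<Longrightarrow>
        is_partition \<pi>' \<Longrightarrow> mesh \<pi>' < ereal d \<Longrightarrow> t \<in> {0..T} \<Longrightarrow> norm2 (S \<pi> t - S \<pi>' t) < e / 2"
    using S T unfolding uniformly_cauchy_def by meson
  show "\<exists>d>0. \<forall>\<pi>. is_partition \<pi> \<and> mesh \<pi> < ereal d \<longrightarrow>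
       (\<forall>t\<in>{0..T}. cmpl_norm norm2 (cmpl_minus norm2 (cmpl_embed norm2 (S \<pi> t)) (mesh_limit S t)) < e)"
  proof (intro exI conjI allI impI ballI)
    fix \<pi> t assume p: "is_partition \<pi> \<and> mesh \<pi> < ereal d" and t: "t \<in> {0..T}"
    define x where "x = (\<lambda>k. S \<pi> t - S (uniform_partition k) t)"
    have cs: "cauchy_wrt norm2 (\<lambda>k. S (uniform_partition k) t)"
      using uniformly_cauchy_sequence[OF S] t by simp
    have cx: "cauchy_wrt norm2 x"
      unfolding x_def by (rule cauchy_norm2_diff[OF cauchy_norm2_const cs])
    have eq: "cmpl_minus norm2 (cmpl_embed norm2 (S \<pi> t)) (mesh_limit S t) = cmpl_class norm2 x"
      unfolding cmpl_embed_eq mesh_limit_def x_def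
      by (rule cmpl_minus_class[OF cauchy_norm2_const cs])
    have "Cauchy (\<lambda>k. norm2 (x k))"
      unfolding Cauchy_iff
    proof (intro allI impI)
      fix e :: real assume "e > 0"
      then obtain N where "\<forall>m\<ge>N. \<forall>n\<ge>N. norm2 (x m - x n) < e" using cx cauchy_wrt_def by metis
      then show "\<exists>M. \<forall>m\<ge>M. \<forall>n\<ge>M. norm (norm2 (x m) - norm2 (x n)) < e"
        using norm2_triangle_ineq3 by (metis le_less_trans real_norm_def)
    qed
    then obtain r where r: "(\<lambda>k. norm2 (x k)) \<longlonglongrightarrow> r"
      using Cauchy_convergent convergent_def by blast
    have "r \<le> e / 2"
    proof (rule tendsto_upperbound[OF r])
      show "eventually (\<lambda>k. norm2 (x k) \<le> e / 2) sequentially"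
        using eventually_mesh_uniform_partition[OF d(1)]
        by eventually_elim
          (use d(2)[of \<pi> _ t] p t is_partition_uniform in \<open>auto simp: x_def intro: less_imp_le\<close>)
    qed simp
    then show "cmpl_norm norm2 (cmpl_minus norm2 (cmpl_embed norm2 (S \<pi> t)) (mesh_limit S t)) < e"
      using e unfolding eq cmpl_norm_class[OF cx r] by simp
  qed (rule d)
qed

text \<open>An identity between sums over partitions passes to the limit.  Here \<open>Sd\<close> converges to
  elements \<open>D t\<close> of the algebra, while \<open>S1\<close> and \<open>S2\<close> only have limits in the completion.\<close>

lemma Lp_mesh_limit_combine:
  assumes S1: "uniformly_cauchy S1" and S2: "uniformly_cauchy S2"
    and Sd: "\<And>T e. T \<ge> 0 \<Longrightarrow> e > 0 \<Longrightarrow> \<exists>d>0. \<forall>\<pi>. is_partition \<pi> \<and> mesh \<pi> < ereal d \<longrightarrow>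
               (\<forall>t\<in>{0..T}. norm2 (Sd \<pi> t - D t) < e)"
    and S: "\<And>\<pi> t. is_partition \<pi> \<Longrightarrow> t \<ge> 0 \<Longrightarrow> S \<pi> t = Sd \<pi> t - S1 \<pi> t - S2 \<pi> t"
  shows "Lp_mesh_limit E 2 S
     (\<lambda>t. cmpl_minus (pnorm E 2) (cmpl_minus (pnorm E 2) (cmpl_embed (pnorm E 2) (D t))
            (mesh_limit S1 t)) (mesh_limit S2 t))"
proof (rule Lp_mesh_limit_cong)
  have "uniformly_cauchy S"
    unfolding uniformly_cauchy_def
  proof (intro allI impI)
    fix T e :: real assume T: "T \<ge> 0" and e: "e > 0"
    then have e5: "e / 5 > 0" by simp
    obtain d1 where d1: "d1 > 0" "\<And>\<pi> \<pi>' t. is_partition \<pi> \<Longrightarrow> mesh \<pi> < ereal d1 \<Longrightarrow>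
        is_partition \<pi>' \<Longrightarrow> mesh \<pi>' < ereal d1 \<Longrightarrow> t \<in> {0..T} \<Longrightarrow> norm2 (S1 \<pi> t - S1 \<pi>' t) < e / 5"
      using S1 T e5 unfolding uniformly_cauchy_def by meson
    obtain d2 where d2: "d2 > 0" "\<And>\<pi> \<pi>' t. is_partition \<pi> \<Longrightarrow> mesh \<pi> < ereal d2 \<Longrightarrow>
        is_partition \<pi>' \<Longrightarrow> mesh \<pi>' < ereal d2 \<Longrightarrow> t \<in> {0..T} \<Longrightarrow> norm2 (S2 \<pi> t - S2 \<pi>' t) < e / 5"
      using S2 T e5 unfolding uniformly_cauchy_def by meson
    obtain d3 where d3: "d3 > 0" "\<And>\<pi> t. is_partition \<pi> \<Longrightarrow> mesh \<pi> < ereal d3 \<Longrightarrow>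
        t \<in> {0..T} \<Longrightarrow> norm2 (Sd \<pi> t - D t) < e / 5"
      using Sd[OF T e5] by meson
    show "\<exists>d>0. \<forall>\<pi> \<pi>'. is_partition \<pi> \<and> mesh \<pi> < ereal d \<and> is_partition \<pi>' \<and> mesh \<pi>' < ereal d \<longrightarrow>
        (\<forall>t\<in>{0..T}. norm2 (S \<pi> t - S \<pi>' t) < e)"
    proof (intro exI[of _ "min d1 (min d2 d3)"] conjI allI impI ballI)
      fix \<pi> \<pi>' t assume *: "is_partition \<pi> \<and> mesh \<pi> < ereal (min d1 (min d2 d3)) \<and>
        is_partition \<pi>' \<and> mesh \<pi>' < ereal (min d1 (min d2 d3))" and t: "t \<in> {0..T}"
      have m: "is_partition \<pi>" "is_partition \<pi>'" "mesh \<pi> < ereal d1" "mesh \<pi>' < ereal d1"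
        "mesh \<pi> < ereal d2" "mesh \<pi>' < ereal d2" "mesh \<pi> < ereal d3" "mesh \<pi>' < ereal d3"
        using * by (auto elim!: less_le_trans)
      have "S \<pi> t - S \<pi>' t = ((Sd \<pi> t - D t) - (Sd \<pi>' t - D t))
          - ((S1 \<pi> t - S1 \<pi>' t) + (S2 \<pi> t - S2 \<pi>' t))"
        using S[of \<pi> t] S[of \<pi>' t] m t by simp
      then have eq: "norm2 (S \<pi> t - S \<pi>' t) = norm2 (((Sd \<pi> t - D t) - (Sd \<pi>' t - D t))
          - ((S1 \<pi> t - S1 \<pi>' t) + (S2 \<pi> t - S2 \<pi>' t)))" by simp
      have tri: "norm2 (x - y) \<le> norm2 x + norm2 y" for x y
        using norm2_triangle[of x "-y"] by (simp add: norm2_minus)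
      have "norm2 (S \<pi> t - S \<pi>' t) \<le> (norm2 (Sd \<pi> t - D t) + norm2 (Sd \<pi>' t - D t))
          + (norm2 (S1 \<pi> t - S1 \<pi>' t) + norm2 (S2 \<pi> t - S2 \<pi>' t))"
        unfolding eq by (rule order_trans[OF tri add_mono[OF tri norm2_triangle]])
      then show "norm2 (S \<pi> t - S \<pi>' t) < e"
        using d1(2)[of \<pi> \<pi>' t] d2(2)[of \<pi> \<pi>' t] d3(2)[of \<pi> t] d3(2)[of \<pi>' t] m t e by simp
    qed (use d1 d2 d3 in auto)
  qed
  then show "Lp_mesh_limit E 2 S (mesh_limit S)" by (rule Lp_mesh_limit_mesh_limit)
next
  fix t :: real assume t: "t \<ge> 0"
  let ?u = uniform_partition
  have c1: "cauchy_wrt norm2 (\<lambda>k. S1 (?u k) t)" and c2: "cauchy_wrt norm2 (\<lambda>k. S2 (?u k) t)"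
    using S1 S2 t by (auto intro: uniformly_cauchy_sequence)
  have "(\<lambda>k. norm2 (S (?u k) t - (D t - S1 (?u k) t - S2 (?u k) t))) \<longlonglongrightarrow> 0"
    unfolding LIMSEQ_iff
  proof (intro allI impI)
    fix e :: real assume "e > 0"
    from Sd[OF t this] obtain d where d: "d > 0" "\<And>\<pi>. is_partition \<pi> \<Longrightarrow> mesh \<pi> < ereal d \<Longrightarrow> norm2 (Sd \<pi> t - D t) < e"
      using t by auto
    obtain N where "\<And>k. k \<ge> N \<Longrightarrow> mesh (?u k) < ereal d"
      using eventually_mesh_uniform_partition[OF d(1)] by (auto simp: eventually_sequentially)
    then have "norm2 (Sd (?u k) t - D t) < e" if "k \<ge> N" for k
      using d(2) is_partition_uniform that by blast
    then show "\<exists>N. \<forall>k\<ge>N. norm (norm2 (S (?u k) t - (D t - S1 (?u k) t - S2 (?u k) t)) - 0) < e"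
      by (intro exI[of _ N]) (simp add: S[OF is_partition_uniform t])
  qed
  then show "mesh_limit S t = cmpl_minus (pnorm E 2) (cmpl_minus (pnorm E 2) (cmpl_embed (pnorm E 2) (D t))
            (mesh_limit S1 t)) (mesh_limit S2 t)"
    unfolding pnorm_2_fun cmpl_embed_eq mesh_limit_def
    by (simp add: cmpl_minus_class c1 c2 cauchy_norm2_const cauchy_norm2_diff cmpl_class_eqI)
qed

end

section \<open>Riemann--Stieltjes sums\<close>

definition clamp_to :: "real \<Rightarrow> real \<Rightarrow> real \<Rightarrow> real" where
  "clamp_to a b x = max a (min b x)"

text \<open>Both sides are the increment of \<open>g\<close> over the intersection of \<open>{a..b}\<close> and
  \<open>{c..d}\<close>.\<close>

lemma clamp_to_increment_swap:
  fixes g :: "real \<Rightarrow> 'w::ab_group_add"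
  assumes "a \<le> b" "c \<le> d"
  shows "g (clamp_to a b d) - g (clamp_to a b c) = g (clamp_to c d b) - g (clamp_to c d a)"
proof (cases "max a c \<le> min b d")
  case True
  then have "clamp_to a b d = clamp_to c d b" "clamp_to a b c = clamp_to c d a"
    using assms by (auto simp: clamp_to_def min_def max_def split: if_splits)
  then show ?thesis by simp
next
  case False
  then have "clamp_to a b d = clamp_to a b c" "clamp_to c d b = clamp_to c d a"
    using assms by (auto simp: clamp_to_def min_def max_def split: if_splits)
  then show ?thesis by simp
qed

lemma clamp_to_nondegenerate:
  assumes "a \<le> b" "c \<le> d" "clamp_to a b c < clamp_to a b d"
  shows "clamp_to a b c \<in> {a..b} \<inter> {c..d}" "clamp_to a b d \<in> {a..b} \<inter> {c..d}"
  using assms by (auto simp: clamp_to_def min_def max_def split: if_splits)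

lemma mono_grid:
  fixes u :: "nat \<Rightarrow> real"
  assumes "\<And>i. i < n \<Longrightarrow> u i \<le> u (Suc i)" "i \<le> j" "j \<le> n"
  shows "u i \<le> u j"
  using assms(2,3)
proof (induction j)
  case (Suc j)
  show ?case
  proof (cases "i = Suc j")
    case False
    then have "u i \<le> u j" using Suc by simp
    then show ?thesis using assms(1)[of j] Suc by simp
  qed simp
qed simp

text \<open>Cutting the cells of either grid by the other one expresses both sums over the same
  intersections of cells, where the tags differ by at most twice the mesh.  This replaces a
  common refinement of the two grids.\<close>

lemma riemann_sums_close:
  fixes F :: "real \<Rightarrow> real \<Rightarrow> 'w::real_normed_vector" and u v :: "nat \<Rightarrow> real"
  assumes u: "u 0 = a" "u n = b" "\<And>i. i < n \<Longrightarrow> u i \<le> u (Suc i)" "\<And>i. i < n \<Longrightarrow> u (Suc i) - u i \<le> \<delta>"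
    and \<tau>: "\<And>i. i < n \<Longrightarrow> \<tau> i \<in> {u i..u (Suc i)}"
    and v: "v 0 = a" "v m = b" "\<And>j. j < m \<Longrightarrow> v j \<le> v (Suc j)" "\<And>j. j < m \<Longrightarrow> v (Suc j) - v j \<le> \<delta>"
    and \<sigma>: "\<And>j. j < m \<Longrightarrow> \<sigma> j \<in> {v j..v (Suc j)}"
    and est: "\<And>s t x y. a \<le> s \<Longrightarrow> s \<le> t \<Longrightarrow> t \<le> b \<Longrightarrow> x \<in> {a..b} \<Longrightarrow> y \<in> {a..b} \<Longrightarrow> \<bar>x - y\<bar> \<le> 2 * \<delta> \<Longrightarrow>
           norm ((F x t - F x s) - (F y t - F y s)) \<le> \<epsilon> * (V t - V s)"
  shows "norm ((\<Sum>i<n. F (\<tau> i) (u (Suc i)) - F (\<tau> i) (u i))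
             - (\<Sum>j<m. F (\<sigma> j) (v (Suc j)) - F (\<sigma> j) (v j))) \<le> \<epsilon> * (V b - V a)"
proof -
  define c where "c i j = clamp_to (u i) (u (Suc i)) (v j)" for i j
  have ub: "a \<le> u i" "u i \<le> b" if "i \<le> n" for i
    using mono_grid[of n u 0 i] mono_grid[of n u i n] u that by auto
  have vb: "a \<le> v j" "v j \<le> b" if "j \<le> m" for j
    using mono_grid[of m v 0 j] mono_grid[of m v j m] v that by auto
  have c0: "c i 0 = u i" and cm: "c i m = u (Suc i)" if "i < n" for i
    using ub[of i] ub[of "Suc i"] u(3)[of i] v(1,2) that by (auto simp: c_def clamp_to_def)
  have cut: "(\<Sum>j<m. g (c i (Suc j)) - g (c i j)) = g (u (Suc i)) - g (u i)" if "i < n"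
    for g :: "real \<Rightarrow> 'z::ab_group_add" and i
    using sum_lessThan_telescope[of "\<lambda>j. g (c i j)" m] that by (simp add: c0 cm)
  have cut': "(\<Sum>i<n. g (c i (Suc j)) - g (c i j)) = g (v (Suc j)) - g (v j)" if j: "j < m"
    for g :: "real \<Rightarrow> 'z::ab_group_add" and j
  proof -
    have "(\<Sum>i<n. g (c i (Suc j)) - g (c i j)) =
        (\<Sum>i<n. g (clamp_to (v j) (v (Suc j)) (u (Suc i))) - g (clamp_to (v j) (v (Suc j)) (u i)))"
      unfolding c_def using u(3) v(3)[OF j] by (intro sum.cong clamp_to_increment_swap) auto
    also have "\<dots> = g (clamp_to (v j) (v (Suc j)) (u n)) - g (clamp_to (v j) (v (Suc j)) (u 0))"
      by (rule sum_lessThan_telescope)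
    finally have "(\<Sum>i<n. g (c i (Suc j)) - g (c i j)) =
        g (clamp_to (v j) (v (Suc j)) (u n)) - g (clamp_to (v j) (v (Suc j)) (u 0))" .
    moreover have "clamp_to (v j) (v (Suc j)) (u n) = v (Suc j)" "clamp_to (v j) (v (Suc j)) (u 0) = v j"
      using vb[of j] vb[of "Suc j"] v(3)[OF j] j u(1,2) by (auto simp: clamp_to_def)
    ultimately show ?thesis by simp
  qed
  have cell: "norm ((F (\<tau> i) (c i (Suc j)) - F (\<tau> i) (c i j)) - (F (\<sigma> j) (c i (Suc j)) - F (\<sigma> j) (c i j)))
      \<le> \<epsilon> * (V (c i (Suc j)) - V (c i j))" if ij: "i < n" "j < m" for i j
  proof (cases "c i j < c i (Suc j)")
    case True
    have in1: "c i j \<in> {u i..u (Suc i)} \<inter> {v j..v (Suc j)}" "c i (Suc j) \<in> {u i..u (Suc i)} \<inter> {v j..v (Suc j)}"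
      using clamp_to_nondegenerate[OF u(3)[OF ij(1)] v(3)[OF ij(2)]] True by (auto simp: c_def)
    have "\<bar>\<tau> i - \<sigma> j\<bar> \<le> 2 * \<delta>"
      using in1(1) \<tau>[OF ij(1)] \<sigma>[OF ij(2)] u(4)[OF ij(1)] v(4)[OF ij(2)] by (auto simp: abs_le_iff)
    moreover have "\<tau> i \<in> {a..b}" "\<sigma> j \<in> {a..b}" "a \<le> c i j" "c i (Suc j) \<le> b"
      using in1 \<tau>[OF ij(1)] \<sigma>[OF ij(2)] ub[of i] ub[of "Suc i"] vb[of j] vb[of "Suc j"] ij by auto
    ultimately show ?thesis using True by (intro est) auto
  next
    case False
    then have "c i j = c i (Suc j)"
      using v(3)[OF ij(2)] by (auto simp: c_def clamp_to_def min_def max_def split: if_splits)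
    then show ?thesis by simp
  qed
  have "(\<Sum>i<n. F (\<tau> i) (u (Suc i)) - F (\<tau> i) (u i)) =
      (\<Sum>i<n. \<Sum>j<m. F (\<tau> i) (c i (Suc j)) - F (\<tau> i) (c i j))"
    by (intro sum.cong) (simp_all add: cut)
  moreover have "(\<Sum>j<m. F (\<sigma> j) (v (Suc j)) - F (\<sigma> j) (v j)) =
      (\<Sum>i<n. \<Sum>j<m. F (\<sigma> j) (c i (Suc j)) - F (\<sigma> j) (c i j))"
    by (subst sum.swap) (intro sum.cong, simp_all add: cut')
  ultimately have "(\<Sum>i<n. F (\<tau> i) (u (Suc i)) - F (\<tau> i) (u i)) - (\<Sum>j<m. F (\<sigma> j) (v (Suc j)) - F (\<sigma> j) (v j)) =
     (\<Sum>i<n. \<Sum>j<m. (F (\<tau> i) (c i (Suc j)) - F (\<tau> i) (c i j)) - (F (\<sigma> j) (c i (Suc j)) - F (\<sigma> j) (c i j)))"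
    by (simp add: sum_subtractf)
  also have "norm \<dots> \<le> (\<Sum>i<n. \<Sum>j<m. \<epsilon> * (V (c i (Suc j)) - V (c i j)))"
    by (intro sum_norm_le, rule cell) simp_all
  also have "\<dots> = (\<Sum>i<n. \<epsilon> * (V (u (Suc i)) - V (u i)))"
    unfolding sum_distrib_left[symmetric] using cut[of _ V] by simp
  also have "\<dots> = \<epsilon> * (V b - V a)"
    using sum_lessThan_telescope[of "\<lambda>i. V (u i)" n] u by (simp flip: sum_distrib_left)
  finally show ?thesis .
qed

text \<open>Grids may repeat points: those cut off from a partition at a time \<open>t\<close> stay at \<open>t\<close> from
  some index on.\<close>

definition tagged_grid :: "real \<Rightarrow> real \<Rightarrow> nat \<Rightarrow> (nat \<Rightarrow> real) \<Rightarrow> (nat \<Rightarrow> real) \<Rightarrow> bool" where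
  "tagged_grid t \<delta> n u \<tau> \<longleftrightarrow> u 0 = 0 \<and> u n = t \<and>
     (\<forall>i<n. u i \<le> u (Suc i) \<and> u (Suc i) - u i < \<delta> \<and> \<tau> i \<in> {u i..u (Suc i)})"

text \<open>For \<open>F x s = G x (g s)\<close> with additive \<open>G x\<close>, these are the Riemann--Stieltjes sums of
  \<open>G\<close> against \<open>g\<close>.\<close>

definition tagged_sum ::
  "(real \<Rightarrow> real \<Rightarrow> 'w::ab_group_add) \<Rightarrow> nat \<Rightarrow> (nat \<Rightarrow> real) \<Rightarrow> (nat \<Rightarrow> real) \<Rightarrow> 'w" where
  "tagged_sum F n u \<tau> = (\<Sum>i<n. F (\<tau> i) (u (Suc i)) - F (\<tau> i) (u i))"

definition uniform_sum :: "(real \<Rightarrow> real \<Rightarrow> 'w::ab_group_add) \<Rightarrow> real \<Rightarrow> nat \<Rightarrow> 'w" where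
  "uniform_sum F t k =
     tagged_sum F (Suc k) (\<lambda>i. t * uniform_partition k i) (\<lambda>i. t * uniform_partition k i)"

definition rs_limit :: "(real \<Rightarrow> real \<Rightarrow> 'w::real_normed_vector) \<Rightarrow> real \<Rightarrow> 'w" where
  "rs_limit F t = lim (uniform_sum F t)"

lemma eventually_tagged_uniform_grid:
  assumes "\<delta> > 0" "t \<ge> 0"
  shows "eventually (\<lambda>k. tagged_grid t \<delta> (Suc k) (\<lambda>i. t * uniform_partition k i)
                           (\<lambda>i. t * uniform_partition k i)) sequentially"
proof -
  have "(\<lambda>k. t * inverse (real (Suc k))) \<longlonglongrightarrow> 0"
    using tendsto_mult_left[OF LIMSEQ_inverse_real_of_nat, of t] by simp
  from order_tendstoD(2)[OF this assms(1)] show ?thesis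
  proof eventually_elim
    case (elim k)
    have "t * uniform_partition k (Suc i) - t * uniform_partition k i = t * inverse (real (Suc k))" for i
      unfolding uniform_partition_def of_nat_Suc[of i] add_divide_distrib
      by (simp add: distrib_left inverse_eq_divide)
    then have "t * uniform_partition k (Suc i) - t * uniform_partition k i < \<delta>"
      "t * uniform_partition k i \<le> t * uniform_partition k (Suc i)" for i
      using elim assms(2) by (auto simp: uniform_partition_def divide_right_mono mult_left_mono)
    moreover have "uniform_partition k 0 = 0" "uniform_partition k (Suc k) = 1"
      by (simp_all add: uniform_partition_def)
    ultimately show ?case by (simp add: tagged_grid_def)
  qed
qed

text \<open>\<open>V\<close> plays the role of the variation of the integrator, and the factor \<open>\<epsilon>\<close> that of the
  modulus of continuity of the integrand.  The same \<open>\<delta>\<close> serves for all end points \<open>t\<close>.\<close>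

lemma rs_limit_uniform:
  fixes F :: "real \<Rightarrow> real \<Rightarrow> 'w::banach"
  assumes est: "\<And>\<epsilon>. \<epsilon> > 0 \<Longrightarrow> \<exists>\<delta>>0. \<forall>s t x y. 0 \<le> s \<and> s \<le> t \<and> t \<le> T \<and> x \<in> {0..T} \<and> y \<in> {0..T} \<and> \<bar>x - y\<bar> \<le> \<delta> \<longrightarrow>
           norm ((F x t - F x s) - (F y t - F y s)) \<le> \<epsilon> * (V t - V s)"
    and V: "\<And>s t. 0 \<le> s \<Longrightarrow> s \<le> t \<Longrightarrow> t \<le> T \<Longrightarrow> V s \<le> V t"
    and \<epsilon>: "\<epsilon> > 0"
  shows "\<exists>\<delta>>0. \<forall>t\<in>{0..T}. \<forall>n u \<tau>. tagged_grid t \<delta> n u \<tau> \<longrightarrow>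
        norm (tagged_sum F n u \<tau> - rs_limit F t) \<le> \<epsilon>"
proof (cases "T \<ge> 0")
  case T: True
  \<comment> \<open>the summand \<open>1\<close> avoids division by \<open>0\<close> when \<open>V\<close> is constant\<close>
  define W where "W = V T - V 0 + 1"
  have W: "W > 0" using V[of 0 T] T by (simp add: W_def)
  have close: "\<exists>\<delta>>0. \<forall>t\<in>{0..T}. \<forall>n u \<tau> m v \<sigma>. tagged_grid t \<delta> n u \<tau> \<longrightarrow> tagged_grid t \<delta> m v \<sigma> \<longrightarrow>
        norm (tagged_sum F n u \<tau> - tagged_sum F m v \<sigma>) \<le> e" if e: "e > 0" for e
  proof -
    have "e / W > 0" using e W by simp
    from est[OF this] obtain \<delta> where \<delta>: "\<delta> > 0" "\<And>s t x y. 0 \<le> s \<Longrightarrow> s \<le> t \<Longrightarrow> t \<le> T \<Longrightarrow> x \<in> {0..T} \<Longrightarrow> y \<in> {0..T} \<Longrightarrow> \<bar>x - y\<bar> \<le> \<delta> \<Longrightarrow>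
           norm ((F x t - F x s) - (F y t - F y s)) \<le> (e / W) * (V t - V s)"
      by blast
    have "norm (tagged_sum F n u \<tau> - tagged_sum F m v \<sigma>) \<le> e"
      if t: "t \<in> {0..T}" and u: "tagged_grid t (\<delta> / 2) n u \<tau>" and v: "tagged_grid t (\<delta> / 2) m v \<sigma>"
      for t n u \<tau> m v \<sigma>
    proof -
      have "norm (tagged_sum F n u \<tau> - tagged_sum F m v \<sigma>) \<le> (e / W) * (V t - V 0)"
        unfolding tagged_sum_def
        by (rule riemann_sums_close[where \<delta> = "\<delta> / 2"])
          (use u v t \<delta>(2) in \<open>auto simp: tagged_grid_def intro: less_imp_le\<close>)
      also have "\<dots> \<le> (e / W) * W"
        using V[of t T] t e W by (intro mult_left_mono) (auto simp: W_def)
      finally show ?thesis using W by simp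
    qed
    then show ?thesis using \<delta>(1) by (intro exI[of _ "\<delta> / 2"]) auto
  qed
  have lim: "uniform_sum F t \<longlonglongrightarrow> rs_limit F t" if t: "t \<in> {0..T}" for t
  proof -
    have "Cauchy (uniform_sum F t)"
      unfolding Cauchy_iff
    proof (intro allI impI)
      fix e :: real assume e: "e > 0"
      then have "e / 2 > 0" by simp
      from close[OF this] obtain \<delta> where \<delta>: "\<delta> > 0"
        and D: "\<And>n u \<tau> m v \<sigma>. tagged_grid t \<delta> n u \<tau> \<Longrightarrow> tagged_grid t \<delta> m v \<sigma> \<Longrightarrow>
          norm (tagged_sum F n u \<tau> - tagged_sum F m v \<sigma>) \<le> e / 2"
        using t by blast
      obtain N where "\<And>k. k \<ge> N \<Longrightarrow> tagged_grid t \<delta> (Suc k) (\<lambda>i. t * uniform_partition k i)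
                           (\<lambda>i. t * uniform_partition k i)"
        using eventually_tagged_uniform_grid[OF \<delta>, of t] t by (auto simp: eventually_sequentially)
      then have "norm (uniform_sum F t k - uniform_sum F t l) \<le> e / 2" if "k \<ge> N" "l \<ge> N" for k l
        unfolding uniform_sum_def using D that by blast
      then show "\<exists>N. \<forall>k\<ge>N. \<forall>l\<ge>N. norm (uniform_sum F t k - uniform_sum F t l) < e"
        using e by (intro exI[of _ N]) force
    qed
    then show ?thesis unfolding rs_limit_def by (simp add: Cauchy_convergent convergent_LIMSEQ_iff[symmetric])
  qed
  from close[OF \<epsilon>] obtain \<delta> where \<delta>: "\<delta> > 0"
    and D: "\<And>t n u \<tau> m v \<sigma>. t \<in> {0..T} \<Longrightarrow> tagged_grid t \<delta> n u \<tau> \<Longrightarrow> tagged_grid t \<delta> m v \<sigma> \<Longrightarrow>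
          norm (tagged_sum F n u \<tau> - tagged_sum F m v \<sigma>) \<le> \<epsilon>"
    by blast
  have "norm (tagged_sum F n u \<tau> - rs_limit F t) \<le> \<epsilon>"
    if t: "t \<in> {0..T}" and u: "tagged_grid t \<delta> n u \<tau>" for t n u \<tau>
  proof (rule tendsto_upperbound)
    show "(\<lambda>k. norm (tagged_sum F n u \<tau> - uniform_sum F t k)) \<longlonglongrightarrow>
        norm (tagged_sum F n u \<tau> - rs_limit F t)"
      by (intro tendsto_intros lim[OF t])
    have "t \<ge> 0" using t by simp
    show "eventually (\<lambda>k. norm (tagged_sum F n u \<tau> - uniform_sum F t k) \<le> \<epsilon>) sequentially"
      using eventually_tagged_uniform_grid[OF \<delta> \<open>t \<ge> 0\<close>]
      by eventually_elim (unfold uniform_sum_def, rule D[OF t u])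
  qed simp
  then show ?thesis using \<delta> by blast
qed (auto intro!: exI[of _ 1])

text \<open>The sums over a partition only see the points before \<open>t\<close>; with \<open>u i = min (\<pi> i) t\<close> they
  become sums over a finite grid of \<open>{0..t}\<close>, and the coefficient may be read off at \<open>u i\<close>
  instead of \<open>\<pi> i\<close>, as the increment vanishes when these differ.\<close>

lemma partition_suminf:
  fixes K :: "real \<Rightarrow> real \<Rightarrow> real \<Rightarrow> 'w::real_normed_vector"
  assumes \<pi>: "is_partition \<pi>" and t: "t \<ge> 0" and N: "t \<le> \<pi> N"
    and K: "\<And>r s. 0 \<le> r \<Longrightarrow> 0 \<le> s \<Longrightarrow> K r s s = 0"
  shows "(\<Sum>n. K (\<pi> (n - 1)) (min (\<pi> (n - 1)) t) (min (\<pi> n) t)) =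
         (\<Sum>i<N. K (min (\<pi> i) t) (min (\<pi> i) t) (min (\<pi> (Suc i)) t))"
proof -
  have m: "\<pi> i \<le> \<pi> j" if "i \<le> j" for i j
    using \<pi> that unfolding is_partition_def by (simp add: strict_mono_less_eq)
  have p0: "\<pi> 0 = 0" using \<pi> by (simp add: is_partition_def)
  have nn: "0 \<le> \<pi> i" for i using m[of 0 i] p0 by simp
  have "(\<Sum>n. K (\<pi> (n - 1)) (min (\<pi> (n - 1)) t) (min (\<pi> n) t)) =
      (\<Sum>n<Suc N. K (\<pi> (n - 1)) (min (\<pi> (n - 1)) t) (min (\<pi> n) t))"
  proof (rule suminf_finite)
    fix n assume "n \<notin> {..<Suc N}"
    then have "N \<le> n - 1" "N \<le> n" by auto
    then have "t \<le> \<pi> (n - 1)" "t \<le> \<pi> n" using N m by (blast intro: order_trans)+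
    then show "K (\<pi> (n - 1)) (min (\<pi> (n - 1)) t) (min (\<pi> n) t) = 0" using K[OF nn t] by (simp add: min_absorb2)
  qed simp
  also have "\<dots> = (\<Sum>i<N. K (\<pi> i) (min (\<pi> i) t) (min (\<pi> (Suc i)) t))"
    unfolding sum.lessThan_Suc_shift using K[of 0 0] p0 t by (simp add: min_absorb1)
  also have "\<dots> = (\<Sum>i<N. K (min (\<pi> i) t) (min (\<pi> i) t) (min (\<pi> (Suc i)) t))"
  proof (rule sum.cong)
    fix i
    show "K (\<pi> i) (min (\<pi> i) t) (min (\<pi> (Suc i)) t) = K (min (\<pi> i) t) (min (\<pi> i) t) (min (\<pi> (Suc i)) t)"
    proof (cases "\<pi> i \<le> t")
      case False
      then have "t \<le> \<pi> i" "t \<le> \<pi> (Suc i)" using m[of i "Suc i"] by auto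
      then show ?thesis using K[OF nn t] K[OF t t] by (simp add: min_absorb2)
    qed (simp add: min_absorb1)
  qed simp
  finally show ?thesis .
qed

lemma partition_grid:
  assumes \<pi>: "is_partition \<pi>" and t: "t \<ge> 0" and N: "t \<le> \<pi> N" and d: "mesh \<pi> < ereal d"
  defines "u \<equiv> \<lambda>i. min (\<pi> i) t"
  shows "u 0 = 0" "u N = t" "\<And>i. u i \<le> u (Suc i)" "\<And>i. u (Suc i) - u i < d" "\<And>i. u i \<in> {0..t}"
proof -
  have m: "\<pi> i \<le> \<pi> j" if "i \<le> j" for i j
    using \<pi> that unfolding is_partition_def by (simp add: strict_mono_less_eq)
  have p0: "\<pi> 0 = 0" using \<pi> by (simp add: is_partition_def)
  have md: "\<pi> (Suc i) - \<pi> i < d" for i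
  proof -
    have "ereal (\<pi> (Suc i) - \<pi> (Suc i - 1)) \<le> mesh \<pi>"
      unfolding mesh_def by (rule SUP_upper) simp
    from le_less_trans[OF this d] show ?thesis by simp
  qed
  show "u 0 = 0" "u N = t" using p0 t N by (auto simp: u_def)
  show "u i \<le> u (Suc i)" for i using m[of i "Suc i"] by (auto simp: u_def)
  show "u (Suc i) - u i < d" for i
    using md[of i] m[of i "Suc i"] by (auto simp: u_def min_def)
  show "u i \<in> {0..t}" for i using m[of 0 i] p0 t by (auto simp: u_def)
qed

lemma partition_exceeds: "is_partition \<pi> \<Longrightarrow> \<exists>N. t \<le> \<pi> N"
  unfolding is_partition_def filterlim_at_top eventually_sequentially by blast

text \<open>\<open>W t\<close> is the supremum of the variation sums over subdivisions of \<open>{0..t}\<close>: adjoining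
  the cell \<open>{s..t}\<close> to a subdivision of \<open>{0..s}\<close> gives one of \<open>{0..t}\<close>.  Trading the
  variation for the increments of a monotone real function makes sums over cells telescope.\<close>

lemma variation_function:
  fixes G :: "real \<Rightarrow> 'v::minus" and \<nu> :: "'v \<Rightarrow> ereal"
  assumes bv: "locally_bounded_variation \<nu> G" and nonneg: "\<And>v. 0 \<le> \<nu> v"
  obtains W :: "real \<Rightarrow> real" where "\<And>s t. 0 \<le> s \<Longrightarrow> s \<le> t \<Longrightarrow> \<nu> (G t - G s) \<le> ereal (W t - W s)"
proof -
  define var_sums where "var_sums t = {(\<Sum>i<n. \<nu> (G (u (Suc i)) - G (u i))) |n u.
      0 \<le> u 0 \<and> u n \<le> t \<and> (\<forall>i<n. u i \<le> u (Suc i))}" for t :: real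
  have fin: "\<exists>w. Sup (var_sums t) = ereal w" if t: "t \<ge> 0" for t
  proof -
    obtain B :: real where B: "\<And>n (u :: nat \<Rightarrow> real). 0 \<le> u 0 \<and> u n \<le> t \<and> (\<forall>i<n. u i \<le> u (Suc i)) \<Longrightarrow>
        (\<Sum>i<n. \<nu> (G (u (Suc i)) - G (u i))) \<le> ereal B"
      using bv t unfolding locally_bounded_variation_def by metis
    have "Sup (var_sums t) \<le> ereal B" by (rule Sup_least) (auto simp: var_sums_def B)
    moreover have "0 \<in> var_sums t" unfolding var_sums_def using t by (auto intro!: exI[of _ 0] exI[of _ "\<lambda>_. 0"])
    then have "0 \<le> Sup (var_sums t)" by (rule Sup_upper)
    ultimately show ?thesis by (cases "Sup (var_sums t)") auto
  qed
  then obtain W where W: "\<And>t. t \<ge> 0 \<Longrightarrow> Sup (var_sums t) = ereal (W t)" by metis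
  have "\<nu> (G t - G s) \<le> ereal (W t - W s)" if st: "0 \<le> s" "s \<le> t" for s t
  proof -
    have ext: "x + \<nu> (G t - G s) \<le> ereal (W t)" if x_in: "x \<in> var_sums s" for x
    proof -
      obtain n and u :: "nat \<Rightarrow> real" where x: "x = (\<Sum>i<n. \<nu> (G (u (Suc i)) - G (u i)))"
        and u: "0 \<le> u 0" "u n \<le> s" "\<And>i. i < n \<Longrightarrow> u i \<le> u (Suc i)"
        using x_in unfolding var_sums_def by blast
      define v where "v i = (if i \<le> n then u i else if i = Suc n then s else t)" for i
      have v: "0 \<le> v 0" "v (Suc (Suc n)) \<le> t" "\<forall>i<Suc (Suc n). v i \<le> v (Suc i)"
        using u st by (auto simp: v_def less_Suc_eq)
      have "(\<Sum>i<n. \<nu> (G (v (Suc i)) - G (v i))) = x"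
        unfolding x by (intro sum.cong) (auto simp: v_def)
      then have "(\<Sum>i<Suc (Suc n). \<nu> (G (v (Suc i)) - G (v i))) = x + \<nu> (G s - G (u n)) + \<nu> (G t - G s)"
        by (simp add: v_def)
      moreover have "x + 0 + \<nu> (G t - G s) \<le> x + \<nu> (G s - G (u n)) + \<nu> (G t - G s)"
        by (intro add_mono order_refl nonneg)
      moreover have "(\<Sum>i<Suc (Suc n). \<nu> (G (v (Suc i)) - G (v i))) \<in> var_sums t"
        unfolding var_sums_def using v by blast
      then have "(\<Sum>i<Suc (Suc n). \<nu> (G (v (Suc i)) - G (v i))) \<le> Sup (var_sums t)" by (rule Sup_upper)
      ultimately show ?thesis using W[of t] st by simp
    qed
    have "0 \<in> var_sums s" unfolding var_sums_def using st by (auto intro!: exI[of _ 0] exI[of _ "\<lambda>_. 0"])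
    from ext[OF this] have "\<nu> (G t - G s) \<le> ereal (W t)" by simp
    then obtain r where r: "\<nu> (G t - G s) = ereal r"
      using nonneg[of "G t - G s"] by (cases "\<nu> (G t - G s)") auto
    have "Sup (var_sums s) \<le> ereal (W t - r)"
    proof (rule Sup_least)
      fix x assume "x \<in> var_sums s"
      from ext[OF this] show "x \<le> ereal (W t - r)" unfolding r by (cases x) auto
    qed
    then show ?thesis using W[OF st(1)] r by simp
  qed
  then show thesis by (rule that)
qed

section \<open>Stochastic sums\<close>

lemma subalgebra_minus:
  assumes "unital_closed_star_subalgebra N" "x \<in> N" "y \<in> N" shows "x - y \<in> N"
proof -
  have "(-1) *\<^sub>C y \<in> N" using assms unfolding unital_closed_star_subalgebra_def by blast
  then have "x + (-1) *\<^sub>C y \<in> N" using assms unfolding unital_closed_star_subalgebra_def by blast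
  then show ?thesis by (simp add: scaleC_minus_left)
qed

lemma subalgebra_zero: "unital_closed_star_subalgebra N \<Longrightarrow> 0 \<in> N"
  unfolding unital_closed_star_subalgebra_def using scaleC_zero_left by metis

text \<open>The martingale property, tested against elements of the algebras of the filtration.\<close>

definition orthogonal_increments ::
  "('a::cstar_algebra \<Rightarrow> complex) \<Rightarrow> (real \<Rightarrow> 'a set) \<Rightarrow> (real \<Rightarrow> 'a) \<Rightarrow> bool" where
  "orthogonal_increments E F M \<longleftrightarrow>
     (\<forall>s t b. 0 \<le> s \<and> s \<le> t \<and> b \<in> F s \<longrightarrow> E (b * (M t - M s)) = 0)"

lemma (in filtered_cstar_probability_space) martingale_orthogonal_increments:
  assumes "martingale E F M" shows "orthogonal_increments E F M"
  unfolding orthogonal_increments_def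
proof (intro allI impI)
  fix s t b assume *: "0 \<le> s \<and> s \<le> t \<and> b \<in> F s"
  have mem: "(\<lambda>_. a) \<in> cmpl_embed (pnorm E 1) a" for a
    by (simp add: cmpl_embed_def cmpl_class_def cauchy_wrt_def pnorm_1_zero)
  have "has_cond_exp E 1 (F s) (cmpl_embed (pnorm E 1) (M t)) (cmpl_embed (pnorm E 1) (M s))"
    using assms * unfolding martingale_def by blast
  then have lim: "\<forall>b\<in>F s. \<forall>x\<in>cmpl_embed (pnorm E 1) (M t). \<forall>y\<in>cmpl_embed (pnorm E 1) (M s).
      (\<lambda>n. E (b * y n) - E (b * x n)) \<longlonglongrightarrow> 0"
    unfolding has_cond_exp_def by blast
  have "b \<in> F s" using * by blast
  from bspec[OF bspec[OF bspec[OF lim this] mem] mem]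
  have "(\<lambda>n::nat. E (b * M s) - E (b * M t)) \<longlonglongrightarrow> 0" .
  then have "E (b * M s) - E (b * M t) = 0" using LIMSEQ_const_iff by blast
  then show "E (b * (M t - M s)) = 0" by (simp add: right_diff_distrib E_diff)
qed

text \<open>Pythagoras, for the orthogonal vectors \<open>M s\<close> and \<open>M t - M s\<close>.\<close>

lemma (in filtered_cstar_probability_space) norm2_increment:
  assumes "orthogonal_increments E F M" "adapted F M" "0 \<le> s" "s \<le> t"
  shows "(norm2 (M t - M s))\<^sup>2 = (norm2 (M t))\<^sup>2 - (norm2 (M s))\<^sup>2"
proof -
  have "star (M s) \<in> F s"
    using assms F_subalgebra[of s] unfolding adapted_def unital_closed_star_subalgebra_def by blast
  then have "E (star (M s) * (M t - M s)) = 0"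
    using assms unfolding orthogonal_increments_def by blast
  then show ?thesis using norm2_add_square[of "M s" "M t - M s"] by simp
qed

lemma Linf_decomposable_continuous:
  assumes "Linf_decomposable E F X" shows "continuous_on {0..} X"
proof -
  obtain M A where MA: "continuous_on {0..} M" "continuous_on {0..} A" "\<forall>t\<ge>0. X t = X 0 + M t + A t"
    using assms unfolding Linf_decomposable_def by auto
  have "continuous_on {0..} (\<lambda>t. X 0 + M t + A t)" by (intro continuous_intros MA)
  moreover have "continuous_on {0..} X \<longleftrightarrow> continuous_on {0..} (\<lambda>t. X 0 + M t + A t)"
    by (rule continuous_on_cong[OF refl]) (rule MA(3)[rule_format], simp)
  ultimately show ?thesis by blast
qed

text \<open>An adapted process of bilinear maps, with its variation packed into a nondecreasing
  function \<open>V\<close> that also dominates the norms.  The first argument is the one into which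
  martingale increments are inserted, so that a process gives rise to two instances.\<close>

locale adapted_bilinear_process =
  A: filtered_cstar_probability_space EA FA + B: filtered_cstar_probability_space EB FB +
  C: filtered_cstar_probability_space EC FC
  for EA :: "'a::cstar_algebra \<Rightarrow> complex" and FA
    and EB :: "'b::cstar_algebra \<Rightarrow> complex" and FB
    and EC :: "'c::cstar_algebra \<Rightarrow> complex" and FC +
  fixes L :: "real \<Rightarrow> 'a \<Rightarrow> 'b \<Rightarrow> 'c" and V :: "real \<Rightarrow> real"
  assumes bilin: "t \<ge> 0 \<Longrightarrow> bilinear (L t)"
    and V_mono: "0 \<le> s \<Longrightarrow> s \<le> t \<Longrightarrow> V s \<le> V t"
    and V_nonneg: "0 \<le> V 0"
    and increment: "0 \<le> s \<Longrightarrow> s \<le> t \<Longrightarrow> norm (L t x y - L s x y) \<le> (V t - V s) * norm x * norm y"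
    and bound: "0 \<le> t \<Longrightarrow> norm (L t x y) \<le> V t * norm x * norm y"
    and bound2: "0 \<le> t \<Longrightarrow> C.norm2 (L t x y) \<le> V t * A.norm2 x * norm y"
    and adapt: "0 \<le> s \<Longrightarrow> s \<le> t \<Longrightarrow> x \<in> FA t \<Longrightarrow> y \<in> FB t \<Longrightarrow> L s x y \<in> FC t"
    and orthogonal: "0 \<le> t \<Longrightarrow> (\<And>b. b \<in> FA t \<Longrightarrow> EA (b * x) = 0) \<Longrightarrow> y \<in> FB t \<Longrightarrow> c \<in> FC t \<Longrightarrow>
       EC (c * L t x y) = 0"
begin

lemma V_ge_0: "0 \<le> t \<Longrightarrow> 0 \<le> V t"
  using V_mono[of 0 t] V_nonneg by simp

lemma L_add_left: "t \<ge> 0 \<Longrightarrow> L t (x + x') y = L t x y + L t x' y"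
  and L_diff_left: "t \<ge> 0 \<Longrightarrow> L t (x - x') y = L t x y - L t x' y"
  and L_diff_right: "t \<ge> 0 \<Longrightarrow> L t x (y - y') = L t x y - L t x y'"
  and L_zero_left: "t \<ge> 0 \<Longrightarrow> L t 0 y = 0"
  using bilin[of t] by (simp_all add: bilinear_ladd bilinear_lsub bilinear_rsub bilinear_lzero)

text \<open>The Ito estimate: the \<open>i\<close>-th summand is orthogonal to the earlier ones, which lie in
  \<open>FC (u i)\<close>, so the squared two-norms of the summands add up, and those of the increments of
  \<open>M\<close> telescope.  The membership in \<open>FC (u n)\<close> is carried along for the induction.\<close>

lemma martingale_sum_bound:
  assumes M: "orthogonal_increments EA FA M" "adapted FA M"
    and u: "\<And>i. u i \<le> u (Suc i)" "\<And>i. u i \<in> {0..T}"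
    and y: "\<And>i. y i \<in> FB (u i)" "\<And>i. norm (y i) \<le> \<epsilon>"
  shows "(C.norm2 (\<Sum>i<n. L (u i) (M (u (Suc i)) - M (u i)) (y i)))\<^sup>2
         \<le> (V T * \<epsilon>)\<^sup>2 * ((A.norm2 (M (u n)))\<^sup>2 - (A.norm2 (M (u 0)))\<^sup>2)
    \<and> (\<Sum>i<n. L (u i) (M (u (Suc i)) - M (u i)) (y i)) \<in> FC (u n)"
proof (induction n)
  case 0
  then show ?case using u C.F_subalgebra by (simp add: subalgebra_zero)
next
  case (Suc n)
  define S where "S = (\<Sum>i<n. L (u i) (M (u (Suc i)) - M (u i)) (y i))"
  define D where "D = L (u n) (M (u (Suc n)) - M (u n)) (y n)"
  have un: "0 \<le> u n" "u n \<le> T" "u n \<le> u (Suc n)" "0 \<le> u (Suc n)" using u by auto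
  have IH: "(C.norm2 S)\<^sup>2 \<le> (V T * \<epsilon>)\<^sup>2 * ((A.norm2 (M (u n)))\<^sup>2 - (A.norm2 (M (u 0)))\<^sup>2)"
    "S \<in> FC (u n)" using Suc by (auto simp: S_def)
  have \<epsilon>: "0 \<le> \<epsilon>" using y(2)[of 0] norm_ge_zero[of "y 0"] by linarith
  have "star S \<in> FC (u n)"
    using IH C.F_subalgebra[OF un(1)] unfolding unital_closed_star_subalgebra_def by blast
  then have "EC (star S * D) = 0"
    unfolding D_def using M un y by (intro orthogonal) (auto simp: orthogonal_increments_def)
  then have "(C.norm2 (S + D))\<^sup>2 = (C.norm2 S)\<^sup>2 + (C.norm2 D)\<^sup>2"
    unfolding C.norm2_add_square by simp
  moreover have "(C.norm2 D)\<^sup>2 \<le> (V T * \<epsilon>)\<^sup>2 * ((A.norm2 (M (u (Suc n))))\<^sup>2 - (A.norm2 (M (u n)))\<^sup>2)"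
  proof -
    have "C.norm2 D \<le> V (u n) * A.norm2 (M (u (Suc n)) - M (u n)) * norm (y n)"
      unfolding D_def by (rule bound2[OF un(1)])
    also have "\<dots> \<le> V T * A.norm2 (M (u (Suc n)) - M (u n)) * \<epsilon>"
      using V_mono[OF un(1,2)] V_ge_0[OF un(1)] y(2)[of n] \<epsilon>
      by (intro mult_mono mult_nonneg_nonneg) auto
    finally have "(C.norm2 D)\<^sup>2 \<le> (V T * A.norm2 (M (u (Suc n)) - M (u n)) * \<epsilon>)\<^sup>2"
      by (intro power_mono) auto
    then show ?thesis
      using A.norm2_increment[OF M un(1,3)] by (simp add: power_mult_distrib mult_ac)
  qed
  ultimately have "(C.norm2 (S + D))\<^sup>2 \<le> (V T * \<epsilon>)\<^sup>2 * ((A.norm2 (M (u (Suc n))))\<^sup>2 - (A.norm2 (M (u 0)))\<^sup>2)"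
    using IH(1) by (simp add: algebra_simps)
  moreover have "S + D \<in> FC (u (Suc n))"
  proof -
    have "M (u (Suc n)) - M (u n) \<in> FA (u (Suc n))"
      using M(2) un A.F_mono[OF un(1,3)] unfolding adapted_def
      by (intro subalgebra_minus A.F_subalgebra) auto
    moreover have "y n \<in> FB (u (Suc n))" using y(1)[of n] B.F_mono[OF un(1,3)] by blast
    ultimately have "D \<in> FC (u (Suc n))" unfolding D_def using un by (intro adapt) auto
    moreover have "S \<in> FC (u (Suc n))" using IH(2) C.F_mono[OF un(1,3)] by blast
    ultimately show ?thesis
      using C.F_subalgebra[OF un(4)] unfolding unital_closed_star_subalgebra_def by blast
  qed
  ultimately show ?case by (simp add: S_def D_def)
qed

lemma finite_variation_sum_bound:
  assumes Z: "\<And>s t. 0 \<le> s \<Longrightarrow> s \<le> t \<Longrightarrow> norm (Z t - Z s) \<le> W t - W s"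
    and u: "\<And>i. u i \<le> u (Suc i)" "\<And>i. u i \<in> {0..T}"
    and y: "\<And>i. norm (y i) \<le> \<epsilon>"
  shows "norm (\<Sum>i<n. L (u i) (Z (u (Suc i)) - Z (u i)) (y i)) \<le> V T * \<epsilon> * (W (u n) - W (u 0))"
proof -
  have \<epsilon>: "0 \<le> \<epsilon>" using y[of 0] norm_ge_zero[of "y 0"] by linarith
  have "norm (L (u i) (Z (u (Suc i)) - Z (u i)) (y i)) \<le> V T * \<epsilon> * (W (u (Suc i)) - W (u i))" for i
  proof -
    have ui: "0 \<le> u i" "u i \<le> T" using u by auto
    have "norm (L (u i) (Z (u (Suc i)) - Z (u i)) (y i)) \<le> V (u i) * norm (Z (u (Suc i)) - Z (u i)) * norm (y i)"
      by (rule bound[OF ui(1)])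
    also have "\<dots> \<le> V T * (W (u (Suc i)) - W (u i)) * \<epsilon>"
      using V_mono[OF ui] V_ge_0[OF ui(1)] y[of i] \<epsilon> Z[OF ui(1) u(1)[of i]]
        order_trans[OF norm_ge_zero Z[OF ui(1) u(1)[of i]]]
      by (intro mult_mono mult_nonneg_nonneg) auto
    finally show ?thesis by (simp add: mult_ac)
  qed
  then have "norm (\<Sum>i<n. L (u i) (Z (u (Suc i)) - Z (u i)) (y i))
      \<le> (\<Sum>i<n. V T * \<epsilon> * (W (u (Suc i)) - W (u i)))"
    by (intro sum_norm_le) auto
  also have "\<dots> = V T * \<epsilon> * (W (u n) - W (u 0))"
    using sum_lessThan_telescope[of "\<lambda>i. W (u i)" n] by (simp flip: sum_distrib_left)
  finally show ?thesis .
qed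

text \<open>The bound is linear in \<open>\<epsilon>\<close> and independent of the grid, so that a uniformly small change of
  the second argument is negligible in all left-endpoint sums at once.\<close>

lemma decomposable_sum_bound:
  assumes M: "orthogonal_increments EA FA M" "adapted FA M"
    and Z: "\<And>s t. 0 \<le> s \<Longrightarrow> s \<le> t \<Longrightarrow> norm (Z t - Z s) \<le> W t - W s"
    and X: "\<And>t. 0 \<le> t \<Longrightarrow> X t = X 0 + M t + Z t"
    and u: "\<And>i. u i \<le> u (Suc i)" "\<And>i. u i \<in> {0..T}"
    and y: "\<And>i. y i \<in> FB (u i)" "\<And>i. norm (y i) \<le> \<epsilon>"
  shows "C.norm2 (\<Sum>i<n. L (u i) (X (u (Suc i)) - X (u i)) (y i))
         \<le> \<epsilon> * (V T * (A.norm2 (M T) + (W T - W 0)))"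
proof -
  have \<epsilon>: "0 \<le> \<epsilon>" using y(2)[of 0] norm_ge_zero[of "y 0"] by linarith
  have un: "0 \<le> u n" "u n \<le> T" "0 \<le> u 0" "u 0 \<le> T" "0 \<le> T" using u(2)[of n] u(2)[of 0] by auto
  define SM where "SM = (\<Sum>i<n. L (u i) (M (u (Suc i)) - M (u i)) (y i))"
  define SZ where "SZ = (\<Sum>i<n. L (u i) (Z (u (Suc i)) - Z (u i)) (y i))"
  have "L (u i) (X (u (Suc i)) - X (u i)) (y i) =
      L (u i) (M (u (Suc i)) - M (u i)) (y i) + L (u i) (Z (u (Suc i)) - Z (u i)) (y i)" for i
  proof -
    have "0 \<le> u i" "0 \<le> u (Suc i)" using u(2) by auto
    then have "X (u (Suc i)) - X (u i) = (M (u (Suc i)) - M (u i)) + (Z (u (Suc i)) - Z (u i))"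
      using X[of "u i"] X[of "u (Suc i)"] by (simp del: diff_diff_eq)
    then show ?thesis using \<open>0 \<le> u i\<close> by (simp only: L_add_left)
  qed
  then have "(\<Sum>i<n. L (u i) (X (u (Suc i)) - X (u i)) (y i)) = SM + SZ"
    by (simp add: SM_def SZ_def sum.distrib)
  moreover have "C.norm2 SM \<le> V T * \<epsilon> * A.norm2 (M T)"
  proof (rule power2_le_imp_le)
    have "(C.norm2 SM)\<^sup>2 \<le> (V T * \<epsilon>)\<^sup>2 * ((A.norm2 (M (u n)))\<^sup>2 - (A.norm2 (M (u 0)))\<^sup>2)"
      unfolding SM_def using martingale_sum_bound[where u = u and y = y, OF M u y] by blast
    moreover have "(A.norm2 (M (u n)))\<^sup>2 - (A.norm2 (M (u 0)))\<^sup>2 \<le> (A.norm2 (M T))\<^sup>2"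
      using A.norm2_increment[OF M un(1,2)] zero_le_power2[of "A.norm2 (M T - M (u n))"]
        zero_le_power2[of "A.norm2 (M (u 0))"] by linarith
    then have "(V T * \<epsilon>)\<^sup>2 * ((A.norm2 (M (u n)))\<^sup>2 - (A.norm2 (M (u 0)))\<^sup>2) \<le> (V T * \<epsilon>)\<^sup>2 * (A.norm2 (M T))\<^sup>2"
      by (intro mult_left_mono) auto
    ultimately show "(C.norm2 SM)\<^sup>2 \<le> (V T * \<epsilon> * A.norm2 (M T))\<^sup>2" by (simp add: power_mult_distrib)
  qed (use \<epsilon> V_ge_0[OF un(5)] in auto)
  moreover have "C.norm2 SZ \<le> V T * \<epsilon> * (W T - W 0)"
  proof -
    have "C.norm2 SZ \<le> norm SZ" by (rule C.norm2_le_norm)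
    also have "\<dots> \<le> V T * \<epsilon> * (W (u n) - W (u 0))"
      unfolding SZ_def by (rule finite_variation_sum_bound[where u = u and y = y, OF Z u y(2)])
    also have "\<dots> \<le> V T * \<epsilon> * (W T - W 0)"
      using Z[OF un(1,2)] Z[OF order_refl un(3)] norm_ge_zero[of "Z T - Z (u n)"]
        norm_ge_zero[of "Z (u 0) - Z 0"] \<epsilon> V_ge_0[OF un(5)]
      by (intro mult_left_mono) (auto simp del: norm_ge_zero)
    finally show ?thesis .
  qed
  moreover have "C.norm2 (SM + SZ) \<le> C.norm2 SM + C.norm2 SZ" by (rule C.norm2_triangle)
  ultimately show ?thesis by (simp add: algebra_simps)
qed

text \<open>If the second argument follows a step process \<open>y\<close>, the left-endpoint sums become
  Riemann--Stieltjes sums by summation by parts.  The integrator \<open>s \<mapsto> L s [\<cdot>, y s]\<close> has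
  bounded variation in operator norm, and \<open>X\<close> is norm continuous, so these sums converge in
  norm.\<close>

lemma step_sums_converge:
  assumes X: "continuous_on {0..} X" and T: "T \<ge> 0" and \<epsilon>: "\<epsilon> > 0"
    and y: "\<And>t. t \<in> {0..T} \<Longrightarrow> norm (y t) \<le> K"
    and W: "\<And>s t. 0 \<le> s \<Longrightarrow> s \<le> t \<Longrightarrow> t \<le> T \<Longrightarrow> norm (y t - y s) \<le> W t - W s"
  shows "\<exists>d>0. \<exists>Z. \<forall>t\<in>{0..T}. \<forall>n u. u 0 = 0 \<and> u n = t \<and>
      (\<forall>i. u i \<le> u (Suc i) \<and> u (Suc i) - u i < d) \<longrightarrow>
      norm ((\<Sum>i<n. L (u i) (X (u (Suc i)) - X (u i)) (y (u i))) - Z t) \<le> \<epsilon>"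
proof -
  \<comment> \<open>\<open>F\<close> separates the time of the integrand \<open>X\<close> from that of the integrator\<close>
  define F where "F x s = L s (X x) (y s)" for x s
  define G where "G s = K * V s + V T * W s" for s
  have K: "0 \<le> K" using y[of 0] T norm_ge_zero[of "y 0"] by (auto simp del: norm_ge_zero)
  have diff: "norm ((F x t - F x s) - (F x' t - F x' s)) \<le> norm (X x - X x') * (G t - G s)"
    if st: "0 \<le> s" "s \<le> t" "t \<le> T" for x x' s t
  proof -
    define z where "z = X x - X x'"
    have t0: "0 \<le> t" using st by simp
    have "(F x t - F x s) - (F x' t - F x' s) = L t z (y t) - L s z (y s)"
      using st t0 by (simp add: F_def z_def L_diff_left)
    also have "\<dots> = (L t z (y t) - L s z (y t)) + L s z (y t - y s)"
      using st by (simp add: L_diff_right)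
    also have "norm \<dots> \<le> (V t - V s) * norm z * norm (y t) + V s * norm z * norm (y t - y s)"
      using st by (intro norm_triangle_mono increment bound)
    also have "\<dots> \<le> (V t - V s) * norm z * K + V T * norm z * (W t - W s)"
      using V_mono[OF st(1,2)] V_mono[of s T] V_ge_0[OF st(1)] st y[of t] K W[OF st]
      by (intro add_mono mult_mono mult_nonneg_nonneg) auto
    finally show ?thesis by (simp add: z_def G_def algebra_simps)
  qed
  have G: "G s \<le> G t" if st: "0 \<le> s" "s \<le> t" "t \<le> T" for s t
    using V_mono[OF st(1,2)] K V_ge_0[OF T] W[OF st] norm_ge_zero[of "y t - y s"]
    unfolding G_def by (intro add_mono mult_left_mono) (auto simp del: norm_ge_zero)
  have "uniformly_continuous_on {0..T} X"
    by (intro compact_uniformly_continuous continuous_on_subset[OF X]) auto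
  then have uc: "\<exists>d>0. \<forall>x\<in>{0..T}. \<forall>x'\<in>{0..T}. dist x' x < d \<longrightarrow> dist (X x') (X x) < e" if "e > 0" for e
    using that unfolding uniformly_continuous_on_def by blast
  have "\<exists>\<delta>>0. \<forall>s t x x'. 0 \<le> s \<and> s \<le> t \<and> t \<le> T \<and> x \<in> {0..T} \<and> x' \<in> {0..T} \<and> \<bar>x - x'\<bar> \<le> \<delta> \<longrightarrow>
           norm ((F x t - F x s) - (F x' t - F x' s)) \<le> e * (G t - G s)" if e: "e > 0" for e
  proof -
    obtain d where d: "d > 0" "\<And>x x'. x \<in> {0..T} \<Longrightarrow> x' \<in> {0..T} \<Longrightarrow> dist x' x < d \<Longrightarrow> dist (X x') (X x) < e"
      using uc[OF e] by blast
    have "norm ((F x t - F x s) - (F x' t - F x' s)) \<le> e * (G t - G s)"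
      if *: "0 \<le> s" "s \<le> t" "t \<le> T" "x \<in> {0..T}" "x' \<in> {0..T}" "\<bar>x - x'\<bar> \<le> d / 2" for s t x x'
    proof -
      have "norm (X x - X x') \<le> e" using d(1) d(2)[of x' x] * by (simp add: dist_norm)
      then have "norm (X x - X x') * (G t - G s) \<le> e * (G t - G s)"
        using G[OF *(1-3)] by (intro mult_right_mono) auto
      then show ?thesis using diff[OF *(1-3), of x x'] by linarith
    qed
    then show ?thesis using d(1) by (intro exI[of _ "d / 2"]) auto
  qed
  from rs_limit_uniform[of T F G, OF this G \<epsilon>] obtain d where d: "d > 0"
    "\<And>t n u \<tau>. t \<in> {0..T} \<Longrightarrow> tagged_grid t d n u \<tau> \<Longrightarrow> norm (tagged_sum F n u \<tau> - rs_limit F t) \<le> \<epsilon>"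
    by blast
  show ?thesis
  proof (intro exI[of _ d] conjI exI[of _ "\<lambda>t. F t t - F 0 0 - rs_limit F t"] ballI allI impI)
    fix t n and u :: "nat \<Rightarrow> real" assume t: "t \<in> {0..T}" and u: "u 0 = 0 \<and> u n = t \<and>
      (\<forall>i. u i \<le> u (Suc i) \<and> u (Suc i) - u i < d)"
    have u0: "0 \<le> u i" for i using u by (induction i) (auto intro: order_trans)
    have "(\<Sum>i<n. L (u i) (X (u (Suc i)) - X (u i)) (y (u i))) =
        (\<Sum>i<n. (F (u (Suc i)) (u (Suc i)) - F (u i) (u i)) - (F (u (Suc i)) (u (Suc i)) - F (u (Suc i)) (u i)))"
      by (intro sum.cong) (simp_all add: F_def L_diff_left u0)
    also have "\<dots> = F t t - F 0 0 - tagged_sum F n u (\<lambda>i. u (Suc i))"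
      using sum_lessThan_telescope[of "\<lambda>i. F (u i) (u i)" n] u
      by (simp only: sum_subtractf tagged_sum_def)
    finally have "norm ((\<Sum>i<n. L (u i) (X (u (Suc i)) - X (u i)) (y (u i))) - (F t t - F 0 0 - rs_limit F t))
        = norm (tagged_sum F n u (\<lambda>i. u (Suc i)) - rs_limit F t)"
      by (simp add: norm_minus_commute)
    also have "\<dots> \<le> \<epsilon>" using u by (intro d(2)[OF t]) (simp add: tagged_grid_def)
    finally show "norm ((\<Sum>i<n. L (u i) (X (u (Suc i)) - X (u i)) (y (u i))) - (F t t - F 0 0 - rs_limit F t)) \<le> \<epsilon>" .
  qed (rule d)
qed

end

context adapted_bilinear_process
begin

text \<open>Split \<open>Y\<close> into the step process \<open>s \<mapsto> Y (g s)\<close> and the remainder.  The sums of the former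
  converge in norm, those of the latter are uniformly small.\<close>

lemma left_sums_uniformly_cauchy:
  assumes X: "Linf_decomposable EA FA X" and Y: "adapted FB Y" "continuous_on {0..} Y"
  shows "C.uniformly_cauchy (\<lambda>\<pi> t. \<Sum>n. L (\<pi> (n - 1)) (X (min (\<pi> n) t) - X (min (\<pi> (n - 1)) t)) (Y (\<pi> (n - 1))))"
    (is "C.uniformly_cauchy ?S")
  unfolding C.uniformly_cauchy_def
proof (intro allI impI)
  fix T e :: real assume T: "0 \<le> T" and e: "0 < e"
  obtain M Z where M: "martingale EA FA M" and Z: "locally_bounded_variation (\<lambda>a. ereal (norm a)) Z"
    and XMZ: "\<And>t. 0 \<le> t \<Longrightarrow> X t = X 0 + M t + Z t"
    using X unfolding Linf_decomposable_def by blast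
  have Mo: "orthogonal_increments EA FA M" "adapted FA M"
    using A.martingale_orthogonal_increments[OF M] M unfolding martingale_def by auto
  obtain W where W: "\<And>s t. 0 \<le> s \<Longrightarrow> s \<le> t \<Longrightarrow> norm (Z t - Z s) \<le> W t - W s"
    using variation_function[OF Z] by auto
  define K where "K = V T * (A.norm2 (M T) + (W T - W 0))"
  have K: "0 \<le> K" unfolding K_def
    using V_ge_0[OF T] order_trans[OF norm_ge_zero W[OF order_refl T]] by (intro mult_nonneg_nonneg) auto
  \<comment> \<open>\<open>K\<close> is the constant of the grid-independent bound; the two errors below are
      at most \<open>e/8\<close> each\<close>
  define \<epsilon> where "\<epsilon> = e / (8 * (K + 1))"
  have \<epsilon>: "\<epsilon> > 0" "\<epsilon> * K \<le> e / 8" using e K by (auto simp: \<epsilon>_def field_simps)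
  have Yc: "continuous_on {0..T} Y" by (rule continuous_on_subset[OF Y(2)]) auto
  then have "bounded (Y ` {0..T})" by (intro compact_imp_bounded compact_continuous_image) auto
  then obtain B where B: "\<And>t. t \<in> {0..T} \<Longrightarrow> norm (Y t) \<le> B" unfolding bounded_iff by blast
  have "uniformly_continuous_on {0..T} Y" by (rule compact_uniformly_continuous[OF Yc]) simp
  then obtain h where h: "h > 0" and Yh: "\<And>x x'. x \<in> {0..T} \<Longrightarrow> x' \<in> {0..T} \<Longrightarrow> dist x' x < h \<Longrightarrow> dist (Y x') (Y x) < \<epsilon>"
    using \<epsilon>(1) unfolding uniformly_continuous_on_def by meson
  \<comment> \<open>the last grid point \<open>h k\<close> not after \<open>s\<close>\<close>
  define g where "g s = h * of_int \<lfloor>s / h\<rfloor>" for s :: real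
  have g: "0 \<le> g s" "g s \<le> s" "s - g s < h" if "0 \<le> s" for s
  proof -
    have "h * of_int \<lfloor>s / h\<rfloor> \<le> h * (s / h)" "h * (s / h) < h * (of_int \<lfloor>s / h\<rfloor> + 1)"
      using h by (intro mult_left_mono mult_strict_left_mono; linarith)+
    moreover have "0 \<le> h * of_int \<lfloor>s / h\<rfloor>" using that h by (intro mult_nonneg_nonneg) auto
    ultimately show "0 \<le> g s" "g s \<le> s" "s - g s < h" using h by (simp_all add: g_def distrib_left)
  qed
  have yB: "norm (Y (g t)) \<le> B" if "t \<in> {0..T}" for t using that g[of t] by (intro B) auto
  \<comment> \<open>the step process jumps only when \<open>\<lfloor>s/h\<rfloor>\<close> does, each time by at most \<open>2 B\<close>\<close>
  have yW: "norm (Y (g t) - Y (g s)) \<le> 2 * B * of_int \<lfloor>t / h\<rfloor> - 2 * B * of_int \<lfloor>s / h\<rfloor>"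
    if st: "0 \<le> s" "s \<le> t" "t \<le> T" for s t
  proof (cases "\<lfloor>s / h\<rfloor> = \<lfloor>t / h\<rfloor>")
    case False
    have "\<lfloor>s / h\<rfloor> \<le> \<lfloor>t / h\<rfloor>" using st h by (intro floor_mono divide_right_mono) auto
    with False have "\<lfloor>s / h\<rfloor> + 1 \<le> \<lfloor>t / h\<rfloor>" by simp
    then have *: "1 \<le> of_int \<lfloor>t / h\<rfloor> - (of_int \<lfloor>s / h\<rfloor> :: real)" by linarith
    have "norm (Y (g t) - Y (g s)) \<le> 2 * B * 1"
      using norm_triangle_ineq4[of "Y (g t)" "Y (g s)"] yB[of t] yB[of s] st by auto
    also have "\<dots> \<le> 2 * B * (of_int \<lfloor>t / h\<rfloor> - of_int \<lfloor>s / h\<rfloor>)"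
      using * order_trans[OF norm_ge_zero yB[of t]] st by (intro mult_left_mono) auto
    finally show ?thesis by (simp add: algebra_simps)
  qed (simp add: g_def)
  have Xc: "continuous_on {0..} X" by (rule Linf_decomposable_continuous[OF X])
  have e8: "e / 8 > 0" using e by simp
  obtain d U where d: "d > 0" and U: "\<And>t n u. t \<in> {0..T} \<Longrightarrow> u 0 = 0 \<Longrightarrow> u n = t \<Longrightarrow>
      (\<And>i. u i \<le> u (Suc i) \<and> u (Suc i) - u i < d) \<Longrightarrow>
      norm ((\<Sum>i<n. L (u i) (X (u (Suc i)) - X (u i)) (Y (g (u i)))) - U t) \<le> e / 8"
    using step_sums_converge[OF Xc T e8, of "\<lambda>s. Y (g s)" B "\<lambda>s. 2 * B * of_int \<lfloor>s / h\<rfloor>", OF yB yW] by blast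
  have close: "C.norm2 (?S \<pi> t - U t) \<le> e / 4"
    if \<pi>: "is_partition \<pi>" "mesh \<pi> < ereal d" and t: "t \<in> {0..T}" for \<pi> t
  proof -
    have t0: "0 \<le> t" using t by simp
    obtain N where N: "t \<le> \<pi> N" using partition_exceeds[OF \<pi>(1)] by blast
    define u where "u i = min (\<pi> i) t" for i
    have u: "u 0 = 0" "u N = t" "\<And>i. u i \<le> u (Suc i)" "\<And>i. u (Suc i) - u i < d" "\<And>i. u i \<in> {0..t}"
      using partition_grid[OF \<pi>(1) t0 N \<pi>(2)] unfolding u_def by blast+
    have uT: "u i \<in> {0..T}" for i using u(5)[of i] t by auto
    have u0: "0 \<le> u i" for i using uT[of i] by simp
    define P where "P = (\<Sum>i<N. L (u i) (X (u (Suc i)) - X (u i)) (Y (u i) - Y (g (u i))))"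
    define Q where "Q = (\<Sum>i<N. L (u i) (X (u (Suc i)) - X (u i)) (Y (g (u i))))"
    have "?S \<pi> t = (\<Sum>i<N. L (u i) (X (u (Suc i)) - X (u i)) (Y (u i)))"
      unfolding u_def
      by (rule partition_suminf[OF \<pi>(1) t0 N, of "\<lambda>r s s'. L r (X s' - X s) (Y r)"]) (simp add: L_zero_left)
    then have S: "?S \<pi> t = P + Q" by (simp add: P_def Q_def L_diff_right u0 sum_subtractf)
    have "C.norm2 P \<le> \<epsilon> * K"
      unfolding P_def K_def
    proof (rule decomposable_sum_bound[where u = u, OF Mo W XMZ u(3) uT])
      fix i
      have "g (u i) \<in> {0..T}" using g[OF u0, of i] uT[of i] by auto
      then show "norm (Y (u i) - Y (g (u i))) \<le> \<epsilon>"
        using Yh[of "g (u i)" "u i"] uT[of i] g[OF u0, of i] by (simp add: dist_norm)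
      have "Y (u i) \<in> FB (u i)" "Y (g (u i)) \<in> FB (u i)"
        using Y(1) u0[of i] g[OF u0, of i] B.F_mono[of "g (u i)" "u i"] unfolding adapted_def by auto
      then show "Y (u i) - Y (g (u i)) \<in> FB (u i)" by (intro subalgebra_minus B.F_subalgebra u0)
    qed
    moreover have "norm (Q - U t) \<le> e / 8" unfolding Q_def using u by (intro U[OF t]) auto
    moreover have "C.norm2 (P + (Q - U t)) \<le> C.norm2 P + C.norm2 (Q - U t)" by (rule C.norm2_triangle)
    ultimately show ?thesis using \<epsilon>(2) C.norm2_le_norm[of "Q - U t"] unfolding S by (simp add: add_diff_eq)
  qed
  show "\<exists>d>0. \<forall>\<pi> \<pi>'. is_partition \<pi> \<and> mesh \<pi> < ereal d \<and> is_partition \<pi>' \<and> mesh \<pi>' < ereal d \<longrightarrow>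
      (\<forall>t\<in>{0..T}. C.norm2 (?S \<pi> t - ?S \<pi>' t) < e)"
  proof (intro exI[of _ d] conjI allI impI ballI)
    fix \<pi> \<pi>' t assume *: "is_partition \<pi> \<and> mesh \<pi> < ereal d \<and> is_partition \<pi>' \<and> mesh \<pi>' < ereal d"
      and t: "t \<in> {0..T}"
    have "C.norm2 (?S \<pi> t - ?S \<pi>' t) \<le> C.norm2 (?S \<pi> t - U t) + C.norm2 (U t - ?S \<pi>' t)"
      by (rule C.norm2_diff_triangle)
    then show "C.norm2 (?S \<pi> t - ?S \<pi>' t) < e"
      using close[of \<pi> t] close[of \<pi>' t] * t e C.norm2_minus_commute[of "U t" "?S \<pi>' t"] by simp
  qed (rule d)
qed

end

section \<open>Processes of bounded variation in the bilinear norm\<close>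

text \<open>Homogeneity turns a bound on unit balls into a bound everywhere; definiteness of \<open>f\<close> and
  \<open>g\<close> covers the vectors that cannot be normalized.\<close>

lemma bilinear_norm_scaling:
  fixes f :: "'a::real_vector \<Rightarrow> real" and g :: "'b::real_vector \<Rightarrow> real" and k :: "'c::real_vector \<Rightarrow> real"
  assumes T: "bilinear T"
    and f: "\<And>x. 0 \<le> f x" "\<And>x. f x = 0 \<Longrightarrow> x = 0" "\<And>r x. f (r *\<^sub>R x) = \<bar>r\<bar> * f x"
    and g: "\<And>y. 0 \<le> g y" "\<And>y. g y = 0 \<Longrightarrow> y = 0" "\<And>r y. g (r *\<^sub>R y) = \<bar>r\<bar> * g y"
    and k: "\<And>r z. k (r *\<^sub>R z) = \<bar>r\<bar> * k z"
    and K: "\<And>x y. f x \<le> 1 \<Longrightarrow> g y \<le> 1 \<Longrightarrow> k (T x y) \<le> K"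
  shows "k (T x y) \<le> K * f x * g y"
proof (cases "x = 0 \<or> y = 0")
  case True
  have "k 0 = 0" using k[of 0 0] by simp
  moreover have "f 0 = 0" "g 0 = 0" using f(3)[of 0 0] g(3)[of 0 0] by auto
  ultimately show ?thesis using True T by (auto simp: bilinear_lzero bilinear_rzero)
next
  case False
  then have fg: "f x > 0" "g y > 0" using f(1,2)[of x] g(1,2)[of y] by (force simp: less_le)+
  have "k (T ((1 / f x) *\<^sub>R x) ((1 / g y) *\<^sub>R y)) \<le> K"
    using fg by (intro K) (simp_all add: f g)
  then have "k (T x y) / (f x * g y) \<le> K"
    using fg T by (simp add: bilinear_lmul bilinear_rmul k abs_mult)
  then show ?thesis using fg by (simp add: field_simps)
qed

lemma bnorm2_nonneg: "0 \<le> bnorm2 EA EB EC (T :: 'a::cstar_algebra \<Rightarrow> 'b::cstar_algebra \<Rightarrow> 'c::cstar_algebra)"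
proof -
  have "ereal (pnorm EC \<infinity> (T 0 0)) \<le> bnorm2 EA EB EC T"
    unfolding bnorm2_def
    by (intro Sup_upper CollectI exI[of _ "\<infinity>::ereal"] exI[of _ "0::'a"] exI[of _ "0::'b"])
      (simp add: pnorm_def)
  moreover have "0 \<le> ereal (pnorm EC \<infinity> (T 0 0))" by (simp add: pnorm_def)
  ultimately show ?thesis by (rule order_trans[rotated])
qed

context
  fixes EA :: "'a::cstar_algebra \<Rightarrow> complex" and EB :: "'b::cstar_algebra \<Rightarrow> complex"
    and EC :: "'c::cstar_algebra \<Rightarrow> complex" and T :: "'a \<Rightarrow> 'b \<Rightarrow> 'c" and K :: real
  assumes A: "cstar_probability_space EA" and B: "cstar_probability_space EB"
    and C: "cstar_probability_space EC"
    and T: "bilinear T" and K: "bnorm2 EA EB EC T \<le> ereal K"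
begin

interpretation A: cstar_probability_space EA by (rule A)
interpretation B: cstar_probability_space EB by (rule B)
interpretation C: cstar_probability_space EC by (rule C)

lemma bnorm2_unit_bound:
  assumes "1 \<le> p" "1 \<le> q" "1 \<le> r" "1 / p + 1 / q = 1 / r" "pnorm EA p x \<le> 1" "pnorm EB q y \<le> 1"
  shows "pnorm EC r (T x y) \<le> K"
proof -
  have "ereal (pnorm EC r (T x y)) \<le> bnorm2 EA EB EC T"
    unfolding bnorm2_def using assms by (intro Sup_upper) blast
  then show ?thesis using K by (meson ereal_less_eq(3) order_trans)
qed

text \<open>The exponents \<open>(\<infinity>, \<infinity>, \<infinity>)\<close>, \<open>(2, \<infinity>, 2)\<close> and \<open>(\<infinity>, 2, 2)\<close>.\<close>

lemma bnorm2_norm: "norm (T x y) \<le> K * norm x * norm y"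
proof (rule bilinear_norm_scaling[OF T])
  fix x y assume "norm (x::'a) \<le> 1" "norm (y::'b) \<le> 1"
  then show "norm (T x y) \<le> K" using bnorm2_unit_bound[of \<infinity> \<infinity> \<infinity> x y] by (simp add: pnorm_def)
qed auto

lemma bnorm2_norm2_left: "C.norm2 (T x y) \<le> K * A.norm2 x * norm y"
proof (rule bilinear_norm_scaling[OF T])
  fix x y assume "A.norm2 x \<le> 1" "norm (y::'b) \<le> 1"
  then show "C.norm2 (T x y) \<le> K"
    using bnorm2_unit_bound[of 2 \<infinity> 2 x y, unfolded A.pnorm_2 C.pnorm_2 B.pnorm_infinity] by simp
qed (auto simp: A.norm2_scaleR C.norm2_scaleR intro: A.norm2_eq_0)

lemma bnorm2_norm2_right: "C.norm2 (T x y) \<le> K * norm x * B.norm2 y"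
proof (rule bilinear_norm_scaling[OF T])
  fix x y assume "norm (x::'a) \<le> 1" "B.norm2 y \<le> 1"
  then show "C.norm2 (T x y) \<le> K"
    using bnorm2_unit_bound[of \<infinity> 2 2 x y, unfolded B.pnorm_2 C.pnorm_2 A.pnorm_infinity] by simp
qed (auto simp: B.norm2_scaleR C.norm2_scaleR intro: B.norm2_eq_0)

end

context filtered_cstar_probability_space
begin

text \<open>An element orthogonal to \<open>F t\<close> has conditional expectation \<open>0\<close> in \<open>L\<^sup>2\<close>.  By
  Cauchy--Schwarz, the condition passes from the constant sequence to all representatives.\<close>

lemma has_cond_exp_zero:
  assumes t: "t \<ge> 0" and x: "\<And>b. b \<in> F t \<Longrightarrow> E (b * x) = 0"
  shows "has_cond_exp E 2 (F t) (cmpl_embed (pnorm E 2) x) (cmpl_embed (pnorm E 2) 0)"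
  unfolding has_cond_exp_def
proof (intro conjI ballI)
  show "cmpl_embed (pnorm E 2) x \<in> Lp E 2"
    unfolding Lp_sub_def pnorm_2_fun cmpl_embed_eq using cauchy_norm2_const by blast
  have "range (\<lambda>_::nat. 0) \<subseteq> F t" using subalgebra_zero[OF F_subalgebra[OF t]] by auto
  then show "cmpl_embed (pnorm E 2) 0 \<in> Lp_sub E 2 (F t)"
    unfolding Lp_sub_def pnorm_2_fun cmpl_embed_eq using cauchy_norm2_const by blast
  fix b x' y' assume b: "b \<in> F t" and x': "x' \<in> cmpl_embed (pnorm E 2) x"
    and y': "y' \<in> cmpl_embed (pnorm E 2) 0"
  have lim: "(\<lambda>n. E (b * z n)) \<longlonglongrightarrow> E (b * a)" if "z \<in> cmpl_embed (pnorm E 2) a" for z a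
  proof -
    have z: "(\<lambda>n. norm2 (z n - a)) \<longlonglongrightarrow> 0"
      using that unfolding pnorm_2_fun cmpl_embed_eq cmpl_class_def by simp
    have "cmod (E (b * z n) - E (b * a)) \<le> norm2 (star b) * norm2 (z n - a)" for n
      using Cauchy_Schwarz[of "star b" "z n - a"] by (simp add: star_star right_diff_distrib E_diff)
    then have "(\<lambda>n. E (b * z n) - E (b * a)) \<longlonglongrightarrow> 0"
      by (intro Lim_null_comparison[OF _ tendsto_mult_right_zero[OF z, of "norm2 (star b)"]]) simp
    then show ?thesis using LIM_zero_iff by blast
  qed
  from tendsto_diff[OF lim[OF y'] lim[OF x']]
  show "(\<lambda>n. E (b * y' n) - E (b * x' n)) \<longlonglongrightarrow> 0" by (simp add: x[OF b])
qed

lemma cmpl_embed_in_Lp_sub: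
  assumes "y \<in> F t" shows "cmpl_embed (pnorm E 2) y \<in> Lp_sub E 2 (F t)"
proof -
  have "range (\<lambda>_::nat. y) \<subseteq> F t" using assms by auto
  then show ?thesis
    unfolding Lp_sub_def pnorm_2_fun cmpl_embed_eq using cauchy_norm2_const by blast
qed

lemma const_in_cmpl_embed: "(\<lambda>_. y) \<in> cmpl_embed (pnorm E 2) y"
  unfolding pnorm_2_fun cmpl_embed_eq using cauchy_norm2_const cmpl_class_self by blast

lemma has_cond_exp_1_const:
  assumes "has_cond_exp E 1 (F t) \<xi> \<eta>" "(\<lambda>_. x) \<in> \<xi>" "(\<lambda>_. y) \<in> \<eta>" "c \<in> F t"
  shows "E (c * x) = E (c * y)"
proof -
  have lim: "\<forall>b\<in>F t. \<forall>x\<in>\<xi>. \<forall>y\<in>\<eta>. (\<lambda>n. E (b * y n) - E (b * x n)) \<longlonglongrightarrow> 0"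
    using assms(1) unfolding has_cond_exp_def by blast
  from bspec[OF bspec[OF bspec[OF lim assms(4)] assms(2)] assms(3)]
  have "E (c * y) - E (c * x) = 0" using LIMSEQ_const_iff[of "E (c * y) - E (c * x)" 0] by simp
  then show ?thesis by simp
qed

end

text \<open>The extension of \<open>T\<close> to the completions contains the constant sequence \<open>T x y\<close>, so
  adaptedness can be tested on elements of the algebras.\<close>

lemma const_in_cmpl_bilinear_ext:
  assumes "cstar_probability_space EC" "(\<lambda>_. x) \<in> \<xi>" "(\<lambda>_. y) \<in> \<upsilon>"
  shows "(\<lambda>_. T x y) \<in> cmpl_bilinear_ext (pnorm EC 1) T \<xi> \<upsilon>"
proof -
  have "(\<lambda>_. T x y) \<in> cmpl_class (pnorm EC 1) (\<lambda>n::nat. T ((\<lambda>_. x) n) ((\<lambda>_. y) n))"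
    by (simp add: cmpl_class_def cauchy_wrt_def cstar_probability_space.pnorm_1_zero[OF assms(1)])
  then show ?thesis unfolding cmpl_bilinear_ext_def using assms(2,3) by blast
qed

text \<open>Both instances share the function \<open>V\<close>: the bound of \<open>L 0\<close> plus the variation of \<open>L\<close>.
  Orthogonality in either argument comes from the corresponding clause of adaptedness, applied to an
  element whose conditional expectation vanishes.\<close>

lemma Q0_adapted_bilinear_process:
  fixes EA :: "'a::cstar_algebra \<Rightarrow> complex" and EB :: "'b::cstar_algebra \<Rightarrow> complex"
    and EC :: "'c::cstar_algebra \<Rightarrow> complex"
  assumes A: "filtered_cstar_probability_space EA FA" and B: "filtered_cstar_probability_space EB FB"
    and C: "filtered_cstar_probability_space EC FC" and L: "L \<in> Q0 EA FA EB FB EC FC"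
  obtains V where "adapted_bilinear_process EA FA EB FB EC FC L V"
    "adapted_bilinear_process EB FB EA FA EC FC (\<lambda>t y x. L t x y) V"
proof -
  interpret A: filtered_cstar_probability_space EA FA by (rule A)
  interpret B: filtered_cstar_probability_space EB FB by (rule B)
  interpret C: filtered_cstar_probability_space EC FC by (rule C)
  have B2: "\<And>t. t \<ge> 0 \<Longrightarrow> L t \<in> B2 EA EB EC" and adapt: "adapted_bilinear EA FA EB FB EC FC L"
    and bv: "locally_bounded_variation (bnorm2 EA EB EC) L"
    using L unfolding Q0_def by auto
  have bil: "bilinear (L t)" if "t \<ge> 0" for t using B2[OF that] by (simp add: B2_def)
  have bil_diff: "bilinear (L t - L s)" if "s \<ge> 0" "t \<ge> 0" for s t
    using bil[OF that(1)] bil[OF that(2)] unfolding bilinear_def minus_apply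
    by (auto intro: linear_compose_sub)
  obtain b where b: "bnorm2 EA EB EC (L 0) = ereal b"
    using B2[of 0] bnorm2_nonneg[of EA EB EC "L 0"] unfolding B2_def
    by (cases "bnorm2 EA EB EC (L 0)") auto
  have b0: "b \<ge> 0" using bnorm2_nonneg[of EA EB EC "L 0"] b by simp
  obtain W where W: "\<And>s t. 0 \<le> s \<Longrightarrow> s \<le> t \<Longrightarrow> bnorm2 EA EB EC (L t - L s) \<le> ereal (W t - W s)"
    using variation_function[OF bv bnorm2_nonneg] by blast
  have W_mono: "W s \<le> W t" if "0 \<le> s" "s \<le> t" for s t
    using order_trans[OF bnorm2_nonneg W[OF that]] by simp
  define V where "V t = b + (W t - W 0)" for t
  have spaces: "cstar_probability_space EA" "cstar_probability_space EB" "cstar_probability_space EC"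
    by unfold_locales
  have V: "V s \<le> V t" if "0 \<le> s" "s \<le> t" for s t using W_mono[OF that] by (simp add: V_def)
  have V0: "0 \<le> V 0" using b0 by (simp add: V_def)
  have inc: "bnorm2 EA EB EC (L t - L s) \<le> ereal (V t - V s)" if "0 \<le> s" "s \<le> t" for s t
    using W[OF that] by (simp add: V_def)
  have split: "L t x y = L 0 x y + (L t - L 0) x y" for t x y by simp
  have V_eq: "V t = b + (V t - V 0)" for t by (simp add: V_def)
  have incr: "norm (L t x y - L s x y) \<le> (V t - V s) * norm x * norm y" if "0 \<le> s" "s \<le> t" for s t x y
    using bnorm2_norm[OF spaces bil_diff inc[OF that], of x y] that by simp
  have bound: "norm (L t x y) \<le> V t * norm x * norm y" if t: "0 \<le> t" for t x y
  proof -
    have "norm (L t x y) \<le> norm (L 0 x y) + norm ((L t - L 0) x y)"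
      using norm_triangle_ineq[of "L 0 x y" "(L t - L 0) x y"] by simp
    also have "\<dots> \<le> b * norm x * norm y + (V t - V 0) * norm x * norm y"
      using bnorm2_norm[OF spaces bil, of 0 b x y] bnorm2_norm[OF spaces bil_diff inc[OF order_refl t], of x y] b t
      by (intro add_mono) auto
    also have "\<dots> = V t * norm x * norm y" by (subst V_eq[of t]) (simp add: algebra_simps)
    finally show ?thesis .
  qed
  have bound_left: "C.norm2 (L t x y) \<le> V t * A.norm2 x * norm y" if t: "0 \<le> t" for t x y
  proof -
    have "C.norm2 (L t x y) \<le> C.norm2 (L 0 x y) + C.norm2 ((L t - L 0) x y)"
      using C.norm2_triangle[of "L 0 x y" "(L t - L 0) x y"] by simp
    also have "\<dots> \<le> b * A.norm2 x * norm y + (V t - V 0) * A.norm2 x * norm y"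
      using bnorm2_norm2_left[OF spaces bil, of 0 b x y] bnorm2_norm2_left[OF spaces bil_diff inc[OF order_refl t], of x y] b t
      by (intro add_mono) auto
    also have "\<dots> = V t * A.norm2 x * norm y" by (subst V_eq[of t]) (simp add: algebra_simps)
    finally show ?thesis .
  qed
  have bound_right: "C.norm2 (L t x y) \<le> V t * B.norm2 y * norm x" if t: "0 \<le> t" for t x y
  proof -
    have "C.norm2 (L t x y) \<le> C.norm2 (L 0 x y) + C.norm2 ((L t - L 0) x y)"
      using C.norm2_triangle[of "L 0 x y" "(L t - L 0) x y"] by simp
    also have "\<dots> \<le> b * norm x * B.norm2 y + (V t - V 0) * norm x * B.norm2 y"
      using bnorm2_norm2_right[OF spaces bil, of 0 b x y] bnorm2_norm2_right[OF spaces bil_diff inc[OF order_refl t], of x y] b t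
      by (intro add_mono) auto
    also have "\<dots> = V t * B.norm2 y * norm x" by (subst V_eq[of t]) (simp add: algebra_simps)
    finally show ?thesis .
  qed
  have maps: "L s x y \<in> FC t" if "0 \<le> s" "s \<le> t" "x \<in> FA t" "y \<in> FB t" for s t x y
    using adapt that unfolding adapted_bilinear_def Let_def by blast
  note const = const_in_cmpl_bilinear_ext[OF spaces(3) A.const_in_cmpl_embed B.const_in_cmpl_embed]
  have orth_left: "EC (c * L t x y) = 0"
    if t: "0 \<le> t" and x: "\<And>b. b \<in> FA t \<Longrightarrow> EA (b * x) = 0" and y: "y \<in> FB t" and c: "c \<in> FC t" for t x y c
  proof -
    have "has_cond_exp EC 1 (FC t)
        (cmpl_bilinear_ext (pnorm EC 1) (L t) (cmpl_embed (pnorm EA 2) x) (cmpl_embed (pnorm EB 2) y))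
        (cmpl_bilinear_ext (pnorm EC 1) (L t) (cmpl_embed (pnorm EA 2) 0) (cmpl_embed (pnorm EB 2) y))"
      using adapt t A.has_cond_exp_zero[OF t x] B.cmpl_embed_in_Lp_sub[OF y]
      unfolding adapted_bilinear_def Let_def by blast
    from C.has_cond_exp_1_const[OF this const const c]
    show ?thesis using bil[OF t] by (simp add: bilinear_lzero)
  qed
  have orth_right: "EC (c * L t x y) = 0"
    if t: "0 \<le> t" and y: "\<And>b. b \<in> FB t \<Longrightarrow> EB (b * y) = 0" and x: "x \<in> FA t" and c: "c \<in> FC t" for t x y c
  proof -
    have "has_cond_exp EC 1 (FC t)
        (cmpl_bilinear_ext (pnorm EC 1) (L t) (cmpl_embed (pnorm EA 2) x) (cmpl_embed (pnorm EB 2) y))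
        (cmpl_bilinear_ext (pnorm EC 1) (L t) (cmpl_embed (pnorm EA 2) x) (cmpl_embed (pnorm EB 2) 0))"
      using adapt t B.has_cond_exp_zero[OF t y] A.cmpl_embed_in_Lp_sub[OF x]
      unfolding adapted_bilinear_def Let_def by blast
    from C.has_cond_exp_1_const[OF this const const c]
    show ?thesis using bil[OF t] by (simp add: bilinear_rzero)
  qed
  have swap: "bilinear (\<lambda>y x. L t x y)" if "t \<ge> 0" for t
    using bil[OF that] unfolding bilinear_def by simp
  have swap_incr: "norm (L t x y - L s x y) \<le> (V t - V s) * norm y * norm x" if "0 \<le> s" "s \<le> t" for s t x y
    using incr[OF that, of x y] by (simp add: mult_ac)
  have swap_bound: "norm (L t x y) \<le> V t * norm y * norm x" if "0 \<le> t" for t x y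
    using bound[OF that, of x y] by (simp add: mult_ac)
  have swap_maps: "L s x y \<in> FC t" if "0 \<le> s" "s \<le> t" "y \<in> FB t" "x \<in> FA t" for s t x y
    using maps that by blast
  show thesis
  proof (rule that)
    show "adapted_bilinear_process EA FA EB FB EC FC L V"
      by unfold_locales (fact bil V V0 incr bound bound_left maps orth_left)+
    show "adapted_bilinear_process EB FB EA FA EC FC (\<lambda>t y x. L t x y) V"
      by unfold_locales (fact swap V V0 swap_incr swap_bound bound_right swap_maps orth_right)+
  qed
qed

section \<open>The quadratic covariation\<close>

context adapted_bilinear_process
begin

text \<open>The integrand \<open>T \<mapsto> T [X x, Y x]\<close> depends continuously on \<open>x\<close> in operator norm, with a
  modulus given by those of \<open>X\<close> and \<open>Y\<close>.\<close>

lemma diagonal_riemann_sums: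
  assumes X: "continuous_on {0..} X" and Y: "continuous_on {0..} Y" and \<epsilon>: "\<epsilon> > 0"
  shows "\<exists>\<delta>>0. \<forall>t\<in>{0..T}. \<forall>n u \<tau>. tagged_grid t \<delta> n u \<tau> \<longrightarrow>
        norm (tagged_sum (\<lambda>x s. L s (X x) (Y x)) n u \<tau> - rs_limit (\<lambda>x s. L s (X x) (Y x)) t) \<le> \<epsilon>"
proof (rule rs_limit_uniform[where V = V, OF _ V_mono \<epsilon>])
  fix e :: real assume e: "e > 0"
  have XY: "continuous_on {0..T} X" "continuous_on {0..T} Y"
    by (rule continuous_on_subset[OF X] continuous_on_subset[OF Y], force)+
  then have "bounded (X ` {0..T})" "bounded (Y ` {0..T})"
    by (intro compact_imp_bounded compact_continuous_image; simp)+
  then obtain BX BY where BX: "\<And>t. t \<in> {0..T} \<Longrightarrow> norm (X t) \<le> BX"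
    and BY: "\<And>t. t \<in> {0..T} \<Longrightarrow> norm (Y t) \<le> BY" unfolding bounded_iff by blast
  define K where "K = \<bar>BX\<bar> + \<bar>BY\<bar> + 1"
  have K: "K > 0" "BX + BY \<le> K" by (auto simp: K_def)
  have eK: "e / K > 0" using e K by simp
  have "uniformly_continuous_on {0..T} X"
    by (rule compact_uniformly_continuous[OF XY(1)]) simp
  then obtain d1 where d1: "d1 > 0" "\<And>x x'. x \<in> {0..T} \<Longrightarrow> x' \<in> {0..T} \<Longrightarrow> dist x' x < d1 \<Longrightarrow> dist (X x') (X x) < e / K"
    using eK unfolding uniformly_continuous_on_def by meson
  have "uniformly_continuous_on {0..T} Y"
    by (rule compact_uniformly_continuous[OF XY(2)]) simp
  then obtain d2 where d2: "d2 > 0" "\<And>x x'. x \<in> {0..T} \<Longrightarrow> x' \<in> {0..T} \<Longrightarrow> dist x' x < d2 \<Longrightarrow> dist (Y x') (Y x) < e / K"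
    using eK unfolding uniformly_continuous_on_def by meson
  have "norm ((L t (X x) (Y x) - L s (X x) (Y x)) - (L t (X x') (Y x') - L s (X x') (Y x'))) \<le> e * (V t - V s)"
    if st: "0 \<le> s" "s \<le> t" and x: "x \<in> {0..T}" "x' \<in> {0..T}" "\<bar>x - x'\<bar> \<le> min d1 d2 / 2" for s t x x'
  proof -
    have "0 \<le> t" using st by simp
    then have "(L t (X x) (Y x) - L s (X x) (Y x)) - (L t (X x') (Y x') - L s (X x') (Y x')) =
        (L t (X x - X x') (Y x) - L s (X x - X x') (Y x)) + (L t (X x') (Y x - Y x') - L s (X x') (Y x - Y x'))"
      using st by (simp add: L_diff_left L_diff_right)
    also have "norm \<dots> \<le> (V t - V s) * norm (X x - X x') * norm (Y x) + (V t - V s) * norm (X x') * norm (Y x - Y x')"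
      by (intro norm_triangle_mono increment st)
    also have "\<dots> \<le> (V t - V s) * (e / K) * BY + (V t - V s) * BX * (e / K)"
    proof -
      have "dist x x' < d1" "dist x x' < d2" using x(3) d1(1) d2(1) by (auto simp: dist_real_def)
      then have "norm (X x - X x') \<le> e / K" "norm (Y x - Y x') \<le> e / K"
        using d1(2)[OF x(2,1)] d2(2)[OF x(2,1)] by (auto simp: dist_norm)
      then show ?thesis
        using V_mono[OF st] BX[OF x(2)] BY[OF x(1)] eK order_trans[OF norm_ge_zero BX[OF x(2)]]
        by (intro add_mono mult_mono mult_nonneg_nonneg) auto
    qed
    also have "\<dots> = (V t - V s) * (e / K) * (BX + BY)" by (simp only: distrib_left distrib_right mult_ac add_ac)
    also have "\<dots> \<le> (V t - V s) * (e / K) * K"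
      using V_mono[OF st] eK K by (intro mult_left_mono mult_nonneg_nonneg) auto
    finally show ?thesis using K by (simp add: mult.commute)
  qed
  then show "\<exists>\<delta>>0. \<forall>s t x y. 0 \<le> s \<and> s \<le> t \<and> t \<le> T \<and> x \<in> {0..T} \<and> y \<in> {0..T} \<and> \<bar>x - y\<bar> \<le> \<delta> \<longrightarrow>
      norm ((L t (X x) (Y x) - L s (X x) (Y x)) - (L t (X y) (Y y) - L s (X y) (Y y))) \<le> e * (V t - V s)"
    using d1(1) d2(1) by (intro exI[of _ "min d1 d2 / 2"]) auto
qed

lemma has_RS_integral_diagonal:
  assumes X: "continuous_on {0..} X" and Y: "continuous_on {0..} Y" and t: "t \<ge> 0"
  shows "has_RS_integral (\<lambda>s T. T (X s) (Y s)) L 0 t (rs_limit (\<lambda>x s. L s (X x) (Y x)) t)"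
  unfolding has_RS_integral_def
proof (intro allI impI)
  fix e :: real assume e: "e > 0"
  then have "e / 2 > 0" by simp
  from diagonal_riemann_sums[OF X Y this, of t] obtain d where d: "d > 0"
    and D: "\<And>n u \<tau>. tagged_grid t d n u \<tau> \<Longrightarrow>
      norm (tagged_sum (\<lambda>x s. L s (X x) (Y x)) n u \<tau> - rs_limit (\<lambda>x s. L s (X x) (Y x)) t) \<le> e / 2"
    using t by auto
  show "\<exists>d>0. \<forall>n u \<tau>. u 0 = 0 \<and> u n = t \<and>
        (\<forall>i<n. u i < u (Suc i) \<and> u (Suc i) - u i < d \<and> \<tau> i \<in> {u i..u (Suc i)}) \<longrightarrow>
        norm ((\<Sum>i<n. (L (u (Suc i)) - L (u i)) (X (\<tau> i)) (Y (\<tau> i))) - rs_limit (\<lambda>x s. L s (X x) (Y x)) t) < e"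
  proof (intro exI[of _ d] conjI allI impI)
    fix n u \<tau> assume "u 0 = 0 \<and> u n = t \<and>
        (\<forall>i<n. u i < u (Suc i) \<and> u (Suc i) - u i < d \<and> \<tau> i \<in> {u i..u (Suc i)})"
    then have "tagged_grid t d n u \<tau>" unfolding tagged_grid_def by (auto intro: less_imp_le)
    from D[OF this] show "norm ((\<Sum>i<n. (L (u (Suc i)) - L (u i)) (X (\<tau> i)) (Y (\<tau> i))) - rs_limit (\<lambda>x s. L s (X x) (Y x)) t) < e"
      using e by (simp add: tagged_sum_def)
  qed (rule d)
qed

text \<open>Summation by parts: on each cell, the increment of \<open>s \<mapsto> L s [X s, Y s]\<close> is the sum of the
  four increments occurring here, the one of \<open>L\<close> being evaluated at the right endpoint.\<close>

lemma product_rule_sum: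
  assumes u: "\<And>i. 0 \<le> u i"
  shows "(\<Sum>i<n. L (u i) (X (u (Suc i)) - X (u i)) (Y (u (Suc i)) - Y (u i)))
     + (\<Sum>i<n. L (u i) (X (u (Suc i)) - X (u i)) (Y (u i)))
     + (\<Sum>i<n. L (u i) (X (u i)) (Y (u (Suc i)) - Y (u i)))
     = L (u n) (X (u n)) (Y (u n)) - L (u 0) (X (u 0)) (Y (u 0))
       - tagged_sum (\<lambda>x s. L s (X x) (Y x)) n u (\<lambda>i. u (Suc i))"
proof -
  have "L (u n) (X (u n)) (Y (u n)) - L (u 0) (X (u 0)) (Y (u 0)) =
      (\<Sum>i<n. L (u (Suc i)) (X (u (Suc i))) (Y (u (Suc i))) - L (u i) (X (u i)) (Y (u i)))"
    using sum_lessThan_telescope[of "\<lambda>i. L (u i) (X (u i)) (Y (u i))" n] by simp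
  then show ?thesis
    unfolding tagged_sum_def by (simp add: u L_diff_left L_diff_right sum_subtractf)
qed

end

theorem theorem5p3:
  fixes EA :: "'a::cstar_algebra \<Rightarrow> complex" and FA :: "real \<Rightarrow> 'a set"
    and EB :: "'b::cstar_algebra \<Rightarrow> complex" and FB :: "real \<Rightarrow> 'b set"
    and EC :: "'c::cstar_algebra \<Rightarrow> complex" and FC :: "real \<Rightarrow> 'c set"
    and X :: "real \<Rightarrow> 'a" and Y :: "real \<Rightarrow> 'b"
    and L :: "real \<Rightarrow> 'a \<Rightarrow> 'b \<Rightarrow> 'c"
  assumes "filtered_cstar_probability_space EA FA"
    and "filtered_cstar_probability_space EB FB"
    and "filtered_cstar_probability_space EC FC"
    and "Linf_decomposable EA FA X"
    and "Linf_decomposable EB FB Y"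
    and "L \<in> Q0 EA FA EB FB EC FC"
  shows "\<exists>R I J.
    (\<forall>t\<ge>0. has_RS_integral (\<lambda>s T. T (X s) (Y s)) L 0 t (R t)) \<and>
    has_stoch_integral EC (\<lambda>s x. L s x (Y s)) X I \<and>
    has_stoch_integral EC (\<lambda>s y. L s (X s) y) Y J \<and>
    Lp_mesh_limit EC 2 (RS L X Y)
      (\<lambda>t. cmpl_minus (pnorm EC 2)
             (cmpl_minus (pnorm EC 2)
                (cmpl_embed (pnorm EC 2) (L t (X t) (Y t) - L 0 (X 0) (Y 0) - R t))
                (I t))
             (J t))"
proof -
  obtain V where P: "adapted_bilinear_process EA FA EB FB EC FC L V"
    "adapted_bilinear_process EB FB EA FA EC FC (\<lambda>t y x. L t x y) V"
    using Q0_adapted_bilinear_process[OF assms(1-3,6)] .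
  interpret P: adapted_bilinear_process EA FA EB FB EC FC L V by (rule P)
  interpret Q: adapted_bilinear_process EB FB EA FA EC FC "\<lambda>t y x. L t x y" V by (rule P)
  have X: "adapted FA X" "continuous_on {0..} X" and Y: "adapted FB Y" "continuous_on {0..} Y"
    using assms(4,5) Linf_decomposable_continuous unfolding Linf_decomposable_def by blast+
  define SI where "SI \<pi> t = (\<Sum>n. L (\<pi> (n - 1)) (X (min (\<pi> n) t) - X (min (\<pi> (n - 1)) t)) (Y (\<pi> (n - 1))))"
    for \<pi> :: "nat \<Rightarrow> real" and t
  define SJ where "SJ \<pi> t = (\<Sum>n. L (\<pi> (n - 1)) (X (\<pi> (n - 1))) (Y (min (\<pi> n) t) - Y (min (\<pi> (n - 1)) t)))"
    for \<pi> :: "nat \<Rightarrow> real" and t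
  have cI: "P.C.uniformly_cauchy SI"
    unfolding SI_def by (rule P.left_sums_uniformly_cauchy[OF assms(4) Y])
  have cJ: "P.C.uniformly_cauchy SJ"
    unfolding SJ_def by (rule Q.left_sums_uniformly_cauchy[OF assms(5) X])
  define R where "R = rs_limit (\<lambda>x s. L s (X x) (Y x))"
  define D where "D t = L t (X t) (Y t) - L 0 (X 0) (Y 0) - R t" for t
  have sums: "RS L X Y \<pi> t + SI \<pi> t + SJ \<pi> t =
      L t (X t) (Y t) - L 0 (X 0) (Y 0) - tagged_sum (\<lambda>x s. L s (X x) (Y x)) N u (\<lambda>i. u (Suc i))"
    if \<pi>: "is_partition \<pi>" and t: "t \<ge> 0" and N: "t \<le> \<pi> N" and u: "u = (\<lambda>i. min (\<pi> i) t)" for \<pi> t N u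
  proof -
    have "mono \<pi>" using \<pi> by (simp add: is_partition_def strict_mono_mono)
    then have u0: "0 \<le> u i" for i using \<pi> t monoD[of \<pi> 0 i] by (simp add: u is_partition_def)
    have ends: "u 0 = 0" "u N = t" using \<pi> t N by (auto simp: u is_partition_def)
    have "RS L X Y \<pi> t = (\<Sum>i<N. L (u i) (X (u (Suc i)) - X (u i)) (Y (u (Suc i)) - Y (u i)))"
      unfolding RS_def u
      by (rule partition_suminf[OF \<pi> t N, of "\<lambda>r s s'. L r (X s' - X s) (Y s' - Y s)"])
        (simp add: P.L_zero_left)
    moreover have "SI \<pi> t = (\<Sum>i<N. L (u i) (X (u (Suc i)) - X (u i)) (Y (u i)))"
      unfolding SI_def u
      by (rule partition_suminf[OF \<pi> t N, of "\<lambda>r s s'. L r (X s' - X s) (Y r)"])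
        (simp add: P.L_zero_left)
    moreover have "SJ \<pi> t = (\<Sum>i<N. L (u i) (X (u i)) (Y (u (Suc i)) - Y (u i)))"
      unfolding SJ_def u
      by (rule partition_suminf[OF \<pi> t N, of "\<lambda>r s s'. L r (X r) (Y s' - Y s)"])
        (simp add: Q.L_zero_left)
    ultimately show ?thesis using P.product_rule_sum[where u = u and n = N and X = X and Y = Y, OF u0] by (simp add: ends)
  qed
  have lim: "\<exists>d>0. \<forall>\<pi>. is_partition \<pi> \<and> mesh \<pi> < ereal d \<longrightarrow>
      (\<forall>t\<in>{0..T}. P.C.norm2 (RS L X Y \<pi> t + SI \<pi> t + SJ \<pi> t - D t) < e)"
    if e: "e > 0" for T e
  proof -
    have "e / 2 > 0" using e by simp
    from P.diagonal_riemann_sums[OF X(2) Y(2) this, of T] obtain d where d: "d > 0"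
      and R: "\<And>t n u \<tau>. t \<in> {0..T} \<Longrightarrow> tagged_grid t d n u \<tau> \<Longrightarrow>
        norm (tagged_sum (\<lambda>x s. L s (X x) (Y x)) n u \<tau> - R t) \<le> e / 2"
      unfolding R_def by blast
    have "P.C.norm2 (RS L X Y \<pi> t + SI \<pi> t + SJ \<pi> t - D t) < e"
      if \<pi>: "is_partition \<pi>" "mesh \<pi> < ereal d" and t: "t \<in> {0..T}" for \<pi> t
    proof -
      have t0: "t \<ge> 0" using t by simp
      obtain N where N: "t \<le> \<pi> N" using partition_exceeds[OF \<pi>(1)] by blast
      define u where "u = (\<lambda>i. min (\<pi> i) t)"
      have "tagged_grid t d N u (\<lambda>i. u (Suc i))"
        using partition_grid[OF \<pi>(1) t0 N \<pi>(2)] unfolding tagged_grid_def u_def by auto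
      from R[OF t this] have "norm (R t - tagged_sum (\<lambda>x s. L s (X x) (Y x)) N u (\<lambda>i. u (Suc i))) \<le> e / 2"
        by (simp add: norm_minus_commute)
      moreover have "RS L X Y \<pi> t + SI \<pi> t + SJ \<pi> t - D t
          = R t - tagged_sum (\<lambda>x s. L s (X x) (Y x)) N u (\<lambda>i. u (Suc i))"
        unfolding sums[OF \<pi>(1) t0 N u_def] D_def by simp
      ultimately show ?thesis
        using P.C.norm2_le_norm[of "RS L X Y \<pi> t + SI \<pi> t + SJ \<pi> t - D t"] e by simp
    qed
    then show ?thesis using d by blast
  qed
  have "Lp_mesh_limit EC 2 (RS L X Y)
      (\<lambda>t. cmpl_minus (pnorm EC 2) (cmpl_minus (pnorm EC 2) (cmpl_embed (pnorm EC 2) (D t))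
             (P.C.mesh_limit SI t)) (P.C.mesh_limit SJ t))"
    by (rule P.C.Lp_mesh_limit_combine[OF cI cJ, where Sd = "\<lambda>\<pi> t. RS L X Y \<pi> t + SI \<pi> t + SJ \<pi> t"])
      (use lim in auto)
  moreover have "has_stoch_integral EC (\<lambda>s x. L s x (Y s)) X (P.C.mesh_limit SI)"
    using P.C.Lp_mesh_limit_mesh_limit[OF cI] unfolding has_stoch_integral_def SI_def .
  moreover have "has_stoch_integral EC (\<lambda>s y. L s (X s) y) Y (P.C.mesh_limit SJ)"
    using P.C.Lp_mesh_limit_mesh_limit[OF cJ] unfolding has_stoch_integral_def SJ_def .
  moreover have "\<forall>t\<ge>0. has_RS_integral (\<lambda>s T. T (X s) (Y s)) L 0 t (R t)"
    unfolding R_def using P.has_RS_integral_diagonal[OF X(2) Y(2)] by blast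
  ultimately show ?thesis unfolding D_def by blast
qed

end
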